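(* Let $F\in H^2(T_{\Gamma_1})$ and let $\{z^{(k)}\}_{k=1}^\infty\subset T_{\Gamma_1}$ be a sequence (repetitions allowed) each element of which is selected according to the maximal selection principle, i.e. for every $m\ge 0$, $$|\langle F,\mathcal B_{m+1}^{z^{(m+1)}}\rangle|=\max_{z\in T_{\Gamma_1}}|\langle F,\mathcal B_{m+1}^{z}\rangle| .$$ Let $S_m(F)=\sum_{k=1}^m\langle F,\mathcal B_k\rangle\mathcal B_k$. Then $$\|F-S_m(F)\|\to 0\quad\text{as } m\to\infty .$$
   Context: $\Gamma_1=\{y\in\mathbb R^n: y_1>0,\dots,y_n>0\}$ and $T_{\Gamma_1}=\{x+iy: x\in\mathbb R^n,\ y\in\Gamma_1\}\subset\mathbb C^n$. $H^2(T_{\Gamma_1})$ is the space of holomorphic $F$ on $T_{\Gamma_1}$ with $\|F\|^2=\sup_{y\in\Gamma_1}\int_{\mathbb R^n}|F(x+iy)|^2dx<\infty$; it is a Hilbert space with inner product $\langle F,G\rangle=\int_{\mathbb R^n}F(\xi)\overline{G(\xi)}\,d\xi$, where $F(\xi)=\lim_{\eta\in\Gamma_1,\eta\to0}F(\xi+i\eta)$ denotes the $L^2$ boundary limit. It is a reproducing kernel Hilbert space with kernel (Cauchy-Szegő kernel) $K_{\Gamma_1}(w,\overline z)=\prod_{k=1}^n\frac{-1}{2\pi i(w_k-\overline z_k)}$, i.e. $F(z)=\langle F,\phi_z\rangle$ with $\phi_z=K_{\Gamma_1}(\cdot,\overline z)$. Multiple kernels: fix once and for all a direction $\vec d=(d_1,\dots,d_n)\in\mathbb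 C^n$ with $\sum_j|d_j|^2=1$ and put $\vec d\cdot\nabla=\sum_{j=1}^n d_j\frac{\partial}{\partial\overline z_j}$. For a finite or infinite sequence $(z^{(1)},z^{(2)},\dots)$ in $T_{\Gamma_1}$ let $l_k$ be the cardinality of $\{j\le k: z^{(j)}=z^{(k)}\}$ and $$\Phi_{z^{(k)}}=\frac1{(l_k-1)!}(\vec d\cdot\nabla)^{l_k-1}\phi_z\Big|_{z=z^{(k)}}$$ (so $\Phi_{z^{(k)}}=\phi_{z^{(k)}}$ if $z^{(k)}$ occurs for the first time). $\{\mathcal B_k\}$ is the orthonormal system obtained by applying the Gram-Schmidt process (with normalization) to $\Phi_{z^{(1)}},\Phi_{z^{(2)}},\dots$. Given $z^{(1)},\dots,z^{(m)}$ and $z\in T_{\Gamma_1}$, $\mathcal B_{m+1}^z$ denotes the last element of the Gram-Schmidt orthonormalization of $\{\mathcal B_1,\dots,\mathcal B_m,\Phi_z\}$, where $\Phi_z$ is the multiple kernel associated with the last term of the sequence $(z^{(1)},\dots,z^{(m)},z)$; thus $\mathcal B_{m+1}=\mathcal B_{m+1}^{z^{(m+1)}}$. *)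

theory Defs
  imports "HOL-Analysis.Analysis"
begin

definition octant :: "(real ^ 'n) set" where
  "octant = {y. \<forall>k. y $ k > 0}"

definition re_im_vec :: "real ^ 'n \<Rightarrow> real ^ 'n \<Rightarrow> complex ^ 'n" where
  "re_im_vec x y = (\<chi> k. Complex (x $ k) (y $ k))"

definition tube :: "(complex ^ 'n) set" where
  "tube = {re_im_vec x y | x y. y \<in> octant}"

text \<open>Holomorphy in several variables, meant for open sets: the Frechet derivative exists
  and is complex linear. (The library predicate \<open>holomorphic_on\<close> covers one variable only.)\<close>

definition holomorphic_several :: "(complex ^ 'n \<Rightarrow> complex) \<Rightarrow> (complex ^ 'n) set \<Rightarrow> bool" where
  "holomorphic_several F S \<longleftrightarrow>
    (\<forall>z\<in>S. \<exists>F'. (F has_derivative F') (at z) \<and> (\<forall>c v. F' (c *s v) = c * F' v))"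

definition hardy_norm_sq :: "(complex ^ 'n \<Rightarrow> complex) \<Rightarrow> ennreal" where
  "hardy_norm_sq F =
    (SUP y\<in>octant. \<integral>\<^sup>+ x. ennreal ((cmod (F (re_im_vec x y)))\<^sup>2) \<partial>lborel)"

text \<open>Elements of the Hardy space are represented by functions on all of \<open>complex ^ 'n\<close>;
  none of the notions below depends on their values off the tube.\<close>

definition hardy_space :: "(complex ^ 'n \<Rightarrow> complex) set" where
  "hardy_space = {F. holomorphic_several F tube \<and> hardy_norm_sq F < \<infinity>}"

text \<open>Meaningful for members of the Hardy space only: \<open>enn2real\<close> sends \<open>\<infinity>\<close> to 0.\<close>

definition hardy_norm :: "(complex ^ 'n \<Rightarrow> complex) \<Rightarrow> real" where
  "hardy_norm F = sqrt (enn2real (hardy_norm_sq F))"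

definition is_boundary_limit :: "(complex ^ 'n \<Rightarrow> complex) \<Rightarrow> (real ^ 'n \<Rightarrow> complex) \<Rightarrow> bool" where
  "is_boundary_limit F f \<longleftrightarrow>
    f \<in> borel_measurable lborel \<and>
    (\<integral>\<^sup>+ x. ennreal ((cmod (f x))\<^sup>2) \<partial>lborel) < \<infinity> \<and>
    ((\<lambda>y. \<integral>\<^sup>+ x. ennreal ((cmod (F (re_im_vec x y) - f x))\<^sup>2) \<partial>lborel) \<longlongrightarrow> 0)
      (at 0 within octant)"

text \<open>The \<open>L\<^sup>2\<close> boundary limit is unique up to null sets, so the choice of a representative
  does not affect the inner product.\<close>

definition boundary_limit :: "(complex ^ 'n \<Rightarrow> complex) \<Rightarrow> real ^ 'n \<Rightarrow> complex" where
  "boundary_limit F = (SOME f. is_boundary_limit F f)"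

definition hardy_inner ::
    "(complex ^ 'n \<Rightarrow> complex) \<Rightarrow> (complex ^ 'n \<Rightarrow> complex) \<Rightarrow> complex" where
  "hardy_inner F G = (LINT x|lborel. boundary_limit F x * cnj (boundary_limit G x))"

text \<open>The second argument of \<open>cauchy_szego\<close> is the conjugated point.\<close>

definition cauchy_szego :: "complex ^ 'n \<Rightarrow> complex ^ 'n \<Rightarrow> complex" where
  "cauchy_szego w v = (\<Prod>k\<in>UNIV. - 1 / (2 * of_real pi * \<i> * (w $ k - v $ k)))"

definition kernel_at :: "complex ^ 'n \<Rightarrow> complex ^ 'n \<Rightarrow> complex" where
  "kernel_at z = (\<lambda>w. cauchy_szego w (\<chi> k. cnj (z $ k)))"

text \<open>The Wirtinger derivative with respect to the conjugate of the \<open>j\<close>-th coordinate: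
  half of (the x-partial plus \<open>\<i>\<close> times the y-partial).\<close>

definition dbar :: "'n \<Rightarrow> (complex ^ 'n \<Rightarrow> complex) \<Rightarrow> complex ^ 'n \<Rightarrow> complex" where
  "dbar j g z =
    (vector_derivative (\<lambda>t::real. g (z + t *\<^sub>R axis j 1)) (at 0)
      + \<i> * vector_derivative (\<lambda>t::real. g (z + t *\<^sub>R axis j \<i>)) (at 0)) / 2"

definition dir_dbar ::
    "complex ^ 'n \<Rightarrow> (complex ^ 'n \<Rightarrow> complex) \<Rightarrow> complex ^ 'n \<Rightarrow> complex" where
  "dir_dbar d g = (\<lambda>z. \<Sum>j\<in>UNIV. d $ j * dbar j g z)"

text \<open>Sequences are indexed from 0, so that \<open>zs k\<close> is the point number \<open>k + 1\<close>; likewise for the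
  kernels and the orthonormal system.\<close>

definition multiplicity_at :: "(nat \<Rightarrow> 'a) \<Rightarrow> nat \<Rightarrow> nat" where
  "multiplicity_at zs k = card {j. j \<le> k \<and> zs j = zs k}"

text \<open>The iterated derivative acts on the parameter point of the kernel, for fixed \<open>w\<close>.\<close>

definition multiple_kernel ::
    "complex ^ 'n \<Rightarrow> (nat \<Rightarrow> complex ^ 'n) \<Rightarrow> nat \<Rightarrow> complex ^ 'n \<Rightarrow> complex" where
  "multiple_kernel d zs k =
    (let l = multiplicity_at zs k in
      (\<lambda>w. (dir_dbar d ^^ (l - 1)) (\<lambda>z. kernel_at z w) (zs k) / fact (l - 1)))"

fun gram_schmidt ::
    "(nat \<Rightarrow> complex ^ 'n \<Rightarrow> complex) \<Rightarrow> nat \<Rightarrow> complex ^ 'n \<Rightarrow> complex" where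
  "gram_schmidt V k =
    (let u = (\<lambda>w. V k w - (\<Sum>j<k. hardy_inner (V k) (gram_schmidt V j) * gram_schmidt V j w))
     in (\<lambda>w. u w / of_real (hardy_norm u)))"

declare gram_schmidt.simps [simp del]

definition orthonormal_system ::
    "complex ^ 'n \<Rightarrow> (nat \<Rightarrow> complex ^ 'n) \<Rightarrow> nat \<Rightarrow> complex ^ 'n \<Rightarrow> complex" where
  "orthonormal_system d zs = gram_schmidt (multiple_kernel d zs)"

text \<open>\<open>candidate d zs m z\<close> is the last element of the orthonormalization of the first \<open>m\<close>
  members of the system followed by the multiple kernel of the last term of
  \<open>zs 0, \<dots>, zs (m - 1), z\<close>; entries from index \<open>m + 1\<close> on play no role.\<close>

definition candidate ::
    "complex ^ 'n \<Rightarrow> (nat \<Rightarrow> complex ^ 'n) \<Rightarrow> nat \<Rightarrow> complex ^ 'n \<Rightarrow> complex ^ 'n \<Rightarrow> complex" where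
  "candidate d zs m z =
    gram_schmidt ((orthonormal_system d zs)(m := multiple_kernel d (zs(m := z)) m)) m"

definition partial_sum ::
    "complex ^ 'n \<Rightarrow> (nat \<Rightarrow> complex ^ 'n) \<Rightarrow> (complex ^ 'n \<Rightarrow> complex) \<Rightarrow> nat
      \<Rightarrow> complex ^ 'n \<Rightarrow> complex" where
  "partial_sum d zs F m =
    (\<lambda>w. \<Sum>k<m. hardy_inner F (orthonormal_system d zs k) * orthonormal_system d zs k w)"

end

theory Submission
  imports Defs "HOL-Complex_Analysis.Cauchy_Integral_Theorem"
begin

text \<open>For \<open>F\<close>, \<open>G\<close> in the Hardy space, Cauchy's theorem averaged over horizontal translates shows
  that the inner product of the slices \<open>F(\<cdot> + i y)\<close> and \<open>G(\<cdot> + i y')\<close> depends only on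
  \<open>y + y'\<close>. With \<open>N(y)\<close> the squared norm of the slice at \<open>y\<close>, the squared distance of two slices
  is therefore \<open>N(y) + N(y') - 2 N((y + y')/2)\<close>. So \<open>N\<close> is midpoint convex and, being bounded, is
  decreasing; the slices are thus Cauchy as \<open>y\<close> tends to 0, which gives the boundary limits and
  identifies the norm with that of the boundary function. The reproducing formula follows by
  replacing the Cauchy kernel by the Poisson kernel, one coordinate at a time.

  Let \<open>R m\<close> be the residual after \<open>m\<close> steps. For a point \<open>a\<close> of the tube outside the
  sequence, \<open>|R m a| = |\<langle>R m, kernel_at a\<rangle>|\<close> is at most the norm of \<open>kernel_at a\<close> times
  \<open>|\<langle>F, candidate at a\<rangle>|\<close>, hence by maximality at most that norm times
  \<open>|\<langle>F, B m\<rangle>|\<close>, which tends to 0. So \<open>R l\<close> tends to 0 almost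
  everywhere on each slice, and Fatou's lemma bounds the squared norm of \<open>R m\<close> by the limit of
  that of \<open>R m - R l\<close>, i.e. by \<open>b m - lim b\<close> where \<open>b m\<close> is the squared norm of \<open>R m\<close>. Hence
  \<open>lim b = 0\<close>.\<close>

section \<open>Square-integrable functions\<close>

text \<open>The norm is a supremum over slices, whereas the inner product integrates boundary
  functions fixed only up to null sets. Until \<open>hardy_inner F F\<close> is known to be the
  squared norm, no Hilbert space argument is available, and this is what the study of slices is for.
  Since point values matter in the end, L2 is kept as a predicate on functions instead of a space of
  classes.

  Points of the sequence must be avoided: once a point has been chosen, its candidate is built from
  a derivative of the kernel, so maximality no longer says anything about point evaluation there.
  The sequence is countable and hence meets every slice in a null set. As only almost every point
  counts, a reproducing formula valid almost everywhere on each slice suffices. It needs no more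
  than L2 convergence of Poisson averages, which comes from L2 continuity of translations.

  Fatou's lemma takes the place of weak compactness: pointwise convergence of the residuals to 0
  together with the Pythagorean identity \<open>b m - b l\<close> forces the limit of their norms to
  vanish.\<close>

definition square_integrable :: "'a measure \<Rightarrow> ('a \<Rightarrow> complex) \<Rightarrow> bool" where
  "square_integrable M f \<longleftrightarrow> f \<in> borel_measurable M \<and> integrable M (\<lambda>x. (cmod (f x))\<^sup>2)"

definition l2_inner :: "'a measure \<Rightarrow> ('a \<Rightarrow> complex) \<Rightarrow> ('a \<Rightarrow> complex) \<Rightarrow> complex" where
  "l2_inner M f g = (\<integral>x. f x * cnj (g x) \<partial>M)"

definition l2_sq :: "'a measure \<Rightarrow> ('a \<Rightarrow> complex) \<Rightarrow> real" where
  "l2_sq M f = (\<integral>x. (cmod (f x))\<^sup>2 \<partial>M)"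

lemma square_integrable_measurable [measurable_dest]:
  "square_integrable M f \<Longrightarrow> f \<in> borel_measurable M"
  by (simp add: square_integrable_def)

lemma l2_sq_nonneg [simp]: "0 \<le> l2_sq M f"
  by (simp add: l2_sq_def)

lemma nn_integral_l2_sq:
  assumes "square_integrable M f"
  shows "(\<integral>\<^sup>+x. ennreal ((cmod (f x))\<^sup>2) \<partial>M) = ennreal (l2_sq M f)"
  using assms unfolding square_integrable_def l2_sq_def
  by (intro nn_integral_eq_integral) auto

lemma square_integrableI_nn:
  assumes "f \<in> borel_measurable M" "(\<integral>\<^sup>+x. ennreal ((cmod (f x))\<^sup>2) \<partial>M) < \<infinity>"
  shows "square_integrable M f"
  using assms unfolding square_integrable_def
  by (auto intro!: integrableI_bounded)

lemma square_integrable_bound: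
  assumes "g \<in> borel_measurable M" "square_integrable M f"
    and "AE x in M. (cmod (g x))\<^sup>2 \<le> C * (cmod (f x))\<^sup>2"
  shows "square_integrable M g"
proof -
  have "integrable M (\<lambda>x. C * (cmod (f x))\<^sup>2)"
    using assms by (auto simp: square_integrable_def)
  then have "integrable M (\<lambda>x. (cmod (g x))\<^sup>2)"
    by (rule Bochner_Integration.integrable_bound) (use assms in \<open>auto simp: abs_real_def\<close>)
  with assms show ?thesis by (simp add: square_integrable_def)
qed

lemma cmod_add_sq_le: "(cmod (a + b))\<^sup>2 \<le> 2 * (cmod a)\<^sup>2 + 2 * (cmod b)\<^sup>2"
proof -
  have "(cmod (a + b))\<^sup>2 \<le> (cmod a + cmod b)\<^sup>2"
    by (intro power_mono norm_triangle_ineq) auto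
  also have "\<dots> \<le> 2 * (cmod a)\<^sup>2 + 2 * (cmod b)\<^sup>2"
    using sum_squares_bound[of "cmod a" "cmod b"] by (simp add: power2_sum)
  finally show ?thesis .
qed

lemma cmod_diff_sq_le: "(cmod (a - b))\<^sup>2 \<le> 2 * (cmod a)\<^sup>2 + 2 * (cmod b)\<^sup>2"
  using cmod_add_sq_le[of a "-b"] by simp

lemma square_integrable_add:
  assumes "square_integrable M f" "square_integrable M g"
  shows "square_integrable M (\<lambda>x. f x + g x)"
proof -
  have "integrable M (\<lambda>x. 2 * (cmod (f x))\<^sup>2 + 2 * (cmod (g x))\<^sup>2)"
    using assms by (auto simp: square_integrable_def)
  then have "integrable M (\<lambda>x. (cmod (f x + g x))\<^sup>2)"
    by (rule Bochner_Integration.integrable_bound)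
       (use assms cmod_add_sq_le in \<open>auto simp: square_integrable_def\<close>)
  moreover have "(\<lambda>x. f x + g x) \<in> borel_measurable M"
    using assms by (intro borel_measurable_add) (auto simp: square_integrable_def)
  ultimately show ?thesis by (simp add: square_integrable_def)
qed

lemma square_integrable_cmult:
  assumes "square_integrable M f"
  shows "square_integrable M (\<lambda>x. c * f x)"
  using assms by (auto simp: square_integrable_def norm_mult power_mult_distrib)

lemma square_integrable_diff:
  assumes "square_integrable M f" "square_integrable M g"
  shows "square_integrable M (\<lambda>x. f x - g x)"
  using square_integrable_add[OF assms(1) square_integrable_cmult[OF assms(2), of "-1"]] by simp

lemma square_integrable_zero [simp]: "square_integrable M (\<lambda>x. 0)"
  by (simp add: square_integrable_def)

lemma integrable_cmod_mult:
  assumes "square_integrable M f" "square_integrable M g"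
  shows "integrable M (\<lambda>x. cmod (f x) * cmod (g x))"
proof -
  have "integrable M (\<lambda>x. (cmod (f x))\<^sup>2 + (cmod (g x))\<^sup>2)"
    using assms by (auto simp: square_integrable_def)
  then show ?thesis
  proof (rule Bochner_Integration.integrable_bound)
    show "AE x in M. norm (cmod (f x) * cmod (g x)) \<le> norm ((cmod (f x))\<^sup>2 + (cmod (g x))\<^sup>2)"
    proof (rule AE_I2)
      fix x
      have "2 * (cmod (f x) * cmod (g x)) \<le> (cmod (f x))\<^sup>2 + (cmod (g x))\<^sup>2"
        using sum_squares_bound[of "cmod (f x)" "cmod (g x)"] by simp
      moreover have "0 \<le> cmod (f x) * cmod (g x)" by simp
      ultimately show "norm (cmod (f x) * cmod (g x)) \<le> norm ((cmod (f x))\<^sup>2 + (cmod (g x))\<^sup>2)"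
        unfolding real_norm_def by linarith
    qed
  qed (use assms in \<open>auto simp: square_integrable_def\<close>)
qed

lemma square_integrable_mult:
  assumes "square_integrable M f" "square_integrable M g"
  shows "integrable M (\<lambda>x. f x * g x)"
  by (rule Bochner_Integration.integrable_bound[OF integrable_cmod_mult[OF assms]])
     (use assms in \<open>auto simp: square_integrable_def norm_mult\<close>)

lemma square_integrable_cnj:
  "square_integrable M f \<Longrightarrow> square_integrable M (\<lambda>x. cnj (f x))"
  unfolding square_integrable_def complex_mod_cnj
  using measurable_compose[OF _ borel_measurable_continuous_onI[OF continuous_on_cnj[OF continuous_on_id]], of f M]
  by blast

lemma l2_inner_integrable:
  assumes "square_integrable M f" "square_integrable M g"
  shows "integrable M (\<lambda>x. f x * cnj (g x))"
  using square_integrable_mult[OF assms(1) square_integrable_cnj[OF assms(2)]] .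

text \<open>The quadratic polynomial given by the integral of (s |f| - |g|)^2 is nonnegative in s.
  If its leading coefficient vanishes it is affine in s and must be constant. Moduli are kept
  because bounds on integrals of absolute values are needed as well.\<close>

lemma l2_Cauchy_Schwarz_abs:
  assumes f: "square_integrable M f" and g: "square_integrable M g"
  shows "(\<integral>x. cmod (f x) * cmod (g x) \<partial>M)\<^sup>2 \<le> l2_sq M f * l2_sq M g"
proof -
  define I where "I = (\<integral>x. cmod (f x) * cmod (g x) \<partial>M)"
  define A where "A = l2_sq M f"
  define B where "B = l2_sq M g"
  have q: "0 \<le> A * s\<^sup>2 - 2 * I * s + B" for s
  proof -
    have "0 \<le> (\<integral>x. (cmod (f x) * s - cmod (g x))\<^sup>2 \<partial>M)" by simp
    also have "\<dots> = (\<integral>x. s\<^sup>2 * (cmod (f x))\<^sup>2 - 2 * s * (cmod (f x) * cmod (g x)) + (cmod (g x))\<^sup>2 \<partial>M)"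
      by (intro Bochner_Integration.integral_cong) (auto simp: power2_eq_square algebra_simps)
    also have "\<dots> = s\<^sup>2 * A - 2 * s * I + B"
      unfolding A_def B_def I_def l2_sq_def
      using f g integrable_cmod_mult[OF f g] unfolding square_integrable_def
      by (subst Bochner_Integration.integral_add Bochner_Integration.integral_diff; simp)+
    finally show ?thesis by (simp add: algebra_simps)
  qed
  have A0: "0 \<le> A" and B0: "0 \<le> B" by (simp_all add: A_def B_def)
  show ?thesis
  proof (cases "A = 0")
    case True
    have "I = 0"
    proof (rule ccontr)
      assume "I \<noteq> 0"
      \<comment> \<open>With \<open>A = 0\<close> this s makes the polynomial equal to -(B + 1) + B
        = -1.\<close>
      with q[of "(B + 1) / (2 * I)"] True show False by (simp add: field_simps)
    qed
    then show ?thesis using True by (simp add: I_def A_def)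
  next
    case False
    with A0 have "A > 0" by simp
    \<comment> \<open>The minimiser of the quadratic.\<close>
    with q[of "I / A"] have "I\<^sup>2 \<le> A * B" by (simp add: field_simps power2_eq_square)
    then show ?thesis by (simp add: I_def A_def B_def)
  qed
qed

lemma l2_Cauchy_Schwarz:
  assumes f: "square_integrable M f" and g: "square_integrable M g"
  shows "cmod (l2_inner M f g) \<le> sqrt (l2_sq M f) * sqrt (l2_sq M g)"
proof -
  have "cmod (l2_inner M f g) \<le> (\<integral>x. norm (f x * cnj (g x)) \<partial>M)"
    unfolding l2_inner_def by (rule integral_norm_bound)
  also have "\<dots> = (\<integral>x. cmod (f x) * cmod (g x) \<partial>M)" by (simp add: norm_mult)
  also have "\<dots> \<le> sqrt (l2_sq M f * l2_sq M g)"
    using l2_Cauchy_Schwarz_abs[OF f g] by (rule real_le_rsqrt)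
  finally show ?thesis by (simp add: real_sqrt_mult)
qed

lemma l2_inner_self: "l2_inner M f f = of_real (l2_sq M f)"
  by (simp add: l2_inner_def l2_sq_def complex_norm_square[symmetric] flip: of_real_power)

lemma l2_inner_cnj: "cnj (l2_inner M f g) = l2_inner M g f"
  by (simp add: l2_inner_def mult.commute flip: Bochner_Integration.integral_cnj)

lemma l2_inner_diff:
  assumes "square_integrable M f" "square_integrable M g" "square_integrable M h"
  shows "l2_inner M (\<lambda>x. f x - g x) h = l2_inner M f h - l2_inner M g h"
  using assms by (simp add: l2_inner_def left_diff_distrib l2_inner_integrable)

lemma l2_inner_diff_right:
  assumes "square_integrable M f" "square_integrable M g" "square_integrable M h"
  shows "l2_inner M h (\<lambda>x. f x - g x) = l2_inner M h f - l2_inner M h g"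
  using assms by (simp add: l2_inner_def right_diff_distrib l2_inner_integrable)

lemma l2_inner_cmult: "l2_inner M (\<lambda>x. c * f x) h = c * l2_inner M f h"
  by (simp add: l2_inner_def mult.assoc)

lemma l2_sq_diff:
  assumes f: "square_integrable M f" and g: "square_integrable M g"
  shows "l2_sq M (\<lambda>x. f x - g x) = l2_sq M f + l2_sq M g - 2 * Re (l2_inner M f g)"
proof -
  have "complex_of_real (l2_sq M (\<lambda>x. f x - g x)) =
    of_real (l2_sq M f) + of_real (l2_sq M g) - (l2_inner M f g + cnj (l2_inner M f g))"
    using f g square_integrable_diff[OF f g]
    by (simp add: l2_inner_self[symmetric] l2_inner_diff l2_inner_diff_right l2_inner_cnj)
  also have "l2_inner M f g + cnj (l2_inner M f g) = of_real (2 * Re (l2_inner M f g))"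
    by (simp add: complex_add_cnj)
  finally show ?thesis
    by (simp only: of_real_add[symmetric] of_real_diff[symmetric] of_real_eq_iff)
qed

lemma l2_inner_tendsto:
  assumes f: "\<And>n. square_integrable M (f n)" "square_integrable M f'"
    and g: "\<And>n. square_integrable M (g n)" "square_integrable M g'"
    and lf: "(\<lambda>n. l2_sq M (\<lambda>x. f n x - f' x)) \<longlonglongrightarrow> 0"
    and lg: "(\<lambda>n. l2_sq M (\<lambda>x. g n x - g' x)) \<longlonglongrightarrow> 0"
  shows "(\<lambda>n. l2_inner M (f n) (g n)) \<longlonglongrightarrow> l2_inner M f' g'"
proof -
  define a where "a n = sqrt (l2_sq M (\<lambda>x. f n x - f' x))" for n
  define b where "b n = sqrt (l2_sq M (\<lambda>x. g n x - g' x))" for n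
  have a: "a \<longlonglongrightarrow> 0" and b: "b \<longlonglongrightarrow> 0"
    using tendsto_real_sqrt[OF lf] tendsto_real_sqrt[OF lg]
    unfolding a_def[abs_def] b_def[abs_def] real_sqrt_zero by this+
  note df = square_integrable_diff[OF f(1) f(2)] and dg = square_integrable_diff[OF g(1) g(2)]
  have bd: "cmod (l2_inner M (f n) (g n) - l2_inner M f' g') \<le>
      a n * b n + a n * sqrt (l2_sq M g') + sqrt (l2_sq M f') * b n" for n
  proof -
    \<comment> \<open>Product of the two errors plus the two mixed terms; each tends to 0 by
      Cauchy-Schwarz.\<close>
    have eq: "l2_inner M (f n) (g n) - l2_inner M f' g' =
      l2_inner M (\<lambda>x. f n x - f' x) (\<lambda>x. g n x - g' x) + l2_inner M (\<lambda>x. f n x - f' x) g'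
      + l2_inner M f' (\<lambda>x. g n x - g' x)"
      by (simp add: l2_inner_diff[OF f(1) f(2) dg] l2_inner_diff[OF f(1) f(2) g(2)]
          l2_inner_diff_right[OF g(1) g(2) f(1)] l2_inner_diff_right[OF g(1) g(2) f(2)])
    have "cmod (l2_inner M (f n) (g n) - l2_inner M f' g') \<le>
      cmod (l2_inner M (\<lambda>x. f n x - f' x) (\<lambda>x. g n x - g' x))
      + cmod (l2_inner M (\<lambda>x. f n x - f' x) g') + cmod (l2_inner M f' (\<lambda>x. g n x - g' x))"
      unfolding eq by (rule norm_triangle_le[OF add_right_mono[OF norm_triangle_ineq]])
    also have "\<dots> \<le> a n * b n + a n * sqrt (l2_sq M g') + sqrt (l2_sq M f') * b n"
      unfolding a_def b_def
      by (intro add_mono l2_Cauchy_Schwarz df dg f g)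
    finally show ?thesis .
  qed
  have "(\<lambda>n. a n * b n + a n * sqrt (l2_sq M g') + sqrt (l2_sq M f') * b n) \<longlonglongrightarrow> 0"
    using tendsto_add[OF tendsto_add[OF tendsto_mult[OF a b] tendsto_mult_right[OF a, of "sqrt (l2_sq M g')"]]
        tendsto_mult_left[OF b, of "sqrt (l2_sq M f')"]] by simp
  then have "(\<lambda>n. l2_inner M (f n) (g n) - l2_inner M f' g') \<longlonglongrightarrow> 0"
    by (rule Lim_null_comparison[OF always_eventually[OF allI[OF bd]]])
  then show ?thesis by (simp add: LIM_zero_iff)
qed

text \<open>Stated with nonnegative integrals, so that square integrability of the limit is a
  possible consequence and not a premise.\<close>

lemma l2_Fatou:
  assumes [measurable]: "\<And>n. f n \<in> borel_measurable M" "g \<in> borel_measurable M"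
    and "AE x in M. (\<lambda>n. f n x) \<longlonglongrightarrow> g x"
  shows "(\<integral>\<^sup>+x. ennreal ((cmod (g x))\<^sup>2) \<partial>M) \<le>
    liminf (\<lambda>n. \<integral>\<^sup>+x. ennreal ((cmod (f n x))\<^sup>2) \<partial>M)"
proof -
  have "AE x in M. ennreal ((cmod (g x))\<^sup>2) = liminf (\<lambda>n. ennreal ((cmod (f n x))\<^sup>2))"
    using assms(3)
  proof eventually_elim
    case (elim x)
    then have "(\<lambda>n. ennreal ((cmod (f n x))\<^sup>2)) \<longlonglongrightarrow> ennreal ((cmod (g x))\<^sup>2)"
      by (intro tendsto_intros tendsto_ennrealI)
    then have "liminf (\<lambda>n. ennreal ((cmod (f n x))\<^sup>2)) = ennreal ((cmod (g x))\<^sup>2)"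
      by (rule lim_imp_Liminf[OF trivial_limit_sequentially])
    then show ?case by (rule sym)
  qed
  then have "(\<integral>\<^sup>+x. ennreal ((cmod (g x))\<^sup>2) \<partial>M) = (\<integral>\<^sup>+x. liminf (\<lambda>n. ennreal ((cmod (f n x))\<^sup>2)) \<partial>M)"
    by (rule nn_integral_cong_AE)
  also have "\<dots> \<le> liminf (\<lambda>n. \<integral>\<^sup>+x. ennreal ((cmod (f n x))\<^sup>2) \<partial>M)"
    by (rule nn_integral_liminf) simp
  finally show ?thesis .
qed

lemma liminf_le_const:
  fixes a :: "nat \<Rightarrow> ennreal"
  assumes "\<And>n. n \<ge> N \<Longrightarrow> a n \<le> c"
  shows "liminf a \<le> c"
proof -
  have "liminf a \<le> limsup a" by (simp add: Liminf_le_Limsup)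
  also have "\<dots> \<le> c" using assms by (intro Limsup_bounded) (auto simp: eventually_sequentially)
  finally show ?thesis .
qed

text \<open>Fatou for \<open>f n - h\<close>: the pointwise limit \<open>g - h\<close> has zero L2
  norm.\<close>

lemma l2_limit_AE_unique:
  assumes [measurable]: "\<And>n. f n \<in> borel_measurable M" "g \<in> borel_measurable M" "h \<in> borel_measurable M"
    and lim: "AE x in M. (\<lambda>n. f n x) \<longlonglongrightarrow> g x"
    and l2: "(\<lambda>n. \<integral>\<^sup>+x. ennreal ((cmod (f n x - h x))\<^sup>2) \<partial>M) \<longlonglongrightarrow> 0"
  shows "AE x in M. g x = h x"
proof -
  have "(\<integral>\<^sup>+x. ennreal ((cmod (g x - h x))\<^sup>2) \<partial>M) \<le>
    liminf (\<lambda>n. \<integral>\<^sup>+x. ennreal ((cmod (f n x - h x))\<^sup>2) \<partial>M)"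
    by (rule l2_Fatou) (auto intro!: eventually_mono[OF lim] tendsto_diff tendsto_const)
  also have "\<dots> = 0" using l2 by (simp add: lim_imp_Liminf)
  finally have "AE x in M. ennreal ((cmod (g x - h x))\<^sup>2) = 0"
    by (subst (asm) le_zero_eq, subst (asm) nn_integral_0_iff_AE) auto
  then show ?thesis by eventually_elim simp
qed

text \<open>Riesz-Fischer: a rapidly Cauchy subsequence converges almost everywhere, and Fatou
  transfers the Cauchy estimate of the whole sequence to its pointwise limit.\<close>

lemma l2_complete:
  assumes f: "\<And>n. square_integrable M (f n)"
    and cauchy: "\<And>e::real. e > 0 \<Longrightarrow> \<exists>N. \<forall>m\<ge>N. \<forall>n\<ge>N. l2_sq M (\<lambda>x. f m x - f n x) \<le> e"
  shows "\<exists>g. square_integrable M g \<and> (\<lambda>n. l2_sq M (\<lambda>x. f n x - g x)) \<longlonglongrightarrow> 0"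
proof -
  have [measurable]: "f n \<in> borel_measurable M" for n
    using f by (simp add: square_integrable_def)
  \<comment> \<open>The ratio 1/8 leaves room for the weights 4^k below: the weighted integrals are
    still summable like (1/2)^k, while boundedness of 4^k |D k|^2 by 1 gives |D k| \<le>
    (1/2)^k.\<close>
  have "\<forall>k. \<exists>N. \<forall>m\<ge>N. \<forall>n\<ge>N. l2_sq M (\<lambda>x. f m x - f n x) \<le> (1/8)^k"
    using cauchy[of "(1/8)^k" for k] by simp
  then obtain N where N: "\<And>k m n. m \<ge> N k \<Longrightarrow> n \<ge> N k \<Longrightarrow> l2_sq M (\<lambda>x. f m x - f n x) \<le> (1/8)^k"
    by metis
  \<comment> \<open>Summing the thresholds makes \<open>r k\<close> and \<open>r (Suc k)\<close>
    both exceed \<open>N k\<close>; the summand \<open>k\<close> makes \<open>r\<close> tend to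
    infinity.\<close>
  define r where "r k = (\<Sum>i\<le>k. N i) + k" for k
  have r: "r k \<ge> N k" "r (Suc k) \<ge> N k" "r k \<ge> k" for k
  proof -
    have *: "N k \<le> (\<Sum>i\<le>m. N i)" if "k \<le> m" for k m
      using that by (intro member_le_sum) auto
    show "r k \<ge> N k" "r (Suc k) \<ge> N k" "r k \<ge> k"
      using *[of k k] *[of k "Suc k"] unfolding r_def by linarith+
  qed
  define D where "D k x = f (r (Suc k)) x - f (r k) x" for k x
  have [measurable]: "D k \<in> borel_measurable M" for k unfolding D_def by measurable
  have sD: "square_integrable M (D k)" for k
    unfolding D_def by (intro square_integrable_diff f)
  have Dk: "l2_sq M (D k) \<le> (1/8)^k" for k
    unfolding D_def by (intro N r)
  have "(\<integral>\<^sup>+x. (\<Sum>k. ennreal (4^k * (cmod (D k x))\<^sup>2)) \<partial>M) = (\<Sum>k. \<integral>\<^sup>+x. ennreal (4^k * (cmod (D k x))\<^sup>2) \<partial>M)"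
    by (rule nn_integral_suminf) simp
  also have "\<dots> \<le> (\<Sum>k. ennreal ((1/2)^k))"
  proof (intro suminf_le allI)
    fix k
    have "(\<integral>\<^sup>+x. ennreal (4^k * (cmod (D k x))\<^sup>2) \<partial>M) = ennreal (4^k) * ennreal (l2_sq M (D k))"
      by (simp add: ennreal_mult nn_integral_cmult nn_integral_l2_sq[OF sD])
    also have "\<dots> = ennreal (4^k * l2_sq M (D k))" by (simp add: ennreal_mult)
    also have "\<dots> \<le> ennreal (4^k * (1/8)^k)" by (intro ennreal_leI mult_left_mono Dk) simp
    also have "4^k * (1/8)^k = ((1/2)^k :: real)" by (simp add: power_mult_distrib[symmetric])
    finally show "(\<integral>\<^sup>+x. ennreal (4^k * (cmod (D k x))\<^sup>2) \<partial>M) \<le> ennreal ((1/2)^k)" .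
  qed auto
  also have "\<dots> < \<infinity>"
    by (subst suminf_ennreal2) (auto simp: less_top)
  finally have "AE x in M. (\<Sum>k. ennreal (4^k * (cmod (D k x))\<^sup>2)) \<noteq> \<infinity>"
    by (intro nn_integral_PInf_AE) auto
  then have conv: "AE x in M. convergent (\<lambda>k. f (r k) x)"
  proof eventually_elim
    case (elim x)
    have sm: "summable (\<lambda>k. 4^k * (cmod (D k x))\<^sup>2)"
      using elim by (intro summable_suminf_not_top) (auto simp: less_top)
    then have "(\<lambda>k. 4^k * (cmod (D k x))\<^sup>2) \<longlonglongrightarrow> 0" by (rule summable_LIMSEQ_zero)
    then have "\<forall>\<^sub>F k in sequentially. 4^k * (cmod (D k x))\<^sup>2 < 1"
      by (rule order_tendstoD) simp
    then have "\<forall>\<^sub>F k in sequentially. norm (D k x) \<le> (1/2)^k"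
    proof eventually_elim
      case (elim k)
      have "(2^k * cmod (D k x))\<^sup>2 = 4^k * (cmod (D k x))\<^sup>2"
        by (simp add: power_mult_distrib power_mult[symmetric] mult.commute[of k] power_mult)
      with elim have "(2^k * cmod (D k x))\<^sup>2 \<le> 1\<^sup>2" by simp
      then have "2^k * cmod (D k x) \<le> 1" by (rule power2_le_imp_le) simp
      then show ?case by (simp add: field_simps)
    qed
    then have "summable (\<lambda>k. D k x)"
      by (rule summable_comparison_test_ev) (simp add: summable_geometric)
    then have "convergent (\<lambda>n. \<Sum>k<n. D k x)" by (simp add: summable_iff_convergent)
    then have "convergent (\<lambda>n. (\<Sum>k<n. D k x) + f (r 0) x)"
      by (intro convergent_add convergent_const)
    also have "(\<lambda>n. (\<Sum>k<n. D k x) + f (r 0) x) = (\<lambda>k. f (r k) x)"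
      unfolding D_def by (subst sum_lessThan_telescope) simp
    finally show ?case .
  qed
  define g where "g x = lim (\<lambda>k. f (r k) x)" for x
  have [measurable]: "g \<in> borel_measurable M" unfolding g_def by measurable
  have lim: "AE x in M. (\<lambda>k. f (r k) x) \<longlonglongrightarrow> g x"
    using conv by eventually_elim (simp add: g_def convergent_LIMSEQ_iff)
  have fg: "(\<integral>\<^sup>+x. ennreal ((cmod (f n x - g x))\<^sup>2) \<partial>M) \<le> ennreal e"
    if e: "\<And>m. m \<ge> n \<Longrightarrow> l2_sq M (\<lambda>x. f n x - f m x) \<le> e" for n e
  proof -
    have "(\<integral>\<^sup>+x. ennreal ((cmod (f n x - g x))\<^sup>2) \<partial>M) \<le>
      liminf (\<lambda>k. \<integral>\<^sup>+x. ennreal ((cmod (f n x - f (r k) x))\<^sup>2) \<partial>M)"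
      by (rule l2_Fatou) (auto intro!: eventually_mono[OF lim] tendsto_diff tendsto_const)
    also have "\<dots> \<le> ennreal e"
    proof (rule liminf_le_const)
      fix k assume "k \<ge> n"
      then have "r k \<ge> n" using r(3)[of k] by simp
      then show "(\<integral>\<^sup>+x. ennreal ((cmod (f n x - f (r k) x))\<^sup>2) \<partial>M) \<le> ennreal e"
        by (subst nn_integral_l2_sq) (auto intro!: square_integrable_diff f ennreal_leI e)
    qed
    finally show ?thesis .
  qed
  \<comment> \<open>Past \<open>N 0\<close> all squared distances are at most (1/8)^0 = 1, so
    \<open>g\<close> differs from one member of the sequence by a square-integrable
    function.\<close>
  have sfg: "square_integrable M (\<lambda>x. f (N 0) x - g x)"
  proof (rule square_integrableI_nn)
    have "(\<integral>\<^sup>+x. ennreal ((cmod (f (N 0) x - g x))\<^sup>2) \<partial>M) \<le> ennreal 1"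
      using N[of 0] by (intro fg) auto
    then show "(\<integral>\<^sup>+x. ennreal ((cmod (f (N 0) x - g x))\<^sup>2) \<partial>M) < \<infinity>"
      by (rule le_less_trans) simp
  qed simp
  have sg: "square_integrable M g"
    using square_integrable_diff[OF f[of "N 0"] sfg] by simp
  have "(\<lambda>n. l2_sq M (\<lambda>x. f n x - g x)) \<longlonglongrightarrow> 0"
  proof (rule LIMSEQ_I)
    fix e :: real assume "e > 0"
    then obtain K where K: "\<And>m n. m \<ge> K \<Longrightarrow> n \<ge> K \<Longrightarrow> l2_sq M (\<lambda>x. f m x - f n x) \<le> e/2"
      using cauchy[of "e/2"] by auto
    have "l2_sq M (\<lambda>x. f n x - g x) \<le> e/2" if "n \<ge> K" for n
    proof -
      have "ennreal (l2_sq M (\<lambda>x. f n x - g x)) \<le> ennreal (e/2)"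
        using fg[of n "e/2"] K that by (simp add: nn_integral_l2_sq[OF square_integrable_diff[OF f sg]])
      then show ?thesis using \<open>e > 0\<close> by simp
    qed
    then show "\<exists>K. \<forall>n\<ge>K. norm (l2_sq M (\<lambda>x. f n x - g x) - 0) < e"
      using \<open>e > 0\<close> by (intro exI[of _ K]) force
  qed
  with sg show ?thesis by blast
qed

section \<open>Tube domain and contour shift\<close>

lemma re_im_vec_nth [simp]: "re_im_vec x y $ k = Complex (x $ k) (y $ k)"
  by (simp add: re_im_vec_def)

lemma tube_iff: "z \<in> tube \<longleftrightarrow> (\<forall>k. 0 < Im (z $ k))"
proof
  assume "\<forall>k. 0 < Im (z $ k)"
  then have "z = re_im_vec (\<chi> k. Re (z $ k)) (\<chi> k. Im (z $ k)) \<and> (\<chi> k. Im (z $ k)) \<in> octant"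
    by (simp add: vec_eq_iff octant_def complex_eq_iff)
  then show "z \<in> tube" unfolding tube_def by blast
qed (auto simp: tube_def octant_def)

lemma re_im_vec_in_tube [simp]: "re_im_vec x y \<in> tube \<longleftrightarrow> y \<in> octant"
  by (simp add: tube_iff octant_def)

lemma open_tube: "open (tube :: (complex ^ 'n) set)"
proof -
  have "(tube :: (complex ^ 'n) set) = (\<Inter>k. {z. 0 < Im (z $ k)})"
    by (auto simp: tube_iff)
  also have "open \<dots>"
    by (intro open_INT) (auto intro!: open_Collect_less continuous_intros)
  finally show ?thesis .
qed

lemma octant_add: "y \<in> octant \<Longrightarrow> y' \<in> octant \<Longrightarrow> y + y' \<in> octant"
  by (auto simp: octant_def add_pos_pos)

lemma octant_scaleR: "y \<in> octant \<Longrightarrow> 0 < c \<Longrightarrow> c *\<^sub>R y \<in> octant"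
  by (simp add: octant_def)

lemma octant_convex: "convex (octant :: (real ^ 'n) set)"
proof (rule convexI)
  fix x y :: "real ^ 'n" and a b :: real
  assume "x \<in> octant" "y \<in> octant" and ab: "0 \<le> a" "0 \<le> b" "a + b = 1"
  then have xy: "x \<in> octant" "y \<in> octant" by simp_all
  show "a *\<^sub>R x + b *\<^sub>R y \<in> octant"
  proof (cases "a = 0 \<or> b = 0")
    case True
    then show ?thesis using ab xy by auto
  next
    case False
    then show ?thesis using ab xy by (intro octant_add octant_scaleR) auto
  qed
qed

lemma continuous_on_re_im_vec [continuous_intros]:
  assumes "continuous_on S f" "continuous_on S g"
  shows "continuous_on S (\<lambda>p. re_im_vec (f p) (g p))"
  unfolding re_im_vec_def
  by (intro continuous_on_vec_lambda continuous_on_Complex continuous_on_component assms)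

lemma holomorphic_several_continuous_on:
  assumes "holomorphic_several F S"
  shows "continuous_on S F"
  using assms unfolding holomorphic_several_def
  by (meson continuous_at_imp_continuous_on has_derivative_continuous)

text \<open>Because \<open>u\<close> is real, moving x by Re \<zeta> and the height by Im \<zeta>
  along \<open>u\<close> is the complex affine map adding \<zeta> times \<open>u\<close>. Complex
  linearity of the Frechet derivative then yields an ordinary complex derivative.\<close>

lemma holomorphic_several_line:
  fixes u x v :: "real ^ 'n"
  assumes F: "holomorphic_several F tube"
    and S: "\<And>\<zeta>. \<zeta> \<in> S \<Longrightarrow> v + Im \<zeta> *\<^sub>R u \<in> octant"
  shows "(\<lambda>\<zeta>. F (re_im_vec (x + Re \<zeta> *\<^sub>R u) (v + Im \<zeta> *\<^sub>R u))) holomorphic_on S"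
proof -
  define c :: "complex ^ 'n" where "c = (\<chi> k. of_real (u $ k))"
  define L where "L \<zeta> = re_im_vec x v + \<zeta> *s c" for \<zeta>
  have L: "re_im_vec (x + Re \<zeta> *\<^sub>R u) (v + Im \<zeta> *\<^sub>R u) = L \<zeta>" for \<zeta>
    by (simp add: L_def c_def vec_eq_iff complex_eq_iff)
  have lin: "bounded_linear (\<lambda>\<zeta>. \<zeta> *s c)"
    unfolding linear_conv_bounded_linear[symmetric]
    by (rule linearI) (simp_all add: vec_eq_iff algebra_simps)
  have dL: "(L has_derivative (\<lambda>h. h *s c)) (at \<zeta>)" for \<zeta>
    unfolding L_def by (auto intro!: derivative_eq_intros bounded_linear.has_derivative[OF lin])
  have "(\<lambda>\<zeta>. F (L \<zeta>)) field_differentiable (at \<zeta>)" if "\<zeta> \<in> S" for \<zeta>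
  proof -
    have "L \<zeta> \<in> tube" using S[OF that] L[of \<zeta>, symmetric] by simp
    then obtain F' where F': "(F has_derivative F') (at (L \<zeta>))" "\<And>c v. F' (c *s v) = c * F' v"
      using F unfolding holomorphic_several_def by blast
    have "((\<lambda>\<zeta>. F (L \<zeta>)) has_derivative (\<lambda>h. F' (h *s c))) (at \<zeta>)"
      using diff_chain_at[OF dL F'(1)] by (simp add: o_def)
    then have "((\<lambda>\<zeta>. F (L \<zeta>)) has_field_derivative F' c) (at \<zeta>)"
      unfolding has_field_derivative_def F'(2) by (simp only: mult.commute[of _ "F' c"])
    then show ?thesis unfolding field_differentiable_def by blast
  qed
  then show ?thesis
    unfolding L holomorphic_on_def using field_differentiable_at_within by blast
qed

section \<open>Integration over all translates of a contour\<close>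

lemma integral_translate:
  fixes f :: "'a::euclidean_space \<Rightarrow> complex"
  assumes [measurable]: "f \<in> borel_measurable borel"
  shows "(\<integral>x. f (x + c) \<partial>lborel) = (\<integral>x. f x \<partial>lborel)"
  by (subst (2) lborel_distr_plus[symmetric, of c]) (simp add: integral_distr add.commute)

lemma nn_integral_translate:
  fixes f :: "'a::euclidean_space \<Rightarrow> ennreal"
  assumes [measurable]: "f \<in> borel_measurable borel"
  shows "(\<integral>\<^sup>+x. f (x + c) \<partial>lborel) = (\<integral>\<^sup>+x. f x \<partial>lborel)"
  by (subst (2) lborel_distr_plus[symmetric, of c]) (simp add: nn_integral_distr add.commute)

text \<open>Contour integrals are gauge integrals over [0,1], the average over translates is a
  Lebesgue integral. The bound on each horizontal line, uniform in t, gives integrability on the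
  product. Nothing is known of \<open>k\<close> off the strip, hence the indicator.\<close>

lemma strip_Fubini:
  fixes k :: "'a::euclidean_space \<Rightarrow> real \<Rightarrow> complex"
  assumes cont: "continuous_on (UNIV \<times> {0..1}) (\<lambda>(x, t). k x t)"
    and bd: "\<And>t. t \<in> {0..1} \<Longrightarrow> (\<integral>\<^sup>+x. ennreal (cmod (k x t)) \<partial>lborel) \<le> ennreal C"
  shows "integrable lborel (\<lambda>x. integral {0..1} (k x))"
    and "(\<integral>x. integral {0..1} (k x) \<partial>lborel) = (\<integral>t. indicator {0..1} t *\<^sub>R (\<integral>x. k x t \<partial>lborel) \<partial>lborel)"
proof -
  define K where "K x t = indicator {0..1} t *\<^sub>R k x t" for x t
  have "(\<lambda>p. indicator (UNIV \<times> {0..1}) p *\<^sub>R (case p of (x, t) \<Rightarrow> k x t)) \<in> borel_measurable borel"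
    by (rule borel_measurable_continuous_on_indicator[OF _ cont]) (auto intro!: borel_closed closed_Times)
  also have "(\<lambda>p. indicator (UNIV \<times> {0..1}) p *\<^sub>R (case p of (x, t) \<Rightarrow> k x t)) = case_prod K"
    by (auto simp: K_def fun_eq_iff indicator_def)
  finally have [measurable]: "case_prod K \<in> borel_measurable (lborel \<Otimes>\<^sub>M lborel)"
    by (simp add: lborel_prod)
  have "(\<integral>\<^sup>+p. ennreal (norm (case_prod K p)) \<partial>(lborel \<Otimes>\<^sub>M lborel)) =
    (\<integral>\<^sup>+t. \<integral>\<^sup>+x. ennreal (norm (K x t)) \<partial>lborel \<partial>lborel)"
    by (subst lborel_pair.nn_integral_snd[symmetric]) simp_all
  also have "\<dots> \<le> (\<integral>\<^sup>+t. ennreal C * indicator {0..1::real} t \<partial>lborel)"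
    using bd by (intro nn_integral_mono) (auto simp: K_def indicator_def)
  also have "\<dots> < \<infinity>" by (subst nn_integral_cmult_indicator) (auto simp: ennreal_mult_less_top)
  finally have int: "integrable (lborel \<Otimes>\<^sub>M lborel) (case_prod K)"
    by (intro integrableI_bounded) auto
  have eq: "integral {0..1} (k x) = (\<integral>t. K x t \<partial>lborel)" for x
  proof -
    have "continuous_on {0..1} (\<lambda>t. (\<lambda>(x, t). k x t) (x, t))"
      by (rule continuous_on_compose2[OF cont]) (auto intro!: continuous_intros)
    then have "set_integrable lborel {0..1} (k x)"
      by (intro borel_integrable_atLeastAtMost') simp
    from set_borel_integral_eq_integral(2)[OF this] show ?thesis
      by (simp add: set_lebesgue_integral_def K_def)
  qed
  show "integrable lborel (\<lambda>x. integral {0..1} (k x))"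
    unfolding eq using lborel_pair.integrable_fst'[OF int] by simp
  show "(\<integral>x. integral {0..1} (k x) \<partial>lborel) = (\<integral>t. indicator {0..1} t *\<^sub>R (\<integral>x. k x t \<partial>lborel) \<partial>lborel)"
    unfolding eq using lborel_pair.Fubini_integral[OF int] by (simp add: K_def[abs_def])
qed

text \<open>Cauchy's theorem on the unit square, integrated over all translates of the square:
  the contributions of the two vertical sides cancel by translation invariance.\<close>

lemma contour_shift:
  fixes g :: "'a::euclidean_space \<Rightarrow> real \<Rightarrow> complex"
  assumes hol: "\<And>x. (\<lambda>\<zeta>. g (x + Re \<zeta> *\<^sub>R u) (Im \<zeta>)) holomorphic_on {\<zeta>. Im \<zeta> \<in> {0..1}}"
    and cont: "continuous_on (UNIV \<times> {0..1}) (\<lambda>(x, t). g x t)"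
    and bd: "\<And>t. t \<in> {0..1} \<Longrightarrow> (\<integral>\<^sup>+x. ennreal (cmod (g x t)) \<partial>lborel) \<le> ennreal C"
  shows "(\<integral>x. g x 0 \<partial>lborel) = (\<integral>x. g x 1 \<partial>lborel)"
proof -
  define J where "J t = (\<integral>x. g x t \<partial>lborel)" for t
  have meas: "(\<lambda>x. g x t) \<in> borel_measurable borel" if "t \<in> {0..1}" for t
  proof -
    have "continuous_on UNIV (\<lambda>x. (\<lambda>(x, t). g x t) (x, t))"
      by (rule continuous_on_compose2[OF cont]) (use that in \<open>auto intro!: continuous_intros\<close>)
    then show ?thesis by (intro borel_measurable_continuous_onI) simp
  qed
  \<comment> \<open>Bottom plus right side equals top plus left side of the square;
    \<open>\<i>\<close> is the velocity along the vertical sides.\<close>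
  have sides: "integral {0..1} (\<lambda>t. g (x + t *\<^sub>R u) 0) + \<i> * integral {0..1} (\<lambda>t. g (x + u) t)
     = integral {0..1} (\<lambda>t. g (x + t *\<^sub>R u) 1) + \<i> * integral {0..1} (\<lambda>t. g x t)" for x
  proof -
    define h where "h \<zeta> = g (x + Re \<zeta> *\<^sub>R u) (Im \<zeta>)" for \<zeta>
    define S where "S = {\<zeta>. Im \<zeta> \<in> {0..1::real}}"
    have S: "convex S"
      using convex_Int[OF convex_halfspace_Im_ge[of 0] convex_halfspace_Im_le[of 1]]
      by (simp add: S_def Collect_conj_eq)
    have h: "h holomorphic_on S" unfolding h_def S_def by (rule hol)
    have I: "(h has_contour_integral (integral {0..1} (\<lambda>t. h (linepath a b t) * (b - a)))) (linepath a b)"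
      if "a \<in> S" "b \<in> S" for a b
    proof -
      have "closed_segment a b \<subseteq> S" using S that by (simp add: convex_contains_segment)
      then have "h contour_integrable_on linepath a b"
        by (intro contour_integrable_continuous_linepath continuous_on_subset[OF holomorphic_on_imp_continuous_on[OF h]])
      then have "(h has_contour_integral contour_integral (linepath a b) h) (linepath a b)"
        by (rule has_contour_integral_integral)
      then show ?thesis
        unfolding has_contour_integral_linepath by (metis integral_unique)
    qed
    have pts: "0 \<in> S" "1 \<in> S" "\<i> \<in> S" "1 + \<i> \<in> S" by (auto simp: S_def)
    let ?p = "linepath 0 1 +++ linepath 1 (1 + \<i>) +++ linepath (1 + \<i>) \<i> +++ linepath \<i> 0"
    have "(h has_contour_integral 0) ?p"
    proof (rule Cauchy_theorem_convex_simple[OF h S])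
      have "closed_segment a b \<subseteq> S" if "a \<in> S" "b \<in> S" for a b
        using S that by (simp add: convex_contains_segment)
      then show "path_image ?p \<subseteq> S" using pts by (auto simp: path_image_join)
    qed (auto intro!: valid_path_join)
    moreover have "(h has_contour_integral
       (integral {0..1} (\<lambda>t. h (linepath 0 1 t) * (1 - 0)) +
       (integral {0..1} (\<lambda>t. h (linepath 1 (1 + \<i>) t) * ((1 + \<i>) - 1)) +
       (- integral {0..1} (\<lambda>t. h (linepath \<i> (1 + \<i>) t) * ((1 + \<i>) - \<i>)) +
        - integral {0..1} (\<lambda>t. h (linepath 0 \<i> t) * (\<i> - 0)))))) ?p"
      by (intro has_contour_integral_join has_contour_integral_reverse_linepath I pts) (auto intro!: valid_path_join)
    ultimately have "integral {0..1} (\<lambda>t. h (linepath 0 1 t) * (1 - 0)) +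
       (integral {0..1} (\<lambda>t. h (linepath 1 (1 + \<i>) t) * ((1 + \<i>) - 1)) +
       (- integral {0..1} (\<lambda>t. h (linepath \<i> (1 + \<i>) t) * ((1 + \<i>) - \<i>)) +
        - integral {0..1} (\<lambda>t. h (linepath 0 \<i> t) * (\<i> - 0)))) = 0"
      by (metis has_contour_integral_unique)
    then show ?thesis
      by (simp add: h_def linepath_def scaleR_conv_of_real algebra_simps flip: integral_mult_right)
  qed
  have c1: "continuous_on (UNIV \<times> {0..1}) (\<lambda>(x, t). g (x + t *\<^sub>R u) b)" if "b \<in> {0..1}" for b
  proof -
    have "continuous_on (UNIV \<times> {0..1}) (\<lambda>p. (\<lambda>(x, t). g x t) (fst p + snd p *\<^sub>R u, b))"
      by (rule continuous_on_compose2[OF cont]) (use that in \<open>auto intro!: continuous_intros\<close>)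
    then show ?thesis by (simp add: case_prod_unfold)
  qed
  have c2: "continuous_on (UNIV \<times> {0..1}) (\<lambda>(x, t). g (x + u) t)"
  proof -
    have "continuous_on (UNIV \<times> {0..1}) (\<lambda>p. (\<lambda>(x, t). g x t) (fst p + u, snd p))"
      by (rule continuous_on_compose2[OF cont]) (auto intro!: continuous_intros)
    then show ?thesis by (simp add: case_prod_unfold)
  qed
  have b1: "(\<integral>\<^sup>+x. ennreal (cmod (g (x + c) b)) \<partial>lborel) \<le> ennreal C" if "b \<in> {0..1}" for b c
    using bd[OF that] meas[OF that] by (subst nn_integral_translate[where f="\<lambda>x. ennreal (cmod (g x b))"]) auto
  have tr: "(\<integral>x. g (x + c) b \<partial>lborel) = J b" if "b \<in> {0..1}" for b c
    unfolding J_def by (rule integral_translate[OF meas[OF that]])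
  have bnd01: "(0::real) \<in> {0..1}" "(1::real) \<in> {0..1}" by auto
  note F0 = strip_Fubini[OF c1[OF bnd01(1)] b1[OF bnd01(1)]]
  note F1 = strip_Fubini[OF c1[OF bnd01(2)] b1[OF bnd01(2)]]
  note F2 = strip_Fubini[OF c2 b1]
  note F3 = strip_Fubini[OF cont bd]
  have J01: "(\<integral>t. indicator {0..1::real} t *\<^sub>R J b \<partial>lborel) = J b" for b
    by simp
  have "(\<integral>x. integral {0..1} (\<lambda>t. g (x + t *\<^sub>R u) 0) + \<i> * integral {0..1} (\<lambda>t. g (x + u) t) \<partial>lborel) =
    J 0 + \<i> * (\<integral>t. indicator {0..1} t *\<^sub>R J t \<partial>lborel)"
    using F0 F2 J01
    by (subst Bochner_Integration.integral_add) (auto simp: tr indicator_def intro!: Bochner_Integration.integral_cong)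
  moreover have "(\<integral>x. integral {0..1} (\<lambda>t. g (x + t *\<^sub>R u) 1) + \<i> * integral {0..1} (\<lambda>t. g x t) \<partial>lborel) =
    J 1 + \<i> * (\<integral>t. indicator {0..1} t *\<^sub>R J t \<partial>lborel)"
    using F1 F3 J01
    by (subst Bochner_Integration.integral_add) (auto simp: tr J_def)
  ultimately have "J 0 = J 1" unfolding sides by simp
  then show ?thesis by (simp add: J_def)
qed

section \<open>Slices and boundary limits\<close>

definition slice :: "(complex ^ 'n \<Rightarrow> complex) \<Rightarrow> real ^ 'n \<Rightarrow> real ^ 'n \<Rightarrow> complex" where
  "slice F y x = F (re_im_vec x y)"

lemma slice_continuous:
  assumes "holomorphic_several F tube" "y \<in> octant"
  shows "continuous_on UNIV (slice F y)"
  unfolding slice_def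
  by (rule continuous_on_compose2[OF holomorphic_several_continuous_on[OF assms(1)]])
     (use assms in \<open>auto intro!: continuous_intros\<close>)

lemma slice_measurable:
  assumes "holomorphic_several F tube" "y \<in> octant"
  shows "slice F y \<in> borel_measurable borel"
  by (rule borel_measurable_continuous_onI[OF slice_continuous[OF assms]])

lemma hardy_space_holomorphic: "F \<in> hardy_space \<Longrightarrow> holomorphic_several F tube"
  by (simp add: hardy_space_def)

lemma hardy_norm_sq_eq:
  assumes "F \<in> hardy_space"
  shows "hardy_norm_sq F = ennreal ((hardy_norm F)\<^sup>2)"
  using assms by (simp add: hardy_space_def hardy_norm_def less_top)

lemma hardy_norm_nonneg [simp]: "0 \<le> hardy_norm F"
  by (simp add: hardy_norm_def)

lemma slice_square_integrable:
  assumes F: "F \<in> hardy_space" and y: "y \<in> octant"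
  shows "square_integrable lborel (slice F y)"
proof (rule square_integrableI_nn)
  show "slice F y \<in> borel_measurable lborel"
    using slice_measurable[OF hardy_space_holomorphic[OF F] y] by simp
  have "(\<integral>\<^sup>+x. ennreal ((cmod (slice F y x))\<^sup>2) \<partial>lborel) \<le> hardy_norm_sq F"
    unfolding hardy_norm_sq_def slice_def using y by (rule SUP_upper)
  also have "\<dots> < \<infinity>" using F by (simp add: hardy_space_def)
  finally show "(\<integral>\<^sup>+x. ennreal ((cmod (slice F y x))\<^sup>2) \<partial>lborel) < \<infinity>" .
qed

lemma hardy_norm_sq_SUP:
  assumes "F \<in> hardy_space"
  shows "hardy_norm_sq F = (SUP y\<in>octant. ennreal (l2_sq lborel (slice F y)))"
  unfolding hardy_norm_sq_def slice_def[symmetric]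
  by (intro SUP_cong refl nn_integral_l2_sq slice_square_integrable assms)

lemma l2_sq_slice_le:
  assumes "F \<in> hardy_space" "y \<in> octant"
  shows "l2_sq lborel (slice F y) \<le> (hardy_norm F)\<^sup>2"
proof -
  have "ennreal (l2_sq lborel (slice F y)) \<le> ennreal ((hardy_norm F)\<^sup>2)"
    unfolding hardy_norm_sq_eq[OF assms(1), symmetric] hardy_norm_sq_SUP[OF assms(1)]
    using assms(2) by (rule SUP_upper)
  then show ?thesis by simp
qed

lemma hardy_spaceI:
  assumes "holomorphic_several F tube"
    and "\<And>y. y \<in> octant \<Longrightarrow> (\<integral>\<^sup>+x. ennreal ((cmod (slice F y x))\<^sup>2) \<partial>lborel) \<le> ennreal C"
  shows "F \<in> hardy_space"
proof -
  have "hardy_norm_sq F \<le> ennreal C"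
    unfolding hardy_norm_sq_def by (rule SUP_least) (use assms in \<open>simp add: slice_def\<close>)
  also have "\<dots> < \<infinity>" by simp
  finally show ?thesis using assms by (simp add: hardy_space_def)
qed

text \<open>Two heights are kept apart so that one can be raised while the other is lowered.\<close>

definition slice_inner ::
    "(complex ^ 'n \<Rightarrow> complex) \<Rightarrow> (complex ^ 'n \<Rightarrow> complex) \<Rightarrow> real ^ 'n \<Rightarrow> real ^ 'n \<Rightarrow> complex" where
  "slice_inner F G y y' = l2_inner lborel (slice F y) (slice G y')"

lemma cmod_slice_inner_le:
  assumes F: "F \<in> hardy_space" and G: "G \<in> hardy_space" and y: "y \<in> octant" "y' \<in> octant"
  shows "cmod (slice_inner F G y y') \<le> hardy_norm F * hardy_norm G"
proof -
  have "cmod (slice_inner F G y y') \<le> sqrt (l2_sq lborel (slice F y)) * sqrt (l2_sq lborel (slice G y'))"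
    unfolding slice_inner_def by (intro l2_Cauchy_Schwarz slice_square_integrable F G y)
  also have "\<dots> \<le> hardy_norm F * hardy_norm G"
    by (intro mult_mono real_le_lsqrt l2_sq_slice_le F G y) auto
  finally show ?thesis .
qed

lemma octant_open: "open (octant :: (real ^ 'n) set)"
proof -
  have "(octant :: (real ^ 'n) set) = (\<Inter>k. {z. 0 < z $ k})"
    by (auto simp: octant_def)
  also have "open \<dots>"
    by (intro open_INT) (auto intro!: open_Collect_less continuous_intros)
  finally show ?thesis .
qed

text \<open>Cauchy-Schwarz in the shape of the uniform L1 bound that \<open>contour_shift\<close>
  requires.\<close>

lemma nn_integral_mult_le:
  assumes f: "square_integrable M f" "l2_sq M f \<le> A\<^sup>2" "0 \<le> A"
    and g: "square_integrable M g" "l2_sq M g \<le> B\<^sup>2" "0 \<le> B"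
  shows "(\<integral>\<^sup>+x. ennreal (cmod (f x * g x)) \<partial>M) \<le> ennreal (A * B)"
proof -
  have "(\<integral>\<^sup>+x. ennreal (cmod (f x * g x)) \<partial>M) = ennreal (\<integral>x. cmod (f x) * cmod (g x) \<partial>M)"
    unfolding norm_mult by (intro nn_integral_eq_integral integrable_cmod_mult f g) auto
  also have "\<dots> \<le> ennreal (A * B)"
  proof (rule ennreal_leI, rule power2_le_imp_le)
    show "(\<integral>x. cmod (f x) * cmod (g x) \<partial>M)\<^sup>2 \<le> (A * B)\<^sup>2"
      unfolding power_mult_distrib
      by (rule order_trans[OF l2_Cauchy_Schwarz_abs[OF f(1) g(1)]]) (intro mult_mono f g; simp)
  qed (use f g in simp)
  finally show ?thesis .
qed

text \<open>Conjugating \<open>G\<close> reverses the direction in which its height moves: F at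
  height v + t u times the conjugate of G at height v' - t u is holomorphic along the contour, and
  the sum of heights stays fixed. The components of \<open>u\<close> may have any sign; convexity of
  the octant keeps both heights inside.\<close>

lemma slice_inner_shift:
  fixes v :: "real ^ 'n"
  assumes F: "F \<in> hardy_space" and G: "G \<in> hardy_space"
    and oct: "v \<in> octant" "v' \<in> octant" "w \<in> octant" "w' \<in> octant"
    and eq: "v + v' = w + w'"
  shows "slice_inner F G v v' = slice_inner F G w w'"
proof -
  define u where "u = w - v"
  have v': "v' - u = w'" using eq by (simp add: u_def algebra_simps)
  \<comment> \<open>An open set containing the strip, since reflecting a holomorphic function by
    conjugation on both sides is done on open sets.\<close>
  define D where "D = {\<zeta>. v + Im \<zeta> *\<^sub>R u \<in> octant \<and> v' - Im \<zeta> *\<^sub>R u \<in> octant}"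
  have io: "v + t *\<^sub>R u \<in> octant" "v' - t *\<^sub>R u \<in> octant" if "t \<in> {0..1}" for t
  proof -
    have "(1 - t) *\<^sub>R v + t *\<^sub>R w \<in> octant" "(1 - t) *\<^sub>R v' + t *\<^sub>R w' \<in> octant"
      using octant_convex oct that unfolding convex_alt by auto
    then show "v + t *\<^sub>R u \<in> octant" "v' - t *\<^sub>R u \<in> octant"
      by (simp_all add: u_def v'[symmetric] algebra_simps)
  qed
  have "open D"
    unfolding D_def
    by (intro open_Collect_conj open_vimage[OF octant_open, unfolded vimage_def] continuous_intros)
  define g where "g x t = slice F (v + t *\<^sub>R u) x * cnj (slice G (v' - t *\<^sub>R u) x)" for x t
  have "(\<integral>x. g x 0 \<partial>lborel) = (\<integral>x. g x 1 \<partial>lborel)"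
  proof (rule contour_shift[where u = u and C = "hardy_norm F * hardy_norm G"])
    fix x
    have "(\<lambda>\<zeta>. F (re_im_vec (x + Re \<zeta> *\<^sub>R u) (v + Im \<zeta> *\<^sub>R u))) holomorphic_on D"
      by (rule holomorphic_several_line[OF hardy_space_holomorphic[OF F]]) (simp add: D_def)
    moreover have "(\<lambda>\<zeta>. G (re_im_vec (x + Re \<zeta> *\<^sub>R u) (v' + Im \<zeta> *\<^sub>R u))) holomorphic_on (cnj ` D)"
      by (rule holomorphic_several_line[OF hardy_space_holomorphic[OF G]]) (auto simp: D_def)
    from holomorphic_on_compose_cnj_cnj[OF this \<open>open D\<close>]
    have "(\<lambda>\<zeta>. cnj (G (re_im_vec (x + Re \<zeta> *\<^sub>R u) (v' - Im \<zeta> *\<^sub>R u)))) holomorphic_on D"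
      by (simp add: o_def)
    ultimately have "(\<lambda>\<zeta>. g (x + Re \<zeta> *\<^sub>R u) (Im \<zeta>)) holomorphic_on D"
      unfolding g_def slice_def by (rule holomorphic_on_mult)
    then show "(\<lambda>\<zeta>. g (x + Re \<zeta> *\<^sub>R u) (Im \<zeta>)) holomorphic_on {\<zeta>. Im \<zeta> \<in> {0..1}}"
      by (rule holomorphic_on_subset) (use io in \<open>auto simp: D_def\<close>)
  next
    have "continuous_on (UNIV \<times> {0..1}) (\<lambda>p. F (re_im_vec (fst p) (v + snd p *\<^sub>R u)))"
      by (rule continuous_on_compose2[OF holomorphic_several_continuous_on[OF hardy_space_holomorphic[OF F]]])
         (use io in \<open>auto intro!: continuous_intros\<close>)
    moreover have "continuous_on (UNIV \<times> {0..1}) (\<lambda>p. G (re_im_vec (fst p) (v' - snd p *\<^sub>R u)))"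
      by (rule continuous_on_compose2[OF holomorphic_several_continuous_on[OF hardy_space_holomorphic[OF G]]])
         (use io in \<open>auto intro!: continuous_intros\<close>)
    ultimately show "continuous_on (UNIV \<times> {0..1}) (\<lambda>(x, t). g x t)"
      unfolding g_def slice_def case_prod_unfold by (intro continuous_intros)
  next
    fix t :: real assume "t \<in> {0..1}"
    note io[OF this]
    then show "(\<integral>\<^sup>+x. ennreal (cmod (g x t)) \<partial>lborel) \<le> ennreal (hardy_norm F * hardy_norm G)"
      unfolding g_def
      by (intro nn_integral_mult_le square_integrable_cnj slice_square_integrable F G l2_sq_slice_le)
         (use l2_sq_slice_le[OF G] in \<open>auto simp: l2_sq_def\<close>)
  qed
  then show ?thesis
    by (simp add: g_def slice_inner_def l2_inner_def v' u_def[symmetric]) (simp add: u_def)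
qed

lemma slice_inner_self: "slice_inner F F y y = of_real (l2_sq lborel (slice F y))"
  by (simp add: slice_inner_def l2_inner_self)

lemma l2_sq_slice_diff:
  assumes F: "F \<in> hardy_space" and y: "y \<in> octant" "y' \<in> octant"
  shows "l2_sq lborel (\<lambda>x. slice F y x - slice F y' x) =
    l2_sq lborel (slice F y) + l2_sq lborel (slice F y') - 2 * l2_sq lborel (slice F ((1/2) *\<^sub>R (y + y')))"
proof -
  let ?m = "(1/2) *\<^sub>R (y + y')"
  have m: "?m \<in> octant" by (intro octant_scaleR octant_add y) simp
  have "slice_inner F F y y' = slice_inner F F ?m ?m"
    by (intro slice_inner_shift F y m) (simp add: scaleR_add_left[symmetric])
  then have "l2_inner lborel (slice F y) (slice F y') = of_real (l2_sq lborel (slice F ?m))"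
    by (simp add: slice_inner_self) (simp add: slice_inner_def)
  then show ?thesis
    using l2_sq_diff[OF slice_square_integrable[OF F y(1)] slice_square_integrable[OF F y(2)]] by simp
qed

text \<open>Increments of a convex sequence are nondecreasing, so a positive first increment would
  force linear growth.\<close>

lemma convex_bounded_seq_le:
  fixes b :: "nat \<Rightarrow> real"
  assumes conv: "\<And>j. 2 * b (Suc j) \<le> b j + b (Suc (Suc j))" and bd: "\<And>j. b j \<le> S"
  shows "b 1 \<le> b 0"
proof (rule ccontr)
  assume "\<not> b 1 \<le> b 0"
  define e where "e = b 1 - b 0"
  have e: "e > 0" using \<open>\<not> b 1 \<le> b 0\<close> by (simp add: e_def)
  have step: "e \<le> b (Suc j) - b j" for j
  proof (induction j)
    case (Suc j)
    then show ?case using conv[of j] by linarith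
  qed (simp add: e_def)
  have "b 0 + real n * e \<le> b n" for n
  proof (induction n)
    case (Suc n)
    then show ?case using step[of n] by (simp add: algebra_simps)
  qed simp
  moreover obtain n where "real n * e > S - b 0"
    using reals_Archimedean3[OF e] by blast
  ultimately show False using bd[of n] by (smt (verit))
qed

lemma l2_sq_slice_antimono:
  assumes F: "F \<in> hardy_space" and y: "y \<in> octant" and w: "w \<in> octant"
  shows "l2_sq lborel (slice F (y + w)) \<le> l2_sq lborel (slice F y)"
proof -
  \<comment> \<open>Squared norms sampled along a ray: each height is the midpoint of its two
    neighbours, so midpoint convexity becomes convexity of the sequence.\<close>
  define b where "b j = l2_sq lborel (slice F (y + real j *\<^sub>R w))" for j
  have o: "y + real j *\<^sub>R w \<in> octant" for j
    using octant_add[OF y octant_scaleR[OF w, of "real j"]] y by (cases "j = 0") auto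
  have "b 1 \<le> b 0"
  proof (rule convex_bounded_seq_le)
    show "b j \<le> (hardy_norm F)\<^sup>2" for j
      unfolding b_def by (intro l2_sq_slice_le F o)
    show "2 * b (Suc j) \<le> b j + b (Suc (Suc j))" for j
    proof -
      have "(1/2) *\<^sub>R ((y + real j *\<^sub>R w) + (y + real (Suc (Suc j)) *\<^sub>R w)) = y + real (Suc j) *\<^sub>R w"
        by (simp add: vec_eq_iff algebra_simps)
      then show ?thesis
        using l2_sq_slice_diff[OF F o[of j] o[of "Suc (Suc j)"]]
          l2_sq_nonneg[of lborel "\<lambda>x. slice F (y + real j *\<^sub>R w) x - slice F (y + real (Suc (Suc j)) *\<^sub>R w) x"]
        unfolding b_def by simp
    qed
  qed
  then show ?thesis by (simp add: b_def)
qed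

text \<open>One nearly optimal height exists by definition of the supremum, and monotonicity extends
  it to all heights below. Being below is strict in every coordinate, expressed by
  \<open>y0 - y \<in> octant\<close>.\<close>

lemma l2_sq_slice_near_norm:
  fixes F :: "complex ^ 'n \<Rightarrow> complex"
  assumes F: "F \<in> hardy_space" and e: "0 < e"
  shows "\<exists>y0\<in>octant. \<forall>y\<in>octant. y0 - y \<in> octant \<longrightarrow> (hardy_norm F)\<^sup>2 - e < l2_sq lborel (slice F y)"
proof -
  have "\<exists>y\<in>octant. (hardy_norm F)\<^sup>2 - e < l2_sq lborel (slice F y)"
  proof (rule ccontr)
    assume "\<not> ?thesis"
    then have *: "l2_sq lborel (slice F y) \<le> (hardy_norm F)\<^sup>2 - e" if "y \<in> octant" for y
      using that by (auto simp: not_less)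
    \<comment> \<open>A witness that the octant is nonempty. It makes the supposed bound
      nonnegative, without which \<open>ennreal\<close> would cut it off at 0 and hide the
      contradiction.\<close>
    have "(1 :: real ^ 'n) \<in> octant" by (simp add: octant_def)
    from *[OF this] have 0: "0 \<le> (hardy_norm F)\<^sup>2 - e" by (rule order_trans[OF l2_sq_nonneg])
    have "ennreal ((hardy_norm F)\<^sup>2) \<le> ennreal ((hardy_norm F)\<^sup>2 - e)"
      unfolding hardy_norm_sq_eq[OF F, symmetric]
      unfolding hardy_norm_sq_SUP[OF F] by (intro SUP_least ennreal_leI *)
    then show False using e 0 by simp
  qed
  then obtain y0 where y0: "y0 \<in> octant" "(hardy_norm F)\<^sup>2 - e < l2_sq lborel (slice F y0)" by blast
  have "(hardy_norm F)\<^sup>2 - e < l2_sq lborel (slice F y)" if "y \<in> octant" "y0 - y \<in> octant" for y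
    using l2_sq_slice_antimono[OF F that] y0 by simp
  then show ?thesis using y0 by blast
qed

text \<open>The midpoint of two heights below \<open>y0\<close> is itself below \<open>y0\<close>.
  With S the squared norm, the squared distance is then at most S + S - 2 (S - e/2) = e.\<close>

lemma l2_sq_slice_Cauchy:
  assumes F: "F \<in> hardy_space" and e: "0 < e"
  shows "\<exists>y0\<in>octant. \<forall>y\<in>octant. \<forall>y'\<in>octant. y0 - y \<in> octant \<longrightarrow> y0 - y' \<in> octant \<longrightarrow>
     l2_sq lborel (\<lambda>x. slice F y x - slice F y' x) \<le> e"
proof -
  from l2_sq_slice_near_norm[OF F, of "e/2"] e obtain y0 where y0: "y0 \<in> octant"
    "\<And>y. y \<in> octant \<Longrightarrow> y0 - y \<in> octant \<Longrightarrow> (hardy_norm F)\<^sup>2 - e/2 < l2_sq lborel (slice F y)"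
    by auto
  have "l2_sq lborel (\<lambda>x. slice F y x - slice F y' x) \<le> e"
    if y: "y \<in> octant" "y' \<in> octant" "y0 - y \<in> octant" "y0 - y' \<in> octant" for y y'
  proof -
    let ?m = "(1/2) *\<^sub>R (y + y')"
    have m: "?m \<in> octant" by (intro octant_scaleR octant_add y) simp
    have "y0 - ?m = (1/2) *\<^sub>R ((y0 - y) + (y0 - y'))" by (simp add: vec_eq_iff field_simps)
    also have "\<dots> \<in> octant" by (intro octant_scaleR octant_add y) simp
    finally have "(hardy_norm F)\<^sup>2 - e/2 < l2_sq lborel (slice F ?m)" by (rule y0(2)[OF m])
    then show ?thesis
      using l2_sq_slice_diff[OF F y(1,2)] l2_sq_slice_le[OF F y(1)] l2_sq_slice_le[OF F y(2)] by simp
  qed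
  with y0(1) show ?thesis by blast
qed

text \<open>One explicit sequence tending to 0 inside the octant. Completeness and dominated
  convergence are sequential, and every limit towards the boundary is taken along it.\<close>

definition height :: "nat \<Rightarrow> real ^ 'n" where
  "height n = inverse (real (Suc n)) *\<^sub>R 1"

lemma height_in_octant [simp]: "height n \<in> octant"
  unfolding height_def by (rule octant_scaleR) (auto simp: octant_def)

lemma height_tendsto: "height \<longlonglongrightarrow> 0"
  using tendsto_scaleR[OF LIMSEQ_inverse_real_of_nat tendsto_const[of 1]]
  by (simp add: height_def[abs_def])

lemma height_below:
  assumes "y \<in> octant"
  shows "\<forall>\<^sub>F n in sequentially. y - height n \<in> octant"
proof -
  have "(\<lambda>n. y - height n) \<longlonglongrightarrow> y - 0" by (intro tendsto_intros height_tendsto)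
  then show ?thesis using assms by (intro topological_tendstoD[OF _ octant_open]) auto
qed

lemma height_filterlim: "filterlim height (at 0 within octant) sequentially"
  unfolding filterlim_at using height_tendsto
  by (auto intro!: always_eventually) (metis height_in_octant octant_def mem_Collect_eq zero_index less_irrefl)

lemma l2_sq_diff_triangle:
  assumes "square_integrable M f" "square_integrable M g" "square_integrable M h"
  shows "l2_sq M (\<lambda>x. f x - h x) \<le> 2 * l2_sq M (\<lambda>x. f x - g x) + 2 * l2_sq M (\<lambda>x. g x - h x)"
proof -
  have i: "integrable M (\<lambda>x. (cmod (f x - g x))\<^sup>2)" "integrable M (\<lambda>x. (cmod (g x - h x))\<^sup>2)"
    "integrable M (\<lambda>x. (cmod (f x - h x))\<^sup>2)"
    using square_integrable_diff assms unfolding square_integrable_def by blast+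
  have "l2_sq M (\<lambda>x. f x - h x) \<le> (\<integral>x. 2 * (cmod (f x - g x))\<^sup>2 + 2 * (cmod (g x - h x))\<^sup>2 \<partial>M)"
    unfolding l2_sq_def using cmod_add_sq_le[of "f x - g x" "g x - h x" for x] i
    by (intro integral_mono) auto
  also have "\<dots> = 2 * l2_sq M (\<lambda>x. f x - g x) + 2 * l2_sq M (\<lambda>x. g x - h x)"
    unfolding l2_sq_def using i by simp
  finally show ?thesis .
qed

text \<open>Completeness yields a limit along \<open>height\<close>; the Cauchy estimate compares an
  arbitrary low slice with one term of that sequence and thus upgrades the limit to the whole
  octant.\<close>

lemma is_boundary_limit_exists:
  assumes F: "F \<in> hardy_space"
  shows "\<exists>f. is_boundary_limit F f"
proof -
  note sq = slice_square_integrable[OF F]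
  have "\<exists>f. square_integrable lborel f \<and> (\<lambda>n. l2_sq lborel (\<lambda>x. slice F (height n) x - f x)) \<longlonglongrightarrow> 0"
  proof (rule l2_complete[OF sq[OF height_in_octant]])
    fix e :: real assume "e > 0"
    from l2_sq_slice_Cauchy[OF F this] obtain y0 where y0: "y0 \<in> octant"
      "\<And>y y'. y \<in> octant \<Longrightarrow> y' \<in> octant \<Longrightarrow> y0 - y \<in> octant \<Longrightarrow> y0 - y' \<in> octant \<Longrightarrow>
        l2_sq lborel (\<lambda>x. slice F y x - slice F y' x) \<le> e" by blast
    then show "\<exists>N. \<forall>m\<ge>N. \<forall>n\<ge>N. l2_sq lborel (\<lambda>x. slice F (height m) x - slice F (height n) x) \<le> e"
      using height_below[OF y0(1)] unfolding eventually_sequentially by (meson height_in_octant)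
  qed
  then obtain f where f: "square_integrable lborel f"
    "(\<lambda>n. l2_sq lborel (\<lambda>x. slice F (height n) x - f x)) \<longlonglongrightarrow> 0" by blast
  have "((\<lambda>y. l2_sq lborel (\<lambda>x. slice F y x - f x)) \<longlongrightarrow> 0) (at 0 within octant)"
  proof (rule tendstoI)
    fix e :: real assume e: "e > 0"
    \<comment> \<open>Each of the two squared distances enters with factor 2, so the sum stays below
      e/2.\<close>
    then have "e/8 > 0" by simp
    from l2_sq_slice_Cauchy[OF F this] obtain y0 where y0: "y0 \<in> octant"
      "\<And>y y'. y \<in> octant \<Longrightarrow> y' \<in> octant \<Longrightarrow> y0 - y \<in> octant \<Longrightarrow> y0 - y' \<in> octant \<Longrightarrow>
        l2_sq lborel (\<lambda>x. slice F y x - slice F y' x) \<le> e/8" by blast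
    have "\<forall>\<^sub>F n in sequentially. l2_sq lborel (\<lambda>x. slice F (height n) x - f x) < e/8"
      by (rule order_tendstoD(2)[OF f(2) \<open>e/8 > 0\<close>])
    then have "\<forall>\<^sub>F n in sequentially. l2_sq lborel (\<lambda>x. slice F (height n) x - f x) < e/8 \<and> y0 - height n \<in> octant"
      using height_below[OF y0(1)] by (rule eventually_conj)
    then obtain n where n: "l2_sq lborel (\<lambda>x. slice F (height n) x - f x) < e/8" "y0 - height n \<in> octant"
      by (metis (no_types, lifting) eventually_happens trivial_limit_sequentially)
    have "((\<lambda>y. y0 - y) \<longlongrightarrow> y0 - 0) (at 0 within octant)" by (intro tendsto_intros)
    then have "\<forall>\<^sub>F y in at 0 within octant. y0 - y \<in> octant"
      using y0(1) by (intro topological_tendstoD[OF _ octant_open]) auto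
    moreover have "\<forall>\<^sub>F y in at 0 within octant. y \<in> octant" by (simp add: eventually_at_filter)
    ultimately show "\<forall>\<^sub>F y in at 0 within octant. dist (l2_sq lborel (\<lambda>x. slice F y x - f x)) 0 < e"
    proof eventually_elim
      case (elim y)
      have "l2_sq lborel (\<lambda>x. slice F y x - f x) \<le>
        2 * l2_sq lborel (\<lambda>x. slice F y x - slice F (height n) x) + 2 * l2_sq lborel (\<lambda>x. slice F (height n) x - f x)"
        by (intro l2_sq_diff_triangle sq f elim height_in_octant)
      also have "\<dots> < e" using y0(2)[OF elim(2) height_in_octant elim(1) n(2)] n(1) e by simp
      finally show ?case by simp
    qed
  qed
  then have "((\<lambda>y. ennreal (l2_sq lborel (\<lambda>x. slice F y x - f x))) \<longlongrightarrow> 0) (at 0 within octant)"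
    using tendsto_ennrealI by fastforce
  moreover have "\<forall>\<^sub>F y in at 0 within octant. ennreal (l2_sq lborel (\<lambda>x. slice F y x - f x)) =
      (\<integral>\<^sup>+x. ennreal ((cmod (F (re_im_vec x y) - f x))\<^sup>2) \<partial>lborel)"
    using nn_integral_l2_sq[OF square_integrable_diff[OF sq f(1)]]
    by (auto simp: eventually_at_filter slice_def)
  ultimately have "((\<lambda>y. \<integral>\<^sup>+x. ennreal ((cmod (F (re_im_vec x y) - f x))\<^sup>2) \<partial>lborel) \<longlongrightarrow> 0) (at 0 within octant)"
    by (rule Lim_transform_eventually)
  then have "is_boundary_limit F f"
    using f(1) nn_integral_l2_sq[OF f(1)] by (auto simp: is_boundary_limit_def square_integrable_def)
  then show ?thesis by (rule exI[of "is_boundary_limit F" f])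
qed

lemma boundary_limit:
  assumes F: "F \<in> hardy_space"
  shows "square_integrable lborel (boundary_limit F)"
    and "(\<lambda>n. l2_sq lborel (\<lambda>x. slice F (height n) x - boundary_limit F x)) \<longlonglongrightarrow> 0"
proof -
  have b: "is_boundary_limit F (boundary_limit F)"
    unfolding boundary_limit_def by (rule someI_ex[OF is_boundary_limit_exists[OF F]])
  then show sq: "square_integrable lborel (boundary_limit F)"
    by (intro square_integrableI_nn) (auto simp: is_boundary_limit_def)
  have "((\<lambda>n. \<integral>\<^sup>+x. ennreal ((cmod (F (re_im_vec x (height n)) - boundary_limit F x))\<^sup>2) \<partial>lborel) \<longlonglongrightarrow> 0)"
    using b unfolding is_boundary_limit_def by (elim conjE) (rule filterlim_compose[OF _ height_filterlim])
  then have "(\<lambda>n. ennreal (l2_sq lborel (\<lambda>x. slice F (height n) x - boundary_limit F x))) \<longlonglongrightarrow> ennreal 0"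
    unfolding nn_integral_l2_sq[OF square_integrable_diff[OF slice_square_integrable[OF F height_in_octant] sq], symmetric]
    by (simp add: slice_def)
  then show "(\<lambda>n. l2_sq lborel (\<lambda>x. slice F (height n) x - boundary_limit F x)) \<longlonglongrightarrow> 0"
    by (subst (asm) tendsto_ennreal_iff) auto
qed

text \<open>Linearity of the inner product is derived through this limit: slices of a sum are sums
  of slices on the nose, while the chosen boundary representatives need not add up
  pointwise.\<close>

lemma hardy_inner_tendsto:
  assumes "F \<in> hardy_space" "G \<in> hardy_space"
  shows "(\<lambda>n. slice_inner F G (height n) (height n)) \<longlonglongrightarrow> hardy_inner F G"
  unfolding slice_inner_def hardy_inner_def l2_inner_def[symmetric]
  by (intro l2_inner_tendsto slice_square_integrable boundary_limit assms height_in_octant)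

section \<open>The Hardy space and its kernels\<close>

lemma holomorphic_several_add:
  assumes "holomorphic_several F S" "holomorphic_several G S"
  shows "holomorphic_several (\<lambda>z. F z + G z) S"
  unfolding holomorphic_several_def
proof
  fix z assume "z \<in> S"
  then obtain F' G' where "(F has_derivative F') (at z)" "\<And>c v. F' (c *s v) = c * F' v"
    "(G has_derivative G') (at z)" "\<And>c v. G' (c *s v) = c * G' v"
    using assms unfolding holomorphic_several_def by metis
  then show "\<exists>H'. ((\<lambda>z. F z + G z) has_derivative H') (at z) \<and> (\<forall>c v. H' (c *s v) = c * H' v)"
    by (intro exI[of _ "\<lambda>h. F' h + G' h"]) (auto intro: has_derivative_add simp: distrib_left)
qed

lemma holomorphic_several_mult:
  assumes "holomorphic_several F S" "holomorphic_several G S"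
  shows "holomorphic_several (\<lambda>z. F z * G z) S"
  unfolding holomorphic_several_def
proof
  fix z assume "z \<in> S"
  then obtain F' G' where "(F has_derivative F') (at z)" "\<And>c v. F' (c *s v) = c * F' v"
    "(G has_derivative G') (at z)" "\<And>c v. G' (c *s v) = c * G' v"
    using assms unfolding holomorphic_several_def by metis
  then show "\<exists>H'. ((\<lambda>z. F z * G z) has_derivative H') (at z) \<and> (\<forall>c v. H' (c *s v) = c * H' v)"
    by (intro exI[of _ "\<lambda>h. F z * G' h + F' h * G z"]) (auto intro!: has_derivative_mult simp: algebra_simps)
qed

lemma holomorphic_several_const: "holomorphic_several (\<lambda>z. c) S"
  unfolding holomorphic_several_def by (auto intro!: exI[of _ "\<lambda>h. 0"])

lemma holomorphic_several_prod:
  assumes "finite I" "\<And>i. i \<in> I \<Longrightarrow> holomorphic_several (f i) S"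
  shows "holomorphic_several (\<lambda>z. \<Prod>i\<in>I. f i z) S"
  using assms
  by (induction I) (simp_all add: holomorphic_several_const holomorphic_several_mult)

lemma holomorphic_several_component:
  fixes f :: "complex \<Rightarrow> complex"
  assumes "\<And>z. z \<in> S \<Longrightarrow> f field_differentiable (at (z $ k))"
  shows "holomorphic_several (\<lambda>z. f (z $ k)) S"
  unfolding holomorphic_several_def
proof
  fix z assume "z \<in> S"
  then obtain D where "(f has_field_derivative D) (at (z $ k))"
    using assms unfolding field_differentiable_def by blast
  then have D: "(f has_derivative (*) D) (at (z $ k))"
    by (simp add: has_field_derivative_def)
  have "((\<lambda>z. z $ k) has_derivative (\<lambda>h. h $ k)) (at z)"
    by (rule bounded_linear.has_derivative[OF bounded_linear_vec_nth has_derivative_ident])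
  from diff_chain_at[OF this D] have "((\<lambda>z. f (z $ k)) has_derivative (\<lambda>h. D * h $ k)) (at z)"
    by (simp add: o_def)
  then show "\<exists>F'. ((\<lambda>z. f (z $ k)) has_derivative F') (at z) \<and> (\<forall>c v. F' (c *s v) = c * F' v)"
    by (intro exI[of _ "\<lambda>h. D * h $ k"]) (auto simp: algebra_simps)
qed

lemma holomorphic_several_cong:
  assumes "holomorphic_several F S" "open S" "\<And>z. z \<in> S \<Longrightarrow> F z = G z"
  shows "holomorphic_several G S"
  using assms unfolding holomorphic_several_def
  by (meson has_derivative_transform_within_open)

lemma hardy_norm_sq_cong:
  assumes "\<And>z. z \<in> tube \<Longrightarrow> F z = G z"
  shows "hardy_norm_sq F = hardy_norm_sq G"
  unfolding hardy_norm_sq_def using assms by (intro SUP_cong) auto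

text \<open>Needed because the iterated derivatives of the kernel are identified with explicit
  functions on the tube only.\<close>

lemma hardy_space_cong:
  assumes "F \<in> hardy_space" "\<And>z. z \<in> tube \<Longrightarrow> F z = G z"
  shows "G \<in> hardy_space"
  using assms holomorphic_several_cong[OF _ open_tube, of F G] hardy_norm_sq_cong[of F G]
  by (simp add: hardy_space_def)

lemma hardy_space_cmult:
  assumes F: "F \<in> hardy_space"
  shows "(\<lambda>z. c * F z) \<in> hardy_space"
proof (rule hardy_spaceI)
  show "holomorphic_several (\<lambda>z. c * F z) tube"
    by (intro holomorphic_several_mult holomorphic_several_const hardy_space_holomorphic F)
  fix y :: "real ^ 'a" assume y: "y \<in> octant"
  have "(\<integral>\<^sup>+x. ennreal ((cmod (slice (\<lambda>z. c * F z) y x))\<^sup>2) \<partial>lborel) = ennreal (l2_sq lborel (\<lambda>x. c * slice F y x))"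
    unfolding nn_integral_l2_sq[OF square_integrable_cmult[OF slice_square_integrable[OF F y]], symmetric]
    by (simp add: slice_def)
  also have "\<dots> \<le> ennreal ((cmod c)\<^sup>2 * (hardy_norm F)\<^sup>2)"
    using l2_sq_slice_le[OF F y] by (intro ennreal_leI) (simp add: l2_sq_def norm_mult power_mult_distrib mult_left_mono)
  finally show "(\<integral>\<^sup>+x. ennreal ((cmod (slice (\<lambda>z. c * F z) y x))\<^sup>2) \<partial>lborel) \<le> ennreal ((cmod c)\<^sup>2 * (hardy_norm F)\<^sup>2)" .
qed

lemma hardy_space_diff:
  assumes F: "F \<in> hardy_space" and G: "G \<in> hardy_space"
  shows "(\<lambda>z. F z - G z) \<in> hardy_space"
proof (rule hardy_spaceI)
  show "holomorphic_several (\<lambda>z. F z - G z) tube"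
    using holomorphic_several_add[OF hardy_space_holomorphic[OF F] hardy_space_holomorphic[OF hardy_space_cmult[OF G, of "-1"]]]
    by simp
  fix y :: "real ^ 'a" assume y: "y \<in> octant"
  have "(\<integral>\<^sup>+x. ennreal ((cmod (slice (\<lambda>z. F z - G z) y x))\<^sup>2) \<partial>lborel) = ennreal (l2_sq lborel (\<lambda>x. slice F y x - slice G y x))"
    unfolding nn_integral_l2_sq[OF square_integrable_diff[OF slice_square_integrable[OF F y] slice_square_integrable[OF G y]], symmetric]
    by (simp add: slice_def)
  also have "\<dots> \<le> ennreal (2 * (hardy_norm F)\<^sup>2 + 2 * (hardy_norm G)\<^sup>2)"
    using l2_sq_slice_le[OF F y] l2_sq_slice_le[OF G y]
      l2_sq_diff_triangle[OF slice_square_integrable[OF F y] square_integrable_zero slice_square_integrable[OF G y]]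
    by (intro ennreal_leI) (simp add: l2_sq_def)
  finally show "(\<integral>\<^sup>+x. ennreal ((cmod (slice (\<lambda>z. F z - G z) y x))\<^sup>2) \<partial>lborel) \<le> ennreal (2 * (hardy_norm F)\<^sup>2 + 2 * (hardy_norm G)\<^sup>2)" .
qed

lemma hardy_space_add:
  assumes F: "F \<in> hardy_space" and G: "G \<in> hardy_space"
  shows "(\<lambda>z. F z + G z) \<in> hardy_space"
  using hardy_space_diff[OF F hardy_space_cmult[OF G, of "-1"]] by simp

lemma hardy_space_zero: "(\<lambda>z. 0) \<in> hardy_space"
  by (rule hardy_spaceI[where C = 0]) (simp_all add: holomorphic_several_const slice_def)

lemma hardy_space_sum:
  assumes "finite I" "\<And>i. i \<in> I \<Longrightarrow> f i \<in> hardy_space"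
  shows "(\<lambda>z. \<Sum>i\<in>I. f i z) \<in> hardy_space"
  using assms by (induction I) (simp_all add: hardy_space_zero hardy_space_add)

lemma hardy_inner_cnj:
  assumes "F \<in> hardy_space" "G \<in> hardy_space"
  shows "cnj (hardy_inner F G) = hardy_inner G F"
  unfolding hardy_inner_def l2_inner_def[symmetric] by (rule l2_inner_cnj)

lemma hardy_inner_diff:
  assumes F: "F \<in> hardy_space" and G: "G \<in> hardy_space" and H: "H \<in> hardy_space"
  shows "hardy_inner (\<lambda>z. F z - G z) H = hardy_inner F H - hardy_inner G H"
proof (rule LIMSEQ_unique[OF hardy_inner_tendsto])
  have "slice_inner (\<lambda>z. F z - G z) H (height n) (height n) =
    slice_inner F H (height n) (height n) - slice_inner G H (height n) (height n)" for n
    using l2_inner_diff[OF slice_square_integrable[OF F height_in_octant[of n]]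
        slice_square_integrable[OF G height_in_octant] slice_square_integrable[OF H height_in_octant]]
    by (simp add: slice_inner_def slice_def[abs_def])
  then show "(\<lambda>n. slice_inner (\<lambda>z. F z - G z) H (height n) (height n)) \<longlonglongrightarrow> hardy_inner F H - hardy_inner G H"
    by (simp add: tendsto_diff hardy_inner_tendsto F G H)
qed (intro hardy_space_diff F G H)+

lemma hardy_inner_cmult:
  assumes F: "F \<in> hardy_space" and H: "H \<in> hardy_space"
  shows "hardy_inner (\<lambda>z. c * F z) H = c * hardy_inner F H"
proof (rule LIMSEQ_unique[OF hardy_inner_tendsto])
  have "slice_inner (\<lambda>z. c * F z) H (height n) (height n) = c * slice_inner F H (height n) (height n)" for n
    using l2_inner_cmult[of lborel c "slice F (height n)" "slice H (height n)"]
    by (simp add: slice_inner_def slice_def[abs_def])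
  then show "(\<lambda>n. slice_inner (\<lambda>z. c * F z) H (height n) (height n)) \<longlonglongrightarrow> c * hardy_inner F H"
    by (simp add: tendsto_mult_left hardy_inner_tendsto F H)
qed (intro hardy_space_cmult F H)+

lemma hardy_inner_add:
  assumes F: "F \<in> hardy_space" and G: "G \<in> hardy_space" and H: "H \<in> hardy_space"
  shows "hardy_inner (\<lambda>z. F z + G z) H = hardy_inner F H + hardy_inner G H"
  using hardy_inner_diff[OF F hardy_space_cmult[OF G, of "-1"] H] hardy_inner_cmult[OF G H, of "-1"] by simp

lemma hardy_inner_zero:
  assumes "H \<in> hardy_space"
  shows "hardy_inner (\<lambda>z. 0) H = 0"
  using hardy_inner_cmult[OF assms assms, of 0] by simp

lemma hardy_inner_sum:
  assumes "finite I" "\<And>i. i \<in> I \<Longrightarrow> f i \<in> hardy_space" "H \<in> hardy_space"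
  shows "hardy_inner (\<lambda>z. \<Sum>i\<in>I. f i z) H = (\<Sum>i\<in>I. hardy_inner (f i) H)"
  using assms
  by (induction I) (simp_all add: hardy_inner_zero hardy_inner_add hardy_space_sum)

lemma hardy_inner_self:
  assumes F: "F \<in> hardy_space"
  shows "hardy_inner F F = of_real ((hardy_norm F)\<^sup>2)"
proof (rule LIMSEQ_unique[OF hardy_inner_tendsto[OF F F]])
  have "(\<lambda>n. l2_sq lborel (slice F (height n))) \<longlonglongrightarrow> (hardy_norm F)\<^sup>2"
  proof (rule LIMSEQ_I)
    fix e :: real assume e: "e > 0"
    from l2_sq_slice_near_norm[OF F this] obtain y0 where y0: "y0 \<in> octant"
      "\<And>y. y \<in> octant \<Longrightarrow> y0 - y \<in> octant \<Longrightarrow> (hardy_norm F)\<^sup>2 - e < l2_sq lborel (slice F y)" by blast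
    obtain N where N: "\<And>n. n \<ge> N \<Longrightarrow> y0 - height n \<in> octant"
      using height_below[OF y0(1)] unfolding eventually_sequentially by blast
    have "norm (l2_sq lborel (slice F (height n)) - (hardy_norm F)\<^sup>2) < e" if "n \<ge> N" for n
      using y0(2)[OF height_in_octant N[OF that]] l2_sq_slice_le[OF F height_in_octant[of n]] by simp
    then show "\<exists>N. \<forall>n\<ge>N. norm (l2_sq lborel (slice F (height n)) - (hardy_norm F)\<^sup>2) < e" by blast
  qed
  then show "(\<lambda>n. slice_inner F F (height n) (height n)) \<longlonglongrightarrow> of_real ((hardy_norm F)\<^sup>2)"
    unfolding slice_inner_self by (rule tendsto_of_real)
qed

lemma hardy_Cauchy_Schwarz:
  assumes F: "F \<in> hardy_space" and G: "G \<in> hardy_space"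
  shows "cmod (hardy_inner F G) \<le> hardy_norm F * hardy_norm G"
  by (rule LIMSEQ_le_const2[OF tendsto_norm[OF hardy_inner_tendsto[OF F G]]])
     (auto intro!: cmod_slice_inner_le F G)

section \<open>Norms of product kernels\<close>

lemma nn_integral_prod_vec:
  fixes f :: "'n::finite \<Rightarrow> real \<Rightarrow> ennreal"
  assumes [measurable]: "\<And>k. f k \<in> borel_measurable borel"
  shows "(\<integral>\<^sup>+x. (\<Prod>k\<in>UNIV. f k (x $ k)) \<partial>(lborel :: (real ^ 'n) measure)) = (\<Prod>k\<in>UNIV. \<integral>\<^sup>+s. f k s \<partial>lborel)"
proof -
  let ?a = "\<lambda>k. axis k 1 :: real ^ 'n"
  have inj: "inj ?a" by (auto simp: inj_on_def axis_eq_axis)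
  have B: "(Basis :: (real ^ 'n) set) = range ?a" by (auto simp: Basis_vec_def)
  have "(\<integral>\<^sup>+x. (\<Prod>b\<in>Basis. f (inv ?a b) (x \<bullet> b)) \<partial>(lborel :: (real ^ 'n) measure)) =
    (\<Prod>b\<in>(Basis :: (real ^ 'n) set). \<integral>\<^sup>+s. f (inv ?a b) s \<partial>lborel)"
    by (rule nn_integral_lborel_prod) auto
  then show ?thesis
    unfolding B by (simp add: prod.reindex[OF inj] inv_f_f[OF inj] inner_axis)
qed

lemma nn_integral_inverse_one_plus_square:
  "(\<integral>\<^sup>+x. ennreal (1 / (1 + x\<^sup>2)) \<partial>lborel) = ennreal pi"
proof -
  let ?f = "\<lambda>x::real. ennreal (1 / (1 + x\<^sup>2))"
  have half: "(\<integral>\<^sup>+x. ?f x * indicator {0..} x \<partial>lborel) = ennreal (pi / 2)"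
    using nn_integral_FTC_atLeast[of "\<lambda>x. 1 / (1 + x\<^sup>2)" 0 arctan "pi / 2"]
      tendsto_arctan_at_top by (simp add: DERIV_arctan[unfolded inverse_eq_divide])
  \<comment> \<open>The origin lies in both closed half-lines and would be counted twice.\<close>
  have "AE x in lborel. x \<noteq> (0::real)" by (rule AE_lborel_singleton)
  then have "(\<integral>\<^sup>+x. ?f x \<partial>lborel) =
    (\<integral>\<^sup>+x. ?f x * indicator {0..} x + ?f x * indicator {0..} (- x) \<partial>lborel)"
    by (intro nn_integral_cong_AE) (auto elim!: eventually_mono simp: indicator_def)
  also have "\<dots> = (\<integral>\<^sup>+x. ?f x * indicator {0..} x \<partial>lborel) + (\<integral>\<^sup>+x. ?f x * indicator {0..} (- x) \<partial>lborel)"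
    by (rule nn_integral_add) auto
  also have "(\<integral>\<^sup>+x. ?f x * indicator {0..} (- x) \<partial>lborel) = (\<integral>\<^sup>+x. ?f x * indicator {0..} x \<partial>lborel)"
    by (subst nn_integral_real_affine[where c = "-1" and t = 0]) auto
  finally show ?thesis unfolding half by (simp flip: ennreal_plus)
qed

lemma nn_integral_inverse_square_plus_square:
  assumes b: "0 < b"
  shows "(\<integral>\<^sup>+x. ennreal (1 / ((x - r)\<^sup>2 + b\<^sup>2)) \<partial>lborel) = ennreal (pi / b)"
proof -
  have "(\<integral>\<^sup>+x. ennreal (1 / ((x - r)\<^sup>2 + b\<^sup>2)) \<partial>lborel) =
    ennreal b * (\<integral>\<^sup>+x. ennreal (1 / ((r + b * x - r)\<^sup>2 + b\<^sup>2)) \<partial>lborel)"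
    using b by (subst nn_integral_real_affine[where c = b and t = r]) auto
  also have "(\<lambda>x. ennreal (1 / ((r + b * x - r)\<^sup>2 + b\<^sup>2))) = (\<lambda>x. ennreal (1 / b\<^sup>2) * ennreal (1 / (1 + x\<^sup>2)))"
  proof
    fix x
    have "1 / ((r + b * x - r)\<^sup>2 + b\<^sup>2) = 1 / b\<^sup>2 * (1 / (1 + x\<^sup>2))"
      using b by (simp add: power_mult_distrib field_simps)
    then show "ennreal (1 / ((r + b * x - r)\<^sup>2 + b\<^sup>2)) = ennreal (1 / b\<^sup>2) * ennreal (1 / (1 + x\<^sup>2))"
      by (simp add: ennreal_mult[symmetric] del: times_divide_eq_left times_divide_eq_right)
  qed
  also have "ennreal b * (\<integral>\<^sup>+x. ennreal (1 / b\<^sup>2) * ennreal (1 / (1 + x\<^sup>2)) \<partial>lborel) = ennreal (b * (1 / b\<^sup>2 * pi))"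
    using b by (subst nn_integral_cmult) (auto simp: nn_integral_inverse_one_plus_square ennreal_mult[symmetric])
  also have "b * (1 / b\<^sup>2 * pi) = pi / b" using b by (simp add: power2_eq_square)
  finally show ?thesis .
qed

text \<open>Up to constants, the partial derivatives of the Cauchy-Szego kernel with respect to the
  conjugated pole. \<open>\<alpha>\<close> counts derivatives per coordinate, so
  \<open>\<alpha> = 0\<close> belongs to the kernel itself; hence the \<open>Suc\<close>.\<close>

definition power_kernel :: "('n \<Rightarrow> nat) \<Rightarrow> complex ^ 'n \<Rightarrow> complex ^ 'n \<Rightarrow> complex" where
  "power_kernel \<alpha> z w = (\<Prod>k\<in>UNIV. (1 / (w $ k - cnj (z $ k))) ^ Suc (\<alpha> k))"

lemma tube_diff_cnj_nonzero:
  assumes "z \<in> tube" "w \<in> tube"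
  shows "w $ k - cnj (z $ k) \<noteq> 0"
proof -
  have "0 < Im (w $ k) + Im (z $ k)"
    using assms unfolding tube_iff by (intro add_pos_pos) auto
  then have "0 < Im (w $ k - cnj (z $ k))" by simp
  then show ?thesis by (metis less_irrefl zero_complex.simps(2))
qed

text \<open>In every coordinate all but one of the factors are estimated by the distance Im (z $ k)
  of the pole from the real line. The remaining factor is replaced by its value at height 0, which
  is integrable and independent of y.\<close>

lemma power_kernel_bound:
  assumes z: "z \<in> tube" and y: "\<And>k. 0 \<le> y $ k"
  shows "(cmod (power_kernel \<alpha> z (re_im_vec x y)))\<^sup>2 \<le>
    (\<Prod>k\<in>UNIV. (1 / (Im (z $ k))\<^sup>2) ^ \<alpha> k * (1 / ((x $ k - Re (z $ k))\<^sup>2 + (Im (z $ k))\<^sup>2)))"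
proof -
  have "(cmod (power_kernel \<alpha> z (re_im_vec x y)))\<^sup>2 =
    (\<Prod>k\<in>UNIV. (1 / (cmod (re_im_vec x y $ k - cnj (z $ k)))\<^sup>2) ^ Suc (\<alpha> k))"
  proof -
    have "((1 / a) ^ m)\<^sup>2 = (1 / a\<^sup>2) ^ m" for a :: real and m
      by (simp add: power_divide power_mult[symmetric] mult.commute)
    then show ?thesis
      by (simp add: power_kernel_def prod_norm[symmetric] norm_power norm_divide prod_power_distrib
          del: power_Suc re_im_vec_nth)
  qed
  also have "\<dots> \<le> (\<Prod>k\<in>UNIV. (1 / (Im (z $ k))\<^sup>2) ^ \<alpha> k * (1 / ((x $ k - Re (z $ k))\<^sup>2 + (Im (z $ k))\<^sup>2)))"
  proof (rule prod_mono, rule conjI)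
    fix k
    have I: "0 < Im (z $ k)" using z by (simp add: tube_iff)
    have eq: "(cmod (re_im_vec x y $ k - cnj (z $ k)))\<^sup>2 = (x $ k - Re (z $ k))\<^sup>2 + (y $ k + Im (z $ k))\<^sup>2"
      by (simp add: cmod_power2)
    have "(Im (z $ k))\<^sup>2 \<le> (y $ k + Im (z $ k))\<^sup>2" using y[of k] I by (intro power_mono) auto
    then have *: "(x $ k - Re (z $ k))\<^sup>2 + (Im (z $ k))\<^sup>2 \<le> (cmod (re_im_vec x y $ k - cnj (z $ k)))\<^sup>2"
      unfolding eq by simp
    have **: "(Im (z $ k))\<^sup>2 \<le> (x $ k - Re (z $ k))\<^sup>2 + (Im (z $ k))\<^sup>2" by simp
    have P: "0 < (Im (z $ k))\<^sup>2" using I by simp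
    have "(1 / (cmod (re_im_vec x y $ k - cnj (z $ k)))\<^sup>2) ^ \<alpha> k \<le> (1 / (Im (z $ k))\<^sup>2) ^ \<alpha> k"
    proof (rule power_mono)
      show "1 / (cmod (re_im_vec x y $ k - cnj (z $ k)))\<^sup>2 \<le> 1 / (Im (z $ k))\<^sup>2"
        using * ** P by (intro divide_left_mono mult_pos_pos) linarith+
    qed simp
    moreover have "1 / (cmod (re_im_vec x y $ k - cnj (z $ k)))\<^sup>2 \<le> 1 / ((x $ k - Re (z $ k))\<^sup>2 + (Im (z $ k))\<^sup>2)"
      using * ** P by (intro divide_left_mono mult_pos_pos) linarith+
    ultimately show "(1 / (cmod (re_im_vec x y $ k - cnj (z $ k)))\<^sup>2) ^ Suc (\<alpha> k) \<le>
      (1 / (Im (z $ k))\<^sup>2) ^ \<alpha> k * (1 / ((x $ k - Re (z $ k))\<^sup>2 + (Im (z $ k))\<^sup>2))"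
      unfolding power_Suc2 by (intro mult_mono) auto
  qed auto
  finally show ?thesis .
qed

lemma nn_integral_power_kernel:
  fixes z :: "complex ^ 'n"
  assumes z: "z \<in> tube" and y: "\<And>k. 0 \<le> y $ k"
  shows "(\<integral>\<^sup>+x. ennreal ((cmod (power_kernel \<alpha> z (re_im_vec x y)))\<^sup>2) \<partial>lborel) \<le>
    ennreal (\<Prod>k\<in>UNIV. (1 / (Im (z $ k))\<^sup>2) ^ \<alpha> k * (pi / Im (z $ k)))"
proof -
  have I: "0 < Im (z $ k)" for k using z by (simp add: tube_iff)
  have "(\<integral>\<^sup>+x. ennreal ((cmod (power_kernel \<alpha> z (re_im_vec x y)))\<^sup>2) \<partial>lborel) \<le>
    (\<integral>\<^sup>+x. (\<Prod>k\<in>UNIV. ennreal ((1 / (Im (z $ k))\<^sup>2) ^ \<alpha> k) * ennreal (1 / ((x $ k - Re (z $ k))\<^sup>2 + (Im (z $ k))\<^sup>2))) \<partial>(lborel :: (real ^ 'n) measure))"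
  proof (rule nn_integral_mono)
    fix x :: "real ^ 'n"
    show "ennreal ((cmod (power_kernel \<alpha> z (re_im_vec x y)))\<^sup>2) \<le>
      (\<Prod>k\<in>UNIV. ennreal ((1 / (Im (z $ k))\<^sup>2) ^ \<alpha> k) * ennreal (1 / ((x $ k - Re (z $ k))\<^sup>2 + (Im (z $ k))\<^sup>2)))"
      using ennreal_leI[OF power_kernel_bound[OF z y, of \<alpha> x]]
      by (simp add: prod_ennreal ennreal_mult[symmetric] del: times_divide_eq_left times_divide_eq_right)
  qed
  also have "\<dots> = (\<Prod>k\<in>UNIV. \<integral>\<^sup>+s. ennreal ((1 / (Im (z $ k))\<^sup>2) ^ \<alpha> k) * ennreal (1 / ((s - Re (z $ k))\<^sup>2 + (Im (z $ k))\<^sup>2)) \<partial>lborel)"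
    by (rule nn_integral_prod_vec) simp
  also have "\<dots> = (\<Prod>k\<in>UNIV. ennreal ((1 / (Im (z $ k))\<^sup>2) ^ \<alpha> k) * ennreal (pi / Im (z $ k)))"
    by (subst nn_integral_cmult) (auto simp: nn_integral_inverse_square_plus_square[OF I])
  also have "\<dots> = ennreal (\<Prod>k\<in>UNIV. (1 / (Im (z $ k))\<^sup>2) ^ \<alpha> k * (pi / Im (z $ k)))"
    using less_imp_le[OF I]
    by (simp add: prod_ennreal ennreal_mult[symmetric] del: times_divide_eq_left times_divide_eq_right)
  finally show ?thesis .
qed

lemma power_kernel_in_hardy_space:
  assumes z: "z \<in> tube"
  shows "power_kernel \<alpha> z \<in> hardy_space"
proof (rule hardy_spaceI)
  show "holomorphic_several (power_kernel \<alpha> z) tube"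
    unfolding power_kernel_def
  proof (intro holomorphic_several_prod)
    fix k
    show "holomorphic_several (\<lambda>w. (1 / (w $ k - cnj (z $ k))) ^ Suc (\<alpha> k)) tube"
      by (rule holomorphic_several_component[of tube "\<lambda>\<zeta>. (1 / (\<zeta> - cnj (z $ k))) ^ Suc (\<alpha> k)"])
         (use tube_diff_cnj_nonzero[OF z] in \<open>intro field_differentiable_power field_differentiable_divide field_differentiable_diff field_differentiable_const field_differentiable_ident; simp\<close>)
  qed simp
  fix y :: "real ^ 'a" assume "y \<in> octant"
  then have "0 \<le> y $ k" for k by (simp add: octant_def less_imp_le)
  from nn_integral_power_kernel[OF z this, of \<alpha>]
  show "(\<integral>\<^sup>+x. ennreal ((cmod (slice (power_kernel \<alpha> z) y x))\<^sup>2) \<partial>lborel) \<le>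
    ennreal (\<Prod>k\<in>UNIV. (1 / (Im (z $ k))\<^sup>2) ^ \<alpha> k * (pi / Im (z $ k)))"
    by (simp add: slice_def)
qed

section \<open>Multiple kernels\<close>

text \<open>Only factor \<open>j\<close> varies. It is holomorphic in the conjugated pole
  \<open>c\<close>, which runs along the real line \<open>c + t * cnj e\<close>. A general complex
  \<open>e\<close> serves both partial derivatives in \<open>dbar\<close>.\<close>

lemma power_kernel_has_vector_derivative:
  assumes z: "z \<in> tube" and w: "w \<in> tube"
  shows "((\<lambda>t::real. power_kernel \<alpha> (z + t *\<^sub>R axis j e) w) has_vector_derivative
    cnj e * (of_nat (Suc (\<alpha> j)) * power_kernel (\<alpha>(j := Suc (\<alpha> j))) z w)) (at 0)"
proof -
  define R where "R = (\<Prod>k\<in>UNIV - {j}. (1 / (w $ k - cnj (z $ k))) ^ Suc (\<alpha> k))"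
  define a where "a = w $ j"
  define c where "c = cnj (z $ j)"
  have ac: "a - c \<noteq> 0" unfolding a_def c_def by (rule tube_diff_cnj_nonzero[OF z w])
  have L: "power_kernel \<alpha> (z + t *\<^sub>R axis j e) w = (1 / (a - (c + of_real t * cnj e))) ^ Suc (\<alpha> j) * R" for t :: real
  proof -
    have "(\<Prod>k\<in>UNIV - {j}. (1 / (w $ k - cnj ((z + t *\<^sub>R axis j e) $ k))) ^ Suc (\<alpha> k)) = R"
      unfolding R_def by (rule prod.cong) (auto simp: axis_def)
    then show ?thesis
      unfolding power_kernel_def
      by (subst prod.remove[of UNIV j]) (simp_all add: axis_def a_def c_def scaleR_conv_of_real[symmetric] del: power_Suc)
  qed
  have R': "power_kernel (\<alpha>(j := Suc (\<alpha> j))) z w = (1 / (a - c)) ^ Suc (Suc (\<alpha> j)) * R"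
  proof -
    have "(\<Prod>k\<in>UNIV - {j}. (1 / (w $ k - cnj (z $ k))) ^ Suc ((\<alpha>(j := Suc (\<alpha> j))) k)) = R"
      unfolding R_def by (rule prod.cong) auto
    then show ?thesis
      unfolding power_kernel_def
      by (subst prod.remove[of UNIV j]) (simp_all add: a_def c_def del: power_Suc)
  qed
  have "((\<lambda>c. 1 / (a - c)) has_field_derivative (1 / (a - c))\<^sup>2) (at c)"
    using ac by (auto intro!: derivative_eq_intros simp: power2_eq_square)
  from DERIV_cmult_right[OF DERIV_power[OF this, of "Suc (\<alpha> j)"], of R]
  have "((\<lambda>c. (1 / (a - c)) ^ Suc (\<alpha> j) * R) has_field_derivative
      of_nat (Suc (\<alpha> j)) * power_kernel (\<alpha>(j := Suc (\<alpha> j))) z w) (at c)"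
    unfolding R' by (simp add: power2_eq_square mult_ac)
  then have "((\<lambda>c. (1 / (a - c)) ^ Suc (\<alpha> j) * R) has_field_derivative
      of_nat (Suc (\<alpha> j)) * power_kernel (\<alpha>(j := Suc (\<alpha> j))) z w) (at (c + of_real 0 * cnj e))"
    by simp
  moreover have "((\<lambda>t::real. c + of_real t * cnj e) has_vector_derivative cnj e) (at 0)"
    by (auto intro!: derivative_eq_intros)
  ultimately show ?thesis
    unfolding L using field_vector_diff_chain_at[of "\<lambda>t::real. c + of_real t * cnj e" "cnj e" 0]
    by (simp add: o_def)
qed

text \<open>The span of the power kernels, which differentiation in the pole maps into itself.
  Members keep both arguments because derivatives act on the pole and membership in the Hardy space
  concerns the other variable.\<close>

inductive kernel_combination :: "(complex ^ 'n \<Rightarrow> complex ^ 'n \<Rightarrow> complex) \<Rightarrow> bool" where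
  power: "kernel_combination (power_kernel \<alpha>)"
| zero: "kernel_combination (\<lambda>z w. 0)"
| add: "kernel_combination G \<Longrightarrow> kernel_combination H \<Longrightarrow> kernel_combination (\<lambda>z w. G z w + H z w)"
| cmult: "kernel_combination G \<Longrightarrow> kernel_combination (\<lambda>z w. c * G z w)"

lemma kernel_combination_sum:
  assumes "finite I" "\<And>i. i \<in> I \<Longrightarrow> kernel_combination (G i)"
  shows "kernel_combination (\<lambda>z w. \<Sum>i\<in>I. G i z w)"
  using assms by (induction I) (auto intro: kernel_combination.intros)

lemma kernel_combination_hardy_space:
  assumes "kernel_combination G" "z \<in> tube"
  shows "G z \<in> hardy_space"
  using assms
  by (induction) (auto intro: power_kernel_in_hardy_space hardy_space_zero hardy_space_add hardy_space_cmult)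

text \<open>The factor \<open>cnj e\<close> says that a combination depends antiholomorphically on the pole,
  which is why \<open>dbar\<close> sees the full derivative.\<close>

lemma kernel_combination_derivative:
  assumes "kernel_combination G"
  shows "\<exists>G'. kernel_combination G' \<and> (\<forall>z\<in>tube. \<forall>w\<in>tube. \<forall>e.
    ((\<lambda>t::real. G (z + t *\<^sub>R axis j e) w) has_vector_derivative cnj e * G' z w) (at 0))"
  using assms
proof induction
  case (power \<alpha>)
  show ?case
    by (intro exI[of _ "\<lambda>z w. of_nat (Suc (\<alpha> j)) * power_kernel (\<alpha>(j := Suc (\<alpha> j))) z w"] conjI
        kernel_combination.intros ballI allI power_kernel_has_vector_derivative)
next
  case zero
  show ?case
    by (intro exI[of _ "\<lambda>z w. 0"]) (auto intro: kernel_combination.intros)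
next
  case (add G H)
  then obtain G' H' where "kernel_combination G'" "\<forall>z\<in>tube. \<forall>w\<in>tube. \<forall>e.
      ((\<lambda>t::real. G (z + t *\<^sub>R axis j e) w) has_vector_derivative cnj e * G' z w) (at 0)"
    "kernel_combination H'" "\<forall>z\<in>tube. \<forall>w\<in>tube. \<forall>e.
      ((\<lambda>t::real. H (z + t *\<^sub>R axis j e) w) has_vector_derivative cnj e * H' z w) (at 0)"
    by blast
  then show ?case
    by (intro exI[of _ "\<lambda>z w. G' z w + H' z w"])
       (auto intro: kernel_combination.intros has_vector_derivative_add simp: distrib_left)
next
  case (cmult G c)
  then obtain G' where G': "kernel_combination G'" "\<And>z w e. z \<in> tube \<Longrightarrow> w \<in> tube \<Longrightarrow>
      ((\<lambda>t::real. G (z + t *\<^sub>R axis j e) w) has_vector_derivative cnj e * G' z w) (at 0)"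
    by blast
  have "((\<lambda>t::real. c * G (z + t *\<^sub>R axis j e) w) has_vector_derivative cnj e * (c * G' z w)) (at 0)"
    if "z \<in> tube" "w \<in> tube" for z w e
    using has_vector_derivative_mult_right[OF G'(2)[OF that], of c e] by (simp add: mult.left_commute)
  with G'(1) show ?case
    by (intro exI[of _ "\<lambda>z w. c * G' z w"]) (auto intro: kernel_combination.intros)
qed

text \<open>Shaped for iteration: \<open>G'\<close> depends on \<open>G\<close> and \<open>d\<close>
  alone, and \<open>H\<close> is any function that agrees with \<open>G\<close> on the tube, which
  is all that is known of an iterated derivative. Openness of the tube makes this enough.\<close>

lemma kernel_combination_dir_dbar:
  assumes "kernel_combination G"
  shows "\<exists>G'. kernel_combination G' \<and> (\<forall>H w. w \<in> tube \<longrightarrow> (\<forall>z\<in>tube. H z = G z w) \<longrightarrow>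
    (\<forall>z\<in>tube. dir_dbar d H z = G' z w))"
proof -
  have "\<forall>j. \<exists>G'. kernel_combination G' \<and> (\<forall>z\<in>tube. \<forall>w\<in>tube. \<forall>e.
    ((\<lambda>t::real. G (z + t *\<^sub>R axis j e) w) has_vector_derivative cnj e * G' z w) (at 0))"
    using kernel_combination_derivative[OF assms] by blast
  then obtain D where D: "\<And>j. kernel_combination (D j)" "\<And>j z w e. z \<in> tube \<Longrightarrow> w \<in> tube \<Longrightarrow>
    ((\<lambda>t::real. G (z + t *\<^sub>R axis j e) w) has_vector_derivative cnj e * D j z w) (at 0)"
    by metis
  have "dir_dbar d H z = (\<Sum>j\<in>UNIV. d $ j * D j z w)"
    if w: "w \<in> tube" and H: "\<forall>z\<in>tube. H z = G z w" and z: "z \<in> tube" for H z w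
  proof -
    have vd: "vector_derivative (\<lambda>t::real. H (z + t *\<^sub>R axis j e)) (at 0) = cnj e * D j z w" for j e
    proof (rule vector_derivative_at, rule has_vector_derivative_transform_within_open[OF D(2)[OF z w]])
      let ?S = "(\<lambda>t::real. z + t *\<^sub>R axis j e) -` tube"
      show "open ?S" by (intro open_vimage open_tube continuous_intros)
      show "0 \<in> ?S" using z by simp
      show "G (z + t *\<^sub>R axis j e) w = H (z + t *\<^sub>R axis j e)" if "t \<in> ?S" for t
        using H that by simp
    qed
    \<comment> \<open>The directions 1 and \<open>\<i>\<close> give D and \<open>- \<i> * D\<close>;
      after multiplication of the second by \<open>\<i>\<close> the two contributions
      coincide.\<close>
    have "dbar j H z = D j z w" for j
      unfolding dbar_def vd by (simp add: algebra_simps)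
    then show ?thesis by (simp add: dir_dbar_def)
  qed
  then show ?thesis
    by (intro exI[of _ "\<lambda>z w. \<Sum>j\<in>UNIV. d $ j * D j z w"])
       (auto intro!: kernel_combination_sum kernel_combination.cmult D(1))
qed

lemma kernel_at_eq:
  fixes z :: "complex ^ 'n"
  shows "kernel_at z w = (- 1 / (2 * of_real pi * \<i>)) ^ CARD('n) * power_kernel (\<lambda>k. 0) z w"
proof -
  have "kernel_at z w = (\<Prod>k\<in>UNIV. (- 1 / (2 * of_real pi * \<i>)) * (1 / (w $ k - cnj (z $ k))))"
    unfolding kernel_at_def cauchy_szego_def by (rule prod.cong) auto
  also have "\<dots> = (- 1 / (2 * of_real pi * \<i>)) ^ CARD('n) * power_kernel (\<lambda>k. 0) z w"
    unfolding prod.distrib power_kernel_def by simp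
  finally show ?thesis .
qed

lemma kernel_at_in_hardy_space: "z \<in> tube \<Longrightarrow> kernel_at z \<in> hardy_space"
  unfolding kernel_at_eq[abs_def] by (intro hardy_space_cmult power_kernel_in_hardy_space)

lemma kernel_combination_iterated_dir_dbar:
  "\<exists>G. kernel_combination G \<and>
    (\<forall>z\<in>tube. \<forall>w\<in>tube. (dir_dbar d ^^ l) (\<lambda>z. kernel_at z w) z = G z w)"
proof (induction l)
  case 0
  show ?case
    unfolding kernel_at_eq
    by (intro exI[of _ "\<lambda>z w. (- 1 / (2 * of_real pi * \<i>)) ^ CARD('a) * power_kernel (\<lambda>k. 0) z w"])
       (auto intro!: kernel_combination.cmult kernel_combination.power)
next
  case (Suc l)
  then obtain G where G: "kernel_combination G"
    "\<And>z w. z \<in> tube \<Longrightarrow> w \<in> tube \<Longrightarrow> (dir_dbar d ^^ l) (\<lambda>z. kernel_at z w) z = G z w" by blast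
  obtain G' where G': "kernel_combination G'" "\<And>H w z. w \<in> tube \<Longrightarrow> (\<forall>z\<in>tube. H z = G z w) \<Longrightarrow> z \<in> tube \<Longrightarrow>
    dir_dbar d H z = G' z w"
    using kernel_combination_dir_dbar[OF G(1), of d] by blast
  have "(dir_dbar d ^^ Suc l) (\<lambda>z. kernel_at z w) z = G' z w" if "z \<in> tube" "w \<in> tube" for z w
    using G'(2)[of w "(dir_dbar d ^^ l) (\<lambda>z. kernel_at z w)" z] G(2) that by simp
  with G'(1) show ?case by blast
qed

lemma multiple_kernel_in_hardy_space:
  assumes "zs k \<in> tube"
  shows "multiple_kernel d zs k \<in> hardy_space"
proof -
  define l where "l = multiplicity_at zs k - 1"
  obtain G where G: "kernel_combination G"
    "\<And>z w. z \<in> tube \<Longrightarrow> w \<in> tube \<Longrightarrow> (dir_dbar d ^^ l) (\<lambda>z. kernel_at z w) z = G z w"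
    using kernel_combination_iterated_dir_dbar[where d = d and l = l] by blast
  have "(\<lambda>w. inverse (fact l) * G (zs k) w) \<in> hardy_space"
    by (intro hardy_space_cmult kernel_combination_hardy_space G assms)
  moreover have "multiple_kernel d zs k = (\<lambda>w. (dir_dbar d ^^ l) (\<lambda>z. kernel_at z w) (zs k) / fact l)"
    by (simp only: multiple_kernel_def Let_def l_def)
  ultimately show ?thesis
    by (elim hardy_space_cong) (simp add: G(2)[OF assms] divide_inverse)
qed

text \<open>Makes the kernel itself, and so point evaluation, available for every point outside the
  sequence, at every step.\<close>

lemma multiple_kernel_first_occurrence:
  assumes "\<And>j. j < k \<Longrightarrow> zs j \<noteq> zs k"
  shows "multiple_kernel d zs k = kernel_at (zs k)"
proof -
  have "{j. j \<le> k \<and> zs j = zs k} = {k}" using assms by (auto simp: le_less)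
  then have "multiplicity_at zs k = 1" by (simp add: multiplicity_at_def)
  then show ?thesis by (simp add: multiple_kernel_def)
qed

section \<open>Reproducing property\<close>

text \<open>The kernel as a function of the horizontal difference and of the sum of the heights of
  argument and pole, so that height can be passed from one to the other.\<close>

definition szego :: "real ^ 'n \<Rightarrow> real ^ 'n \<Rightarrow> complex" where
  "szego a b = (\<Prod>k\<in>UNIV. - 1 / (2 * of_real pi * \<i> * Complex (a $ k) (b $ k)))"

lemma kernel_at_re_im_vec: "kernel_at (re_im_vec p q) (re_im_vec x y) = szego (x - p) (y + q)"
proof -
  have "Complex a b - cnj (Complex c d) = Complex (a - c) (b + d)" for a b c d
    by (simp add: complex_eq_iff)
  then show ?thesis by (simp add: kernel_at_def cauchy_szego_def szego_def)
qed

lemma slice_kernel_at: "slice (kernel_at (re_im_vec p q)) y = (\<lambda>x. szego (x - p) (y + q))"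
  by (simp add: slice_def kernel_at_re_im_vec fun_eq_iff)

lemma szego_square_integrable:
  assumes "b \<in> octant"
  shows "square_integrable lborel (\<lambda>x. szego (x - p) b)"
proof -
  \<comment> \<open>Half of the height goes to the pole and half to the slice.\<close>
  have h: "(1/2) *\<^sub>R b \<in> octant" using assms by (intro octant_scaleR) auto
  have "square_integrable lborel (slice (kernel_at (re_im_vec p ((1/2) *\<^sub>R b))) ((1/2) *\<^sub>R b))"
    by (intro slice_square_integrable kernel_at_in_hardy_space) (use h in auto)
  then show ?thesis unfolding slice_kernel_at by (simp add: scaleR_add_left[symmetric])
qed

lemma cmod_szego_antimono:
  assumes "b \<in> octant" "\<And>k. b $ k \<le> b' $ k"
  shows "cmod (szego a b') \<le> cmod (szego a b)"
  unfolding szego_def prod_norm[symmetric]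
proof (rule prod_mono, rule conjI)
  fix k
  have b: "0 < b $ k" using assms(1) by (simp add: octant_def)
  have "cmod (Complex (a $ k) (b $ k)) \<le> cmod (Complex (a $ k) (b' $ k))"
    using b assms(2)[of k] by (simp add: cmod_def power_mono)
  moreover have "0 < cmod (Complex (a $ k) (b $ k))" using b by (simp add: complex_eq_iff)
  ultimately have "1 / (2 * pi * cmod (Complex (a $ k) (b' $ k))) \<le> 1 / (2 * pi * cmod (Complex (a $ k) (b $ k)))"
    by (intro divide_left_mono mult_left_mono mult_pos_pos) auto
  then show "cmod (- 1 / (2 * of_real pi * \<i> * Complex (a $ k) (b' $ k))) \<le>
      cmod (- 1 / (2 * of_real pi * \<i> * Complex (a $ k) (b $ k)))"
    by (simp add: norm_divide norm_mult)
qed auto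

text \<open>The modulus of the kernel decreases with the height, so approaching \<open>b\<close>
  from above makes the kernel at \<open>b\<close> the dominating function.\<close>

lemma szego_inner_tendsto:
  assumes f: "square_integrable lborel f" and b: "b \<in> octant"
    and c: "c \<longlonglongrightarrow> b" "\<And>n k. b $ k \<le> c n $ k"
  shows "(\<lambda>n. l2_inner lborel f (\<lambda>x. szego (x - p) (c n))) \<longlonglongrightarrow> l2_inner lborel f (\<lambda>x. szego (x - p) b)"
  unfolding l2_inner_def
proof (rule integral_dominated_convergence[where w = "\<lambda>x. cmod (f x) * cmod (szego (x - p) b)"])
  have co: "c n \<in> octant" for n
    using b c(2)[of _ n] unfolding octant_def by (auto intro: less_le_trans)
  show "integrable lborel (\<lambda>x. cmod (f x) * cmod (szego (x - p) b))"
    by (rule integrable_cmod_mult[OF f szego_square_integrable[OF b]])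
  show "(\<lambda>x. f x * cnj (szego (x - p) b)) \<in> borel_measurable lborel"
    using l2_inner_integrable[OF f szego_square_integrable[OF b]] by auto
  show "(\<lambda>x. f x * cnj (szego (x - p) (c n))) \<in> borel_measurable lborel" for n
    using l2_inner_integrable[OF f szego_square_integrable[OF co]] by auto
  show "AE x in lborel. (\<lambda>n. f x * cnj (szego (x - p) (c n))) \<longlonglongrightarrow> f x * cnj (szego (x - p) b)"
  proof (rule AE_I2)
    fix x
    have "2 * of_real pi * \<i> * Complex ((x - p) $ k) (b $ k) \<noteq> 0" for k
      using b by (auto simp: complex_eq_iff octant_def) (metis less_irrefl)
    then show "(\<lambda>n. f x * cnj (szego (x - p) (c n))) \<longlonglongrightarrow> f x * cnj (szego (x - p) b)"
      unfolding szego_def by (intro tendsto_intros tendsto_vec_nth c(1))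
  qed
  show "AE x in lborel. norm (f x * cnj (szego (x - p) (c n))) \<le> cmod (f x) * cmod (szego (x - p) b)" for n
    using cmod_szego_antimono[OF b c(2)] by (auto simp: norm_mult intro!: mult_left_mono)
qed

text \<open>Part \<open>e\<close> of the pole's height is moved onto the slice of \<open>F\<close>,
  trading the boundary function for an honest slice. At positive heights this is
  \<open>slice_inner_shift\<close>; the surplus \<open>height n + height n\<close> then tends to
  0.\<close>

lemma hardy_inner_kernel_at:
  assumes F: "F \<in> hardy_space" and e: "e \<in> octant" and b: "b \<in> octant"
  shows "hardy_inner F (kernel_at (re_im_vec p (e + b))) = l2_inner lborel (slice F e) (\<lambda>x. szego (x - p) b)"
proof (rule LIMSEQ_unique[OF hardy_inner_tendsto[OF F]])
  show "kernel_at (re_im_vec p (e + b)) \<in> hardy_space"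
    by (intro kernel_at_in_hardy_space) (simp add: octant_add e b)
  have G: "kernel_at (re_im_vec p b) \<in> hardy_space"
    by (intro kernel_at_in_hardy_space) (simp add: b)
  have "slice_inner F (kernel_at (re_im_vec p (e + b))) (height n) (height n) =
    l2_inner lborel (slice F e) (\<lambda>x. szego (x - p) (height n + height n + b))" for n
  proof -
    \<comment> \<open>Raising the pole by \<open>e\<close> has the same effect as raising the second
      slice by \<open>e\<close>.\<close>
    have "slice_inner F (kernel_at (re_im_vec p (e + b))) (height n) (height n) =
      slice_inner F (kernel_at (re_im_vec p b)) (height n) (height n + e)"
      by (simp add: slice_inner_def slice_kernel_at add.assoc)
    also have "\<dots> = slice_inner F (kernel_at (re_im_vec p b)) e (height n + height n)"
      by (rule slice_inner_shift[OF F G height_in_octant octant_add[OF height_in_octant e] e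
            octant_add[OF height_in_octant height_in_octant]]) (simp add: ac_simps)
    finally show ?thesis by (simp add: slice_inner_def slice_kernel_at)
  qed
  moreover have "(\<lambda>n. l2_inner lborel (slice F e) (\<lambda>x. szego (x - p) (height n + height n + b))) \<longlonglongrightarrow>
    l2_inner lborel (slice F e) (\<lambda>x. szego (x - p) b)"
  proof (rule szego_inner_tendsto[OF slice_square_integrable[OF F e] b])
    show "(\<lambda>n. height n + height n + b) \<longlonglongrightarrow> b"
      using tendsto_add[OF tendsto_add[OF height_tendsto height_tendsto] tendsto_const[of b]] by simp
    show "b $ k \<le> (height n + height n + b) $ k" for n k by (simp add: height_def)
  qed
  ultimately show "(\<lambda>n. slice_inner F (kernel_at (re_im_vec p (e + b))) (height n) (height n)) \<longlonglongrightarrow>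
    l2_inner lborel (slice F e) (\<lambda>x. szego (x - p) b)" by simp
qed

text \<open>Splitting y into halves fixes the slice at y/2, so that only the height in the kernel
  varies.\<close>

lemma hardy_inner_kernel_at_tendsto:
  assumes F: "F \<in> hardy_space" and y: "y \<in> octant"
  shows "(\<lambda>n. hardy_inner F (kernel_at (re_im_vec p (y + height n)))) \<longlonglongrightarrow> hardy_inner F (kernel_at (re_im_vec p y))"
proof -
  let ?h = "(1/2) *\<^sub>R y"
  have h: "?h \<in> octant" using y by (intro octant_scaleR) auto
  have "y = ?h + ?h" by (simp add: scaleR_add_left[symmetric])
  then have 1: "hardy_inner F (kernel_at (re_im_vec p y)) = l2_inner lborel (slice F ?h) (\<lambda>x. szego (x - p) ?h)"
    using hardy_inner_kernel_at[OF F h h] by simp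
  have 2: "hardy_inner F (kernel_at (re_im_vec p (y + height n))) =
      l2_inner lborel (slice F ?h) (\<lambda>x. szego (x - p) (?h + height n))" for n
    using hardy_inner_kernel_at[OF F h octant_add[OF h height_in_octant[of n]]] \<open>y = ?h + ?h\<close>
    by (metis add.assoc)
  show ?thesis
    unfolding 1 2
  proof (rule szego_inner_tendsto[OF slice_square_integrable[OF F h] h])
    show "(\<lambda>n. ?h + height n) \<longlonglongrightarrow> ?h"
      using tendsto_add[OF tendsto_const[of ?h] height_tendsto] by simp
  qed (simp add: height_def)
qed

text \<open>Moving the contour in direction \<open>j\<close> to \<open>+\<infinity>\<close>: there is no pole in the way.\<close>

lemma integral_no_pole_zero:
  fixes \<rho> :: "real ^ 'n \<Rightarrow> complex"
  assumes F: "F \<in> hardy_space" and e: "e \<in> octant" and b: "0 < b"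
    and \<rho>: "continuous_on UNIV \<rho>" "\<And>x s. \<rho> (x + s *\<^sub>R axis j 1) = \<rho> x"
    and sq: "square_integrable lborel (\<lambda>x. \<rho> x / Complex (x $ j - r) b)"
  shows "(\<integral>x. slice F e x * (\<rho> x / Complex (x $ j - r) b) \<partial>lborel) = 0"
proof -
  define q where "q t x = \<rho> x / Complex (x $ j - r) (b + t)" for t x
  have nz: "Complex a (b + t) \<noteq> 0" if "0 \<le> t" for a t
    using b that by (simp add: complex_eq_iff)
  have cq: "continuous_on UNIV (q t)" if "0 \<le> t" for t
    unfolding q_def using nz[OF that] \<rho>(1) by (intro continuous_intros) auto
  have mq: "q t \<in> borel_measurable lborel" if "0 \<le> t" for t
    using borel_measurable_continuous_onI[OF cq[OF that]] by simp
  have qle: "cmod (q t x) \<le> cmod (q 0 x)" if "0 \<le> t" for t x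
  proof -
    have "cmod (Complex (x $ j - r) (b + 0)) \<le> cmod (Complex (x $ j - r) (b + t))"
      using b that by (simp add: cmod_def power_mono)
    then show ?thesis
      unfolding q_def norm_divide using nz[of 0] nz[OF that]
      by (intro divide_left_mono mult_pos_pos) (auto simp del: Complex_eq_0)
  qed
  have sq0: "square_integrable lborel (q 0)" using sq by (simp add: q_def[abs_def])
  have sqt: "square_integrable lborel (q t)" if "0 \<le> t" for t
    by (rule square_integrable_bound[OF mq[OF that] sq0, where C = 1])
       (use qle[OF that] in \<open>auto intro!: power_mono\<close>)
  have l2q: "l2_sq lborel (q t) \<le> l2_sq lborel (q 0)" if "0 \<le> t" for t
    unfolding l2_sq_def using sqt[OF that] sq0 qle[OF that]
    by (intro integral_mono power_mono) (auto simp: square_integrable_def)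
  have shift: "(\<integral>x. slice F e x * q 0 x \<partial>lborel) = (\<integral>x. slice F (e + t *\<^sub>R axis j 1) x * q t x \<partial>lborel)"
    if t: "0 \<le> t" for t
  proof -
    \<comment> \<open>\<open>contour_shift\<close> moves through the unit strip, so the distance
      \<open>t\<close> is absorbed into the direction.\<close>
    define g where "g x s = slice F (e + s *\<^sub>R (t *\<^sub>R axis j 1)) x * q (s * t) x" for x s
    have oct: "e + s *\<^sub>R (t *\<^sub>R axis j 1) \<in> octant" if "0 \<le> s" for s
      using e t that by (auto simp: octant_def axis_def add_pos_nonneg)
    have "(\<integral>x. g x 0 \<partial>lborel) = (\<integral>x. g x 1 \<partial>lborel)"
    proof (rule contour_shift[where u = "t *\<^sub>R axis j 1" and C = "hardy_norm F * sqrt (l2_sq lborel (q 0))"])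
      fix x
      have "(\<lambda>\<zeta>. \<rho> x / (of_real (x $ j - r) + \<i> * of_real b + of_real t * \<zeta>)) holomorphic_on {\<zeta>. Im \<zeta> \<in> {0..1}}"
      proof (intro holomorphic_intros)
        fix \<zeta> assume "\<zeta> \<in> {\<zeta>. Im \<zeta> \<in> {0..1}}"
        then have "0 < b + t * Im \<zeta>" using b t by (simp add: add_pos_nonneg)
        then have "0 < Im (of_real (x $ j - r) + \<i> * of_real b + of_real t * \<zeta>)" by simp
        then show "of_real (x $ j - r) + \<i> * of_real b + of_real t * \<zeta> \<noteq> 0" by (metis less_irrefl zero_complex.simps(2))
      qed
      also have "(\<lambda>\<zeta>. \<rho> x / (of_real (x $ j - r) + \<i> * of_real b + of_real t * \<zeta>)) =
        (\<lambda>\<zeta>. q (Im \<zeta> * t) (x + Re \<zeta> *\<^sub>R (t *\<^sub>R axis j 1)))"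
      proof
        fix \<zeta>
        have "\<rho> (x + Re \<zeta> *\<^sub>R (t *\<^sub>R axis j 1)) = \<rho> x" using \<rho>(2)[of x "Re \<zeta> * t"] by simp
        moreover have "of_real (x $ j - r) + \<i> * of_real b + of_real t * \<zeta> =
          Complex ((x + Re \<zeta> *\<^sub>R (t *\<^sub>R axis j 1)) $ j - r) (b + Im \<zeta> * t)"
          by (simp add: complex_eq_iff axis_def algebra_simps)
        ultimately show "\<rho> x / (of_real (x $ j - r) + \<i> * of_real b + of_real t * \<zeta>) =
          q (Im \<zeta> * t) (x + Re \<zeta> *\<^sub>R (t *\<^sub>R axis j 1))" by (simp add: q_def)
      qed
      finally have "(\<lambda>\<zeta>. q (Im \<zeta> * t) (x + Re \<zeta> *\<^sub>R (t *\<^sub>R axis j 1))) holomorphic_on {\<zeta>. Im \<zeta> \<in> {0..1}}" .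
      moreover have "(\<lambda>\<zeta>. F (re_im_vec (x + Re \<zeta> *\<^sub>R (t *\<^sub>R axis j 1)) (e + Im \<zeta> *\<^sub>R (t *\<^sub>R axis j 1))))
          holomorphic_on {\<zeta>. Im \<zeta> \<in> {0..1}}"
        by (rule holomorphic_several_line[OF hardy_space_holomorphic[OF F]]) (use oct in auto)
      ultimately show "(\<lambda>\<zeta>. g (x + Re \<zeta> *\<^sub>R (t *\<^sub>R axis j 1)) (Im \<zeta>)) holomorphic_on {\<zeta>. Im \<zeta> \<in> {0..1}}"
        unfolding g_def slice_def by (intro holomorphic_on_mult)
    next
      have "continuous_on (UNIV \<times> {0..1}) (\<lambda>p. F (re_im_vec (fst p) (e + snd p *\<^sub>R (t *\<^sub>R axis j 1))))"
        by (rule continuous_on_compose2[OF holomorphic_several_continuous_on[OF hardy_space_holomorphic[OF F]]])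
           (use oct in \<open>auto intro!: continuous_intros\<close>)
      moreover have "continuous_on (UNIV \<times> {0..1}) (\<lambda>p. q (snd p * t) (fst p))"
        unfolding q_def
      proof (intro continuous_intros ballI)
        show "continuous_on (UNIV \<times> {0..1}) (\<lambda>p. \<rho> (fst p))"
          by (rule continuous_on_compose2[OF \<rho>(1)]) (auto intro!: continuous_intros)
        show "Complex (fst p $ j - r) (b + snd p * t) \<noteq> 0" if "p \<in> UNIV \<times> {0..1}" for p
          using that t by (intro nz) auto
      qed
      ultimately show "continuous_on (UNIV \<times> {0..1}) (\<lambda>(x, s). g x s)"
        unfolding g_def slice_def case_prod_unfold by (intro continuous_intros)
    next
      fix s :: real assume s: "s \<in> {0..1}"
      then have st: "0 \<le> s" "0 \<le> s * t" using t by auto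
      show "(\<integral>\<^sup>+x. ennreal (cmod (g x s)) \<partial>lborel) \<le> ennreal (hardy_norm F * sqrt (l2_sq lborel (q 0)))"
        unfolding g_def using l2q[OF st(2)]
        by (intro nn_integral_mult_le slice_square_integrable F l2_sq_slice_le oct st sqt) auto
    qed
    then show ?thesis by (simp add: g_def)
  qed
  \<comment> \<open>The integral is the same for all shifts. The kernel factor tends to 0 in L2
    while the slices of \<open>F\<close> stay bounded by the Hardy norm.\<close>
  have "(\<lambda>n. l2_sq lborel (q (real n))) \<longlonglongrightarrow> l2_sq lborel (\<lambda>x :: real ^ 'n. 0)"
    unfolding l2_sq_def
  proof (rule integral_dominated_convergence[where w = "\<lambda>x. (cmod (q 0 x))\<^sup>2"])
    show "integrable lborel (\<lambda>x. (cmod (q 0 x))\<^sup>2)" using sq0 by (simp add: square_integrable_def)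
    show "(\<lambda>x. (cmod (q (real n) x))\<^sup>2) \<in> borel_measurable lborel" for n
      using mq[of "real n"] by measurable
    show "AE x in lborel. norm ((cmod (q (real n) x))\<^sup>2) \<le> (cmod (q 0 x))\<^sup>2" for n
      using qle[of "real n"] by (auto intro!: power_mono)
    show "AE x in lborel. (\<lambda>n. (cmod (q (real n) x))\<^sup>2) \<longlonglongrightarrow> (cmod 0)\<^sup>2"
    proof (rule AE_I2)
      fix x
      have "filterlim (\<lambda>n. b + real n) at_top sequentially"
        by (rule filterlim_tendsto_add_at_top[OF tendsto_const filterlim_real_sequentially])
      moreover have "\<forall>n. b + real n \<le> cmod (Complex (x $ j - r) (b + real n))"
      proof
        fix n
        have "b + real n \<le> \<bar>Im (Complex (x $ j - r) (b + real n))\<bar>" by simp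
        also have "\<dots> \<le> cmod (Complex (x $ j - r) (b + real n))" by (rule abs_Im_le_cmod)
        finally show "b + real n \<le> cmod (Complex (x $ j - r) (b + real n))" .
      qed
      ultimately have "filterlim (\<lambda>n. cmod (Complex (x $ j - r) (b + real n))) at_top sequentially"
        by (rule filterlim_at_top_mono[OF _ always_eventually])
      then have "filterlim (\<lambda>n. Complex (x $ j - r) (b + real n)) at_infinity sequentially"
        by (rule filterlim_norm_at_top_imp_at_infinity)
      then have "(\<lambda>n. q (real n) x) \<longlonglongrightarrow> 0"
        unfolding q_def by (rule tendsto_divide_0[OF tendsto_const])
      from tendsto_power[OF tendsto_norm[OF this], of 2]
      show "(\<lambda>n. (cmod (q (real n) x))\<^sup>2) \<longlonglongrightarrow> (cmod 0)\<^sup>2" .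
    qed
  qed simp
  then have "(\<lambda>n. hardy_norm F * sqrt (l2_sq lborel (q (real n)))) \<longlonglongrightarrow> hardy_norm F * sqrt 0"
    by (intro tendsto_intros) (simp add: l2_sq_def)
  moreover have "cmod (\<integral>x. slice F e x * q 0 x \<partial>lborel) \<le> hardy_norm F * sqrt (l2_sq lborel (q (real n)))" for n
  proof -
    have o: "e + real n *\<^sub>R axis j 1 \<in> octant"
      using e by (auto simp: octant_def axis_def add_pos_nonneg)
    have "cmod (\<integral>x. slice F e x * q 0 x \<partial>lborel) =
      cmod (l2_inner lborel (slice F (e + real n *\<^sub>R axis j 1)) (\<lambda>x. cnj (q (real n) x)))"
      using shift[of "real n"] by (simp add: l2_inner_def)
    also have "\<dots> \<le> sqrt (l2_sq lborel (slice F (e + real n *\<^sub>R axis j 1))) * sqrt (l2_sq lborel (\<lambda>x. cnj (q (real n) x)))"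
      by (intro l2_Cauchy_Schwarz slice_square_integrable F o square_integrable_cnj sqt) simp
    also have "\<dots> \<le> hardy_norm F * sqrt (l2_sq lborel (q (real n)))"
      using real_le_lsqrt[OF _ l2_sq_slice_le[OF F o]]
      by (intro mult_mono) (auto simp: l2_sq_def)
    finally show ?thesis .
  qed
  ultimately have "cmod (\<integral>x. slice F e x * q 0 x \<partial>lborel) \<le> hardy_norm F * sqrt 0"
    by (intro LIMSEQ_le_const) auto
  then show ?thesis by (simp add: q_def)
qed

definition poisson :: "real \<Rightarrow> real \<Rightarrow> real" where
  "poisson b a = b / (pi * (a\<^sup>2 + b\<^sup>2))"

text \<open>In each coordinate the Poisson kernel differs from the Cauchy kernel by a term that has no
  pole in the upper half plane, so the two kernels reproduce the same value.\<close>

lemma szego_inner_eq_poisson: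
  fixes b p :: "real ^ 'n"
  assumes F: "F \<in> hardy_space" and e: "e \<in> octant" and b: "b \<in> octant"
  shows "l2_inner lborel (slice F e) (\<lambda>x. szego (x - p) b) =
    (\<integral>x. slice F e x * of_real (\<Prod>k\<in>UNIV. poisson (b $ k) (x $ k - p $ k)) \<partial>lborel)"
proof -
  \<comment> \<open>\<open>A\<close> is the conjugated Cauchy factor, with its pole in the upper
    half plane; \<open>B\<close> is its mirror image, with the pole in the lower one. Their
    difference is the Poisson kernel.\<close>
  define A where "A k x = 1 / (2 * of_real pi * \<i> * Complex (x $ k - p $ k) (- (b $ k)))" for k and x :: "real ^ 'n"
  define B where "B k x = 1 / (2 * of_real pi * \<i> * Complex (x $ k - p $ k) (b $ k))" for k and x :: "real ^ 'n"
  \<comment> \<open>Interpolates between the two kernels: Poisson factors in the coordinates of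
    \<open>I\<close>, Cauchy factors elsewhere. Induction on \<open>I\<close> exchanges one
    coordinate at a time.\<close>
  define R where "R I x = (\<Prod>k\<in>I. A k x - B k x) * (\<Prod>k\<in>-I. A k x)" for I and x :: "real ^ 'n"
  have bk: "0 < b $ k" for k using b by (simp add: octant_def)
  have nz: "Complex a (- (b $ k)) \<noteq> 0" "Complex a (b $ k) \<noteq> 0" for a k
    using bk[of k] by (auto simp: complex_eq_iff)
  have cA: "continuous_on UNIV (A k)" and cB: "continuous_on UNIV (B k)" for k
    unfolding A_def B_def using nz by (intro continuous_intros; simp)+
  have cR: "continuous_on UNIV (R I)" for I
    unfolding R_def by (intro continuous_intros cA cB)
  have normB: "cmod (B k x) = cmod (A k x)" for k x
  proof -
    have "cmod (Complex a (- d)) = cmod (Complex a d)" for a d by (simp add: cmod_def)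
    then show ?thesis by (simp add: A_def B_def norm_divide norm_mult)
  qed
  have szego: "cnj (szego (x - p) b) = (\<Prod>k\<in>UNIV. A k x)" for x
  proof -
    have "cnj (- 1 / (2 * of_real pi * \<i> * Complex ((x - p) $ k) (b $ k))) = A k x" for k
    proof -
      have "cnj (Complex c d) = Complex c (- d)" for c d by (simp add: complex_eq_iff)
      then show ?thesis by (simp add: A_def)
    qed
    then show ?thesis by (simp add: szego_def)
  qed
  \<comment> \<open>Since \<open>A\<close> and \<open>B\<close> have equal modulus, every mixed
    kernel is dominated by the Cauchy kernel and inherits its square integrability.\<close>
  have normR: "cmod (R I x) \<le> 2 ^ card I * cmod (szego (x - p) b)" for I x
  proof -
    have "cmod (R I x) = (\<Prod>k\<in>I. cmod (A k x - B k x)) * (\<Prod>k\<in>-I. cmod (A k x))"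
      by (simp add: R_def norm_mult prod_norm)
    also have "\<dots> \<le> (\<Prod>k\<in>I. 2 * cmod (A k x)) * (\<Prod>k\<in>-I. cmod (A k x))"
    proof (intro mult_right_mono prod_mono conjI)
      show "cmod (A k x - B k x) \<le> 2 * cmod (A k x)" for k
        using norm_triangle_ineq4[of "A k x" "B k x"] normB[of k x] by simp
    qed (auto intro: prod_nonneg)
    also have "\<dots> = 2 ^ card I * ((\<Prod>k\<in>I. cmod (A k x)) * (\<Prod>k\<in>-I. cmod (A k x)))"
      by (simp add: prod.distrib)
    also have "(\<Prod>k\<in>I. cmod (A k x)) * (\<Prod>k\<in>-I. cmod (A k x)) = (\<Prod>k\<in>UNIV. cmod (A k x))"
      by (subst prod.union_disjoint[symmetric]) (auto intro: prod.cong)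
    also have "\<dots> = cmod (szego (x - p) b)"
      by (metis complex_mod_cnj prod_norm szego)
    finally show ?thesis .
  qed
  have sqR: "square_integrable lborel (R I)" for I
  proof (rule square_integrable_bound[OF _ szego_square_integrable[OF b, of p], where C = "(2 ^ card I)\<^sup>2"])
    show "R I \<in> borel_measurable lborel"
      using borel_measurable_continuous_onI[OF cR] by simp
    show "AE x in lborel. (cmod (R I x))\<^sup>2 \<le> (2 ^ card I)\<^sup>2 * (cmod (szego (x - p) b))\<^sup>2"
      unfolding power_mult_distrib[symmetric] by (intro AE_I2 power_mono normR) simp
  qed
  have int: "integrable lborel (\<lambda>x. slice F e x * R I x)" for I
    by (intro square_integrable_mult slice_square_integrable F e sqR)
  have step: "(\<integral>x. slice F e x * R (insert j I) x \<partial>lborel) = (\<integral>x. slice F e x * R I x \<partial>lborel)"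
    if j: "j \<notin> I" for j I
  proof -
    define \<rho> where "\<rho> x = (\<Prod>k\<in>I. A k x - B k x) * (\<Prod>k\<in>-insert j I. A k x) / (2 * of_real pi * \<i>)" for x
    have eq: "R I x - R (insert j I) x = \<rho> x / Complex (x $ j - p $ j) (b $ j)" for x
    proof -
      have "- I = insert j (- insert j I)" using j by auto
      then have "(\<Prod>k\<in>-I. A k x) = A j x * (\<Prod>k\<in>-insert j I. A k x)"
        by (metis Compl_iff finite insertI1 prod.insert)
      then have "R I x - R (insert j I) x = B j x * ((\<Prod>k\<in>I. A k x - B k x) * (\<Prod>k\<in>-insert j I. A k x))"
        using j by (simp add: R_def algebra_simps)
      then show ?thesis by (simp add: B_def \<rho>_def)
    qed
    have "(\<integral>x. slice F e x * (\<rho> x / Complex (x $ j - p $ j) (b $ j)) \<partial>lborel) = 0"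
    proof (rule integral_no_pole_zero[OF F e bk])
      show "continuous_on UNIV \<rho>" unfolding \<rho>_def by (intro continuous_intros cA cB) auto
      show "\<rho> (x + s *\<^sub>R axis j 1) = \<rho> x" for x s
      proof -
        have "A k (x + s *\<^sub>R axis j 1) = A k x" "B k (x + s *\<^sub>R axis j 1) = B k x" if "k \<noteq> j" for k
          using that by (auto simp: A_def B_def axis_def)
        moreover have "k \<noteq> j" if "k \<in> I" for k using that j by auto
        ultimately show ?thesis by (simp add: \<rho>_def)
      qed
      show "square_integrable lborel (\<lambda>x. \<rho> x / Complex (x $ j - p $ j) (b $ j))"
        unfolding eq[symmetric] by (intro square_integrable_diff sqR)
    qed
    also have "(\<lambda>x. slice F e x * (\<rho> x / Complex (x $ j - p $ j) (b $ j))) =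
      (\<lambda>x. slice F e x * R I x - slice F e x * R (insert j I) x)"
      unfolding eq[symmetric] by (simp add: right_diff_distrib)
    finally show ?thesis by (simp add: int)
  qed
  have "(\<integral>x. slice F e x * R I x \<partial>lborel) = (\<integral>x. slice F e x * R {} x \<partial>lborel)" if "finite I" for I
    using that by induction (simp_all add: step)
  from this[of UNIV] have "(\<integral>x. slice F e x * R {} x \<partial>lborel) = (\<integral>x. slice F e x * R UNIV x \<partial>lborel)"
    by simp
  moreover have "R UNIV x = of_real (\<Prod>k\<in>UNIV. poisson (b $ k) (x $ k - p $ k))" for x
  proof -
    have "A k x - B k x = of_real (poisson (b $ k) (x $ k - p $ k))" for k
    proof -
      define a where "a = x $ k - p $ k"
      have "Complex a (- (b $ k)) * Complex a (b $ k) = of_real (a\<^sup>2 + (b $ k)\<^sup>2)"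
        by (simp add: complex_eq_iff power2_eq_square)
      moreover have "A k x - B k x =
        (Complex a (b $ k) - Complex a (- (b $ k))) / (2 * of_real pi * \<i> * (Complex a (- (b $ k)) * Complex a (b $ k)))"
        unfolding A_def B_def a_def[symmetric] using nz[of a k] by (simp add: field_simps)
      moreover have "Complex a (b $ k) - Complex a (- (b $ k)) = 2 * \<i> * of_real (b $ k)"
        by (simp add: complex_eq_iff)
      ultimately show ?thesis by (simp add: poisson_def a_def)
    qed
    then show ?thesis by (simp add: R_def)
  qed
  moreover have "R {} x = cnj (szego (x - p) b)" for x by (simp add: R_def szego)
  ultimately show ?thesis by (simp add: l2_inner_def)
qed

lemma integral_lborel_affine:
  fixes f :: "'a::euclidean_space \<Rightarrow> complex"
  assumes [measurable]: "f \<in> borel_measurable borel" and c: "0 < c"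
  shows "(\<integral>x. f x \<partial>lborel) = (\<integral>x. c ^ DIM('a) *\<^sub>R f (t + c *\<^sub>R x) \<partial>lborel)"
proof -
  have "(\<integral>x. f x \<partial>lborel) = (\<integral>x. f x \<partial>density (distr lborel borel (\<lambda>x. t + c *\<^sub>R x)) (\<lambda>_. \<bar>c\<bar> ^ DIM('a)))"
    using c by (subst lborel_affine[of c t]) auto
  also have "\<dots> = (\<integral>x. c ^ DIM('a) *\<^sub>R f (t + c *\<^sub>R x) \<partial>lborel)"
    using c by (subst integral_density) (auto simp: integral_distr)
  finally show ?thesis .
qed

text \<open>The Poisson kernel of height 1 in every coordinate: a fixed probability density,
  independent of the height that later shrinks to 0.\<close>

definition poisson1 :: "real ^ 'n \<Rightarrow> real" where
  "poisson1 s = (\<Prod>k\<in>UNIV. poisson 1 (s $ k))"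

lemma poisson1_nonneg: "0 \<le> poisson1 s"
  unfolding poisson1_def poisson_def by (intro prod_nonneg) auto

lemma poisson1_continuous: "continuous_on UNIV poisson1"
proof -
  have "a\<^sup>2 + 1 \<noteq> 0" for a :: real
    using zero_le_power2[of a] by linarith
  then show ?thesis
    unfolding poisson1_def poisson_def by (intro continuous_intros) auto
qed

lemma nn_integral_poisson1: "(\<integral>\<^sup>+s. ennreal (poisson1 s) \<partial>(lborel :: (real ^ 'n) measure)) = 1"
proof -
  have 1: "(\<integral>\<^sup>+x. ennreal (poisson 1 x) \<partial>lborel) = 1"
  proof -
    have "(\<integral>\<^sup>+x. ennreal (poisson 1 x) \<partial>lborel) = (\<integral>\<^sup>+x. ennreal (1 / pi) * ennreal (1 / ((x - 0)\<^sup>2 + 1\<^sup>2)) \<partial>lborel)"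
      by (intro nn_integral_cong) (simp add: poisson_def ennreal_mult[symmetric])
    also have "\<dots> = ennreal (1 / pi) * ennreal (pi / 1)"
      by (subst nn_integral_cmult, simp) (simp only: nn_integral_inverse_square_plus_square[OF zero_less_one])
    also have "\<dots> = 1" by (simp flip: ennreal_mult)
    finally show ?thesis .
  qed
  have "(\<integral>\<^sup>+s. ennreal (poisson1 s) \<partial>(lborel :: (real ^ 'n) measure)) = (\<integral>\<^sup>+s. (\<Prod>k\<in>UNIV. ennreal (poisson 1 (s $ k))) \<partial>(lborel :: (real ^ 'n) measure))"
    by (intro nn_integral_cong) (auto simp: poisson1_def poisson_def prod_ennreal)
  also have "\<dots> = (\<Prod>k\<in>(UNIV :: 'n set). \<integral>\<^sup>+x. ennreal (poisson 1 x) \<partial>lborel)"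
    by (rule nn_integral_prod_vec) (simp add: poisson_def)
  finally show ?thesis by (simp add: 1)
qed

text \<open>The substitution x = p + c s moves the parameter \<open>c\<close> from the kernel into
  the argument of the slice. Equal increments in all coordinates suffice, since
  \<open>height\<close> has this form.\<close>

lemma hardy_inner_kernel_at_poisson:
  fixes e :: "real ^ 'n"
  assumes F: "F \<in> hardy_space" and e: "e \<in> octant" and c: "0 < c"
  shows "hardy_inner F (kernel_at (re_im_vec p (e + c *\<^sub>R 1))) =
    (\<integral>s. of_real (poisson1 s) * slice F e (p + c *\<^sub>R s) \<partial>lborel)"
proof -
  have b: "c *\<^sub>R 1 \<in> (octant :: (real ^ 'n) set)" using c by (simp add: octant_def)
  have [measurable]: "slice F e \<in> borel_measurable borel"
    by (rule slice_measurable[OF hardy_space_holomorphic[OF F] e])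
  have [measurable]: "(\<lambda>x :: real ^ 'n. \<Prod>k\<in>UNIV. poisson c (x $ k - p $ k)) \<in> borel_measurable borel"
  proof -
    have "a\<^sup>2 + c\<^sup>2 \<noteq> 0" for a :: real
      using c zero_le_power2[of a] zero_less_power[OF c, of 2] by linarith
    then have "continuous_on UNIV (\<lambda>x :: real ^ 'n. \<Prod>k\<in>UNIV. poisson c (x $ k - p $ k))"
      unfolding poisson_def by (intro continuous_intros) auto
    then show ?thesis by (rule borel_measurable_continuous_onI)
  qed
  have "hardy_inner F (kernel_at (re_im_vec p (e + c *\<^sub>R 1))) =
    (\<integral>x. slice F e x * of_real (\<Prod>k\<in>UNIV. poisson c (x $ k - p $ k)) \<partial>lborel)"
    using hardy_inner_kernel_at[OF F e b] szego_inner_eq_poisson[OF F e b] by simp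
  also have "\<dots> = (\<integral>s. c ^ CARD('n) *\<^sub>R (slice F e (p + c *\<^sub>R s) *
      of_real (\<Prod>k\<in>UNIV. poisson c ((p + c *\<^sub>R s) $ k - p $ k))) \<partial>lborel)"
  proof -
    have "(\<lambda>x. slice F e x * of_real (\<Prod>k\<in>UNIV. poisson c (x $ k - p $ k))) \<in> borel_measurable borel"
      by measurable
    from integral_lborel_affine[OF this c, of p] show ?thesis by (simp del: of_real_prod)
  qed
  also have "\<dots> = (\<integral>s. of_real (poisson1 s) * slice F e (p + c *\<^sub>R s) \<partial>lborel)"
  proof (rule Bochner_Integration.integral_cong[OF refl])
    fix s :: "real ^ 'n"
    have "c ^ CARD('n) * (\<Prod>k\<in>UNIV. poisson c ((p + c *\<^sub>R s) $ k - p $ k)) =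
      (\<Prod>k\<in>(UNIV :: 'n set). c * poisson c ((p + c *\<^sub>R s) $ k - p $ k))"
      by (simp add: prod.distrib)
    also have "\<dots> = poisson1 s"
      unfolding poisson1_def
    proof (rule prod.cong[OF refl])
      fix k
      have "(c * s $ k)\<^sup>2 + c\<^sup>2 = c\<^sup>2 * ((s $ k)\<^sup>2 + 1)" by (simp add: power_mult_distrib algebra_simps)
      then show "c * poisson c ((p + c *\<^sub>R s) $ k - p $ k) = poisson 1 (s $ k)"
        using c by (simp add: poisson_def power2_eq_square)
    qed
    finally show "c ^ CARD('n) *\<^sub>R (slice F e (p + c *\<^sub>R s) *
        of_real (\<Prod>k\<in>UNIV. poisson c ((p + c *\<^sub>R s) $ k - p $ k))) =
      of_real (poisson1 s) * slice F e (p + c *\<^sub>R s)"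
      by (simp add: scaleR_conv_of_real mult.left_commute mult.commute flip: of_real_mult of_real_power of_real_prod)
  qed
  finally show ?thesis .
qed

section \<open>L2 convergence of Poisson averages\<close>

lemma l2_translate:
  fixes f :: "'a::euclidean_space \<Rightarrow> complex"
  assumes "square_integrable lborel f"
  shows "square_integrable lborel (\<lambda>x. f (x + c))" "l2_sq lborel (\<lambda>x. f (x + c)) = l2_sq lborel f"
proof -
  have [measurable]: "f \<in> borel_measurable borel" using assms by (simp add: square_integrable_def)
  have "(\<integral>\<^sup>+x. ennreal ((cmod (f (x + c)))\<^sup>2) \<partial>lborel) = ennreal (l2_sq lborel f)"
    using nn_integral_translate[of "\<lambda>x. ennreal ((cmod (f x))\<^sup>2)" c] nn_integral_l2_sq[OF assms] by simp
  note eq = this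
  show "square_integrable lborel (\<lambda>x. f (x + c))"
    by (rule square_integrableI_nn) (simp_all add: eq)
  from nn_integral_l2_sq[OF this] eq show "l2_sq lborel (\<lambda>x. f (x + c)) = l2_sq lborel f" by simp
qed

lemma l2_translate_diff_le:
  fixes f :: "'a::euclidean_space \<Rightarrow> complex"
  assumes "square_integrable lborel f"
  shows "l2_sq lborel (\<lambda>x. f (x + c) - f x) \<le> 4 * l2_sq lborel f"
  using l2_sq_diff_triangle[OF l2_translate(1)[OF assms, of c] square_integrable_zero assms] l2_translate(2)[OF assms, of c]
  by (simp add: l2_sq_def)

text \<open>Fatou's lemma for \<open>2|a|\<^sup>2 + 2|b|\<^sup>2 - |a - b|\<^sup>2\<close>, where \<open>a\<close> is the translate of \<open>b\<close>.\<close>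

lemma l2_translate_tendsto:
  fixes f :: "'a::euclidean_space \<Rightarrow> complex"
  assumes f: "square_integrable lborel f" and cont: "continuous_on UNIV f" and s: "s \<longlonglongrightarrow> 0"
  shows "(\<lambda>n. l2_sq lborel (\<lambda>x. f (x + s n) - f x)) \<longlonglongrightarrow> 0"
proof (rule LIMSEQ_I)
  fix e :: real assume e: "e > 0"
  define A where "A = l2_sq lborel f"
  define D where "D n = l2_sq lborel (\<lambda>x. f (x + s n) - f x)" for n
  define \<phi> where "\<phi> n x = 2 * (cmod (f (x + s n)))\<^sup>2 + 2 * (cmod (f x))\<^sup>2 - (cmod (f (x + s n) - f x))\<^sup>2" for n x
  have [measurable]: "f \<in> borel_measurable borel" using f by (simp add: square_integrable_def)
  have int: "integrable lborel (\<lambda>x. (cmod (f x))\<^sup>2)" "integrable lborel (\<lambda>x. (cmod (f (x + s n)))\<^sup>2)"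
    "integrable lborel (\<lambda>x. (cmod (f (x + s n) - f x))\<^sup>2)" for n
    using f l2_translate(1)[OF f, of "s n"] square_integrable_diff[OF l2_translate(1)[OF f, of "s n"] f]
    by (auto simp: square_integrable_def)
  have nn: "0 \<le> \<phi> n x" for n x
    unfolding \<phi>_def using cmod_diff_sq_le[of "f (x + s n)" "f x"] by simp
  have iphi: "(\<integral>\<^sup>+x. ennreal (\<phi> n x) \<partial>lborel) = ennreal (4 * A - D n)" for n
  proof -
    have "(\<integral>\<^sup>+x. ennreal (\<phi> n x) \<partial>lborel) = ennreal (\<integral>x. \<phi> n x \<partial>lborel)"
      by (rule nn_integral_eq_integral) (use nn int(1) int(2,3)[of n] in \<open>auto simp: \<phi>_def\<close>)
    also have "(\<integral>x. \<phi> n x \<partial>lborel) = 2 * l2_sq lborel (\<lambda>x. f (x + s n)) + 2 * A - D n"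
      unfolding \<phi>_def A_def D_def l2_sq_def using int(1) int(2,3)[of n] by simp
    finally show ?thesis using l2_translate(2)[OF f, of "s n"] by (simp add: A_def)
  qed
  have lim: "(\<lambda>n. ennreal (\<phi> n x)) \<longlonglongrightarrow> ennreal (4 * (cmod (f x))\<^sup>2)" for x
  proof -
    have "isCont f x" using cont by (simp add: continuous_on_eq_continuous_at)
    moreover have "(\<lambda>n. x + s n) \<longlonglongrightarrow> x" using tendsto_add[OF tendsto_const[of x] s] by simp
    ultimately have l: "(\<lambda>n. f (x + s n)) \<longlonglongrightarrow> f x" by (rule isCont_tendsto_compose)
    have "(\<lambda>n. \<phi> n x) \<longlonglongrightarrow> 2 * (cmod (f x))\<^sup>2 + 2 * (cmod (f x))\<^sup>2 - (cmod (f x - f x))\<^sup>2"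
      unfolding \<phi>_def by (intro tendsto_intros l)
    then show ?thesis by (intro tendsto_ennrealI) simp
  qed
  have "ennreal (4 * A) = (\<integral>\<^sup>+x. ennreal (4 * (cmod (f x))\<^sup>2) \<partial>lborel)"
    using nn_integral_l2_sq[OF f] by (simp add: A_def ennreal_mult nn_integral_cmult)
  also have "\<dots> = (\<integral>\<^sup>+x. liminf (\<lambda>n. ennreal (\<phi> n x)) \<partial>lborel)"
    using lim_imp_Liminf[OF trivial_limit_sequentially lim] by simp
  also have "\<dots> \<le> liminf (\<lambda>n. \<integral>\<^sup>+x. ennreal (\<phi> n x) \<partial>lborel)"
    by (rule nn_integral_liminf) (simp add: \<phi>_def)
  finally have *: "ennreal (4 * A) \<le> liminf (\<lambda>n. ennreal (4 * A - D n))" by (simp add: iphi)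
  have A0: "0 \<le> A" and Dle: "D n \<le> 4 * A" and D0: "0 \<le> D n" for n
    unfolding A_def D_def using l2_translate_diff_le[OF f] by auto
  \<comment> \<open>If 4 A < e the bound D n \<le> 4 A is enough, and
    \<open>ennreal (4 * A - e)\<close> would be truncated to 0. Otherwise 4 A - e is nonnegative and
    the liminf bound can be read off.\<close>
  have "\<forall>\<^sub>F n in sequentially. D n < e"
  proof (cases "4 * A < e")
    case True
    have "D n < e" for n using le_less_trans[OF Dle True] .
    then show ?thesis by simp
  next
    case False
    then have "ennreal (4 * A - e) < ennreal (4 * A)" using e by (intro ennreal_lessI) auto
    also note *
    finally have "\<forall>\<^sub>F n in sequentially. ennreal (4 * A - e) < ennreal (4 * A - D n)" by (rule less_LiminfD)
    then show ?thesis by eventually_elim (use False Dle in \<open>auto simp: ennreal_less_iff\<close>)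
  qed
  then show "\<exists>N. \<forall>n\<ge>N. norm (l2_sq lborel (\<lambda>x. f (x + s n) - f x) - 0) < e"
    unfolding eventually_sequentially by (simp add: D_def)
qed

text \<open>Jensen's inequality by Cauchy-Schwarz: sqrt Q (h - c) is paired with sqrt Q, which has
  norm 1. Integrability of \<open>Q * h\<close> is not presupposed; it follows when the right-hand
  side is finite, and otherwise the claim is trivial.\<close>

lemma average_sq_le:
  fixes h :: "'a \<Rightarrow> complex"
  assumes [measurable]: "Q \<in> borel_measurable M" "h \<in> borel_measurable M"
    and Q: "\<And>x. 0 \<le> Q x" "(\<integral>\<^sup>+x. ennreal (Q x) \<partial>M) = 1"
  shows "ennreal ((cmod ((\<integral>x. of_real (Q x) * h x \<partial>M) - c))\<^sup>2) \<le> (\<integral>\<^sup>+x. ennreal (Q x * (cmod (h x - c))\<^sup>2) \<partial>M)"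
proof (cases "(\<integral>\<^sup>+x. ennreal (Q x * (cmod (h x - c))\<^sup>2) \<partial>M) < \<infinity>")
  case True
  define r where "r x = complex_of_real (sqrt (Q x))" for x
  define f where "f x = r x * (h x - c)" for x
  have [measurable]: "r \<in> borel_measurable M" "f \<in> borel_measurable M"
    unfolding r_def f_def by measurable
  have r: "(cmod (r x))\<^sup>2 = Q x" "r x * cnj (r x) = of_real (Q x)" for x
    using Q(1)[of x] by (simp_all add: r_def flip: of_real_mult)
  have f: "(cmod (f x))\<^sup>2 = Q x * (cmod (h x - c))\<^sup>2" for x
    by (simp add: f_def norm_mult power_mult_distrib r)
  have sr: "square_integrable M r" by (rule square_integrableI_nn) (simp_all add: r Q)
  have sf: "square_integrable M f" by (rule square_integrableI_nn) (use True in \<open>simp_all add: f\<close>)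
  have "ennreal (l2_sq M r) = 1" using nn_integral_l2_sq[OF sr] by (simp add: r Q)
  then have l2r: "l2_sq M r = 1" by simp
  have "l2_inner M f r = (\<integral>x. of_real (Q x) * h x \<partial>M) - c"
  proof -
    have fr: "f x * cnj (r x) = of_real (Q x) * h x - c * (r x * cnj (r x))" for x
      by (simp add: f_def r(2)[symmetric] algebra_simps)
    have i1: "integrable M (\<lambda>x. f x * cnj (r x))" by (rule l2_inner_integrable[OF sf sr])
    have i2: "integrable M (\<lambda>x. c * (r x * cnj (r x)))" by (intro integrable_mult_right l2_inner_integrable sr)
    have "integrable M (\<lambda>x. f x * cnj (r x) + c * (r x * cnj (r x)))" by (rule Bochner_Integration.integrable_add[OF i1 i2])
    then have i3: "integrable M (\<lambda>x. of_real (Q x) * h x)" unfolding fr by simp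
    have "l2_inner M f r = (\<integral>x. of_real (Q x) * h x \<partial>M) - c * l2_inner M r r"
      unfolding l2_inner_def fr using i3 i2 by simp
    then show ?thesis by (simp add: l2_inner_self l2r)
  qed
  then have "cmod ((\<integral>x. of_real (Q x) * h x \<partial>M) - c) \<le> sqrt (l2_sq M f)"
    using l2_Cauchy_Schwarz[OF sf sr] by (simp add: l2r)
  from power_mono[OF this, of 2] have "(cmod ((\<integral>x. of_real (Q x) * h x \<partial>M) - c))\<^sup>2 \<le> l2_sq M f" by simp
  then have "ennreal ((cmod ((\<integral>x. of_real (Q x) * h x \<partial>M) - c))\<^sup>2) \<le> ennreal (l2_sq M f)" by (rule ennreal_leI)
  then show ?thesis using nn_integral_l2_sq[OF sf] by (simp add: f)
next
  case False
  then show ?thesis by (simp add: less_top[symmetric])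
qed

text \<open>\<open>T n p\<close> is at once the pairing with the kernel whose pole is raised by
  \<open>height n\<close> and a Poisson average of the slice. The first description gives a
  pointwise limit, the second an L2 limit; they agree almost everywhere.\<close>

lemma hardy_reproducing_AE:
  fixes F :: "complex ^ 'n \<Rightarrow> complex"
  assumes F: "F \<in> hardy_space" and y: "y \<in> octant"
  shows "AE x in lborel. hardy_inner F (kernel_at (re_im_vec x y)) = F (re_im_vec x y)"
proof -
  define f where "f = slice F y"
  define T where "T n p = hardy_inner F (kernel_at (re_im_vec p (y + height n)))" for n p
  define c where "c n = inverse (real (Suc n))" for n
  have c: "0 < c n" for n by (simp add: c_def)
  have sf: "square_integrable lborel f" unfolding f_def by (rule slice_square_integrable[OF F y])
  have cf: "continuous_on UNIV f" unfolding f_def by (rule slice_continuous[OF hardy_space_holomorphic[OF F] y])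
  have [measurable]: "f \<in> borel_measurable borel" by (rule borel_measurable_continuous_onI[OF cf])
  have [measurable]: "poisson1 \<in> borel_measurable borel" by (rule borel_measurable_continuous_onI[OF poisson1_continuous])
  have T: "T n p = (\<integral>s. of_real (poisson1 s) * f (p + c n *\<^sub>R s) \<partial>lborel)" for n p
    unfolding T_def f_def using hardy_inner_kernel_at_poisson[OF F y c[of n], of p] by (simp add: height_def c_def)
  have [measurable]: "T n \<in> borel_measurable lborel" for n
    unfolding T[abs_def] by measurable
  \<comment> \<open>Jensen for each p, then Tonelli: the L2 error of the average is at most the
    average of the L2 translation errors.\<close>
  have bound: "(\<integral>\<^sup>+p. ennreal ((cmod (T n p - f p))\<^sup>2) \<partial>lborel) \<le>
    (\<integral>\<^sup>+s. ennreal (poisson1 s * l2_sq lborel (\<lambda>p. f (p + c n *\<^sub>R s) - f p)) \<partial>lborel)" for n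
  proof -
    have "(\<integral>\<^sup>+p. ennreal ((cmod (T n p - f p))\<^sup>2) \<partial>lborel) \<le>
      (\<integral>\<^sup>+p. \<integral>\<^sup>+s. ennreal (poisson1 s * (cmod (f (p + c n *\<^sub>R s) - f p))\<^sup>2) \<partial>lborel \<partial>lborel)"
      unfolding T by (intro nn_integral_mono average_sq_le poisson1_nonneg nn_integral_poisson1) auto
    also have "\<dots> = (\<integral>\<^sup>+s. \<integral>\<^sup>+p. ennreal (poisson1 s * (cmod (f (p + c n *\<^sub>R s) - f p))\<^sup>2) \<partial>lborel \<partial>lborel)"
      by (rule lborel_pair.Fubini'[symmetric]) measurable
    also have "\<dots> = (\<integral>\<^sup>+s. ennreal (poisson1 s * l2_sq lborel (\<lambda>p. f (p + c n *\<^sub>R s) - f p)) \<partial>lborel)"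
    proof (rule nn_integral_cong)
      fix s
      have "(\<integral>\<^sup>+p. ennreal (poisson1 s * (cmod (f (p + c n *\<^sub>R s) - f p))\<^sup>2) \<partial>lborel) =
        ennreal (poisson1 s) * (\<integral>\<^sup>+p. ennreal ((cmod (f (p + c n *\<^sub>R s) - f p))\<^sup>2) \<partial>lborel)"
        by (subst nn_integral_cmult[symmetric]) (auto simp: ennreal_mult poisson1_nonneg)
      then show "(\<integral>\<^sup>+p. ennreal (poisson1 s * (cmod (f (p + c n *\<^sub>R s) - f p))\<^sup>2) \<partial>lborel) =
        ennreal (poisson1 s * l2_sq lborel (\<lambda>p. f (p + c n *\<^sub>R s) - f p))"
        unfolding nn_integral_l2_sq[OF square_integrable_diff[OF l2_translate(1)[OF sf] sf]]
        by (simp add: ennreal_mult poisson1_nonneg)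
    qed
    finally show ?thesis .
  qed
  have meas_l2: "(\<lambda>s. ennreal (poisson1 s * l2_sq lborel (\<lambda>p. f (p + c n *\<^sub>R s) - f p))) \<in> borel_measurable lborel" for n
    unfolding l2_sq_def by measurable
  have "(\<lambda>n. \<integral>\<^sup>+s. ennreal (poisson1 s * l2_sq lborel (\<lambda>p. f (p + c n *\<^sub>R s) - f p)) \<partial>lborel) \<longlonglongrightarrow>
    (\<integral>\<^sup>+s. 0 \<partial>(lborel :: (real ^ 'n) measure))"
  proof (rule nn_integral_dominated_convergence[where w = "\<lambda>s. ennreal (4 * l2_sq lborel f) * ennreal (poisson1 s)"])
    show "(\<integral>\<^sup>+s. ennreal (4 * l2_sq lborel f) * ennreal (poisson1 s) \<partial>lborel) < \<infinity>"
      by (subst nn_integral_cmult) (auto simp: nn_integral_poisson1)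
    show "AE s in lborel. ennreal (poisson1 s * l2_sq lborel (\<lambda>p. f (p + c n *\<^sub>R s) - f p)) \<le>
        ennreal (4 * l2_sq lborel f) * ennreal (poisson1 s)" for n
    proof (rule AE_I2)
      fix s
      have "poisson1 s * l2_sq lborel (\<lambda>p. f (p + c n *\<^sub>R s) - f p) \<le> poisson1 s * (4 * l2_sq lborel f)"
        by (intro mult_left_mono l2_translate_diff_le sf poisson1_nonneg)
      from ennreal_leI[OF this]
      show "ennreal (poisson1 s * l2_sq lborel (\<lambda>p. f (p + c n *\<^sub>R s) - f p)) \<le>
        ennreal (4 * l2_sq lborel f) * ennreal (poisson1 s)"
        by (simp add: ennreal_mult poisson1_nonneg mult_ac)
    qed
    show "AE s in lborel. (\<lambda>n. ennreal (poisson1 s * l2_sq lborel (\<lambda>p. f (p + c n *\<^sub>R s) - f p))) \<longlonglongrightarrow> 0"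
    proof (rule AE_I2)
      fix s :: "real ^ 'n"
      have "(\<lambda>n. c n *\<^sub>R s) \<longlonglongrightarrow> 0"
        using tendsto_scaleR[OF LIMSEQ_inverse_real_of_nat tendsto_const[of s]] by (simp add: c_def)
      then have "(\<lambda>n. poisson1 s * l2_sq lborel (\<lambda>p. f (p + c n *\<^sub>R s) - f p)) \<longlonglongrightarrow> poisson1 s * 0"
        by (intro tendsto_mult tendsto_const l2_translate_tendsto sf cf)
      from tendsto_ennrealI[OF this]
      show "(\<lambda>n. ennreal (poisson1 s * l2_sq lborel (\<lambda>p. f (p + c n *\<^sub>R s) - f p))) \<longlonglongrightarrow> 0" by simp
    qed
  qed (use meas_l2 in auto)
  then have l2: "(\<lambda>n. \<integral>\<^sup>+p. ennreal ((cmod (T n p - f p))\<^sup>2) \<partial>lborel) \<longlonglongrightarrow> 0"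
    by (intro tendsto_sandwich[OF _ always_eventually[OF allI[OF bound]] tendsto_const[of 0]]) auto
  have lim: "(\<lambda>n. T n p) \<longlonglongrightarrow> hardy_inner F (kernel_at (re_im_vec p y))" for p
    unfolding T_def by (rule hardy_inner_kernel_at_tendsto[OF F y])
  have "AE p in lborel. hardy_inner F (kernel_at (re_im_vec p y)) = f p"
  proof (rule l2_limit_AE_unique[OF _ _ _ _ l2])
    show "(\<lambda>p. hardy_inner F (kernel_at (re_im_vec p y))) \<in> borel_measurable lborel"
      by (rule borel_measurable_LIMSEQ_metric[OF _ lim]) simp
  qed (use lim in auto)
  then show ?thesis by (simp add: f_def slice_def)
qed

section \<open>Gram-Schmidt residuals\<close>

text \<open>A vanishing Gram-Schmidt step produces the zero function, since division by the norm 0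
  gives 0.\<close>

definition orthonormal_or_zero :: "(nat \<Rightarrow> complex ^ 'n \<Rightarrow> complex) \<Rightarrow> nat \<Rightarrow> bool" where
  "orthonormal_or_zero B m \<longleftrightarrow>
    (\<forall>i<m. B i \<in> hardy_space \<and> (B i = (\<lambda>w. 0) \<or> hardy_inner (B i) (B i) = 1)) \<and>
    (\<forall>i<m. \<forall>j<m. i \<noteq> j \<longrightarrow> hardy_inner (B i) (B j) = 0)"

text \<open>Projection off the first \<open>m\<close> vectors. The same operation produces the
  approximation error of \<open>F\<close> and the unnormalised Gram-Schmidt vectors.\<close>

definition residual ::
    "(nat \<Rightarrow> complex ^ 'n \<Rightarrow> complex) \<Rightarrow> (complex ^ 'n \<Rightarrow> complex) \<Rightarrow> nat \<Rightarrow> complex ^ 'n \<Rightarrow> complex" where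
  "residual B F m = (\<lambda>w. F w - (\<Sum>k<m. hardy_inner F (B k) * B k w))"

lemma gram_schmidt_residual:
  "gram_schmidt V k = (\<lambda>w. residual (gram_schmidt V) (V k) k w / of_real (hardy_norm (residual (gram_schmidt V) (V k) k)))"
  by (subst gram_schmidt.simps) (simp add: residual_def Let_def)

lemma orthonormal_or_zero_mono: "orthonormal_or_zero B m \<Longrightarrow> k \<le> m \<Longrightarrow> orthonormal_or_zero B k"
  by (auto simp: orthonormal_or_zero_def)

lemma residual_in_hardy_space:
  assumes "orthonormal_or_zero B m" "F \<in> hardy_space"
  shows "residual B F m \<in> hardy_space"
  unfolding residual_def
  by (intro hardy_space_diff hardy_space_sum hardy_space_cmult assms(2))
     (use assms(1) in \<open>auto simp: orthonormal_or_zero_def\<close>)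

lemma hardy_inner_residual:
  assumes B: "orthonormal_or_zero B m" and F: "F \<in> hardy_space" and H: "H \<in> hardy_space"
  shows "hardy_inner (residual B F m) H = hardy_inner F H - (\<Sum>k<m. hardy_inner F (B k) * hardy_inner (B k) H)"
proof -
  have Bk: "B k \<in> hardy_space" if "k < m" for k using B that by (simp add: orthonormal_or_zero_def)
  have S: "(\<lambda>w. \<Sum>k<m. hardy_inner F (B k) * B k w) \<in> hardy_space"
    by (intro hardy_space_sum hardy_space_cmult Bk) auto
  have "hardy_inner (\<lambda>w. \<Sum>k<m. hardy_inner F (B k) * B k w) H =
      (\<Sum>k<m. hardy_inner (\<lambda>w. hardy_inner F (B k) * B k w) H)"
    by (rule hardy_inner_sum) (auto intro: hardy_space_cmult Bk H)
  also have "\<dots> = (\<Sum>k<m. hardy_inner F (B k) * hardy_inner (B k) H)"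
    by (intro sum.cong refl hardy_inner_cmult Bk H) simp
  finally show ?thesis
    unfolding residual_def hardy_inner_diff[OF F S H] by simp
qed

lemma residual_orthogonal:
  assumes B: "orthonormal_or_zero B m" and F: "F \<in> hardy_space" and j: "j < m"
  shows "hardy_inner (residual B F m) (B j) = 0" "hardy_inner (B j) (residual B F m) = 0"
proof -
  have Bj: "B j \<in> hardy_space" using B j by (simp add: orthonormal_or_zero_def)
  have "(\<Sum>k<m. hardy_inner F (B k) * hardy_inner (B k) (B j)) =
    (\<Sum>k<m. if k = j then hardy_inner F (B j) * hardy_inner (B j) (B j) else 0)"
    using B j by (intro sum.cong) (auto simp: orthonormal_or_zero_def)
  also have "\<dots> = hardy_inner F (B j) * hardy_inner (B j) (B j)" using j by simp
  \<comment> \<open>For a vanishing \<open>B j\<close> the squared norm is 0 instead of 1, but then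
    the coefficient of \<open>F\<close> is 0 too.\<close>
  also have "\<dots> = hardy_inner F (B j)"
  proof (cases "B j = (\<lambda>w. 0)")
    case True
    have "hardy_inner F (\<lambda>w. 0) = cnj (hardy_inner (\<lambda>w. 0) F)"
      by (rule hardy_inner_cnj[symmetric]) (simp_all add: F hardy_space_zero)
    then show ?thesis using hardy_inner_zero[OF F] True by simp
  next
    case False
    then show ?thesis using B j by (auto simp: orthonormal_or_zero_def)
  qed
  finally show 1: "hardy_inner (residual B F m) (B j) = 0"
    by (simp add: hardy_inner_residual[OF B F Bj])
  show "hardy_inner (B j) (residual B F m) = 0"
    using hardy_inner_cnj[OF residual_in_hardy_space[OF B F] Bj] 1 by simp
qed

text \<open>Passing from \<open>G\<close> to its residual only subtracts vectors \<open>B k\<close>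
  with k < m \<le> l, all orthogonal to the later residual.\<close>

lemma residual_inner_right:
  assumes B: "orthonormal_or_zero B l" and m: "m \<le> l" and F: "F \<in> hardy_space" and G: "G \<in> hardy_space"
  shows "hardy_inner (residual B G m) (residual B F l) = hardy_inner G (residual B F l)"
  using hardy_inner_residual[OF orthonormal_or_zero_mono[OF B m] G residual_in_hardy_space[OF B F]]
    residual_orthogonal(2)[OF B F] m by simp

text \<open>Self-adjointness of an orthogonal projection, obtained by projecting both arguments; it
  lets a residual of \<open>F\<close> be traded for a residual of the kernel.\<close>

lemma residual_swap:
  assumes B: "orthonormal_or_zero B m" and F: "F \<in> hardy_space" and G: "G \<in> hardy_space"
  shows "hardy_inner F (residual B G m) = hardy_inner (residual B F m) G"
proof -
  note R = residual_in_hardy_space[OF B]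
  have "hardy_inner F (residual B G m) = hardy_inner (residual B F m) (residual B G m)"
    using residual_inner_right[OF B order_refl G F] by simp
  also have "\<dots> = cnj (hardy_inner (residual B G m) (residual B F m))"
    by (simp add: hardy_inner_cnj R F G)
  also have "\<dots> = cnj (hardy_inner G (residual B F m))"
    using residual_inner_right[OF B order_refl F G] by simp
  also have "\<dots> = hardy_inner (residual B F m) G"
    by (simp add: hardy_inner_cnj R F G)
  finally show ?thesis .
qed

lemma hardy_norm_diff:
  assumes F: "F \<in> hardy_space" and G: "G \<in> hardy_space"
  shows "(hardy_norm (\<lambda>w. F w - G w))\<^sup>2 = (hardy_norm F)\<^sup>2 + (hardy_norm G)\<^sup>2 - 2 * Re (hardy_inner F G)"
proof -
  have FG: "(\<lambda>w. F w - G w) \<in> hardy_space" by (rule hardy_space_diff[OF F G])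
  have right: "hardy_inner H (\<lambda>w. F w - G w) = hardy_inner H F - hardy_inner H G" if "H \<in> hardy_space" for H
    using hardy_inner_diff[OF F G that] hardy_inner_cnj[OF that F] hardy_inner_cnj[OF that G] hardy_inner_cnj[OF FG that]
    by (metis complex_cnj_cnj complex_cnj_diff hardy_inner_cnj[OF that F])
  have "complex_of_real ((hardy_norm (\<lambda>w. F w - G w))\<^sup>2) =
    hardy_inner F F - hardy_inner F G - (hardy_inner G F - hardy_inner G G)"
    unfolding hardy_inner_self[OF FG, symmetric] hardy_inner_diff[OF F G FG] right[OF F] right[OF G] ..
  also have "\<dots> =
    of_real ((hardy_norm F)\<^sup>2) + of_real ((hardy_norm G)\<^sup>2) - (hardy_inner F G + cnj (hardy_inner F G))"
    unfolding hardy_inner_self[OF F] hardy_inner_self[OF G] hardy_inner_cnj[OF F G] by simp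
  also have "hardy_inner F G + cnj (hardy_inner F G) = of_real (2 * Re (hardy_inner F G))"
    by (simp add: complex_add_cnj)
  finally show ?thesis
    by (simp only: of_real_add[symmetric] of_real_diff[symmetric] of_real_eq_iff)
qed

text \<open>Pythagoras: the inner product of an earlier with a later residual is the squared norm of
  the later one.\<close>

lemma residual_norm_diff:
  assumes B: "orthonormal_or_zero B l" and m: "m \<le> l" and F: "F \<in> hardy_space"
  shows "(hardy_norm (\<lambda>w. residual B F m w - residual B F l w))\<^sup>2 =
    (hardy_norm (residual B F m))\<^sup>2 - (hardy_norm (residual B F l))\<^sup>2"
proof -
  have "hardy_inner (residual B F m) (residual B F l) = hardy_inner (residual B F l) (residual B F l)"
    using residual_inner_right[OF B m F F] residual_inner_right[OF B order_refl F F] by simp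
  then have "Re (hardy_inner (residual B F m) (residual B F l)) = (hardy_norm (residual B F l))\<^sup>2"
    by (simp add: hardy_inner_self residual_in_hardy_space[OF B F])
  then show ?thesis
    using hardy_norm_diff[OF residual_in_hardy_space[OF orthonormal_or_zero_mono[OF B m] F] residual_in_hardy_space[OF B F]]
    by simp
qed

lemma hardy_norm_residual_le:
  assumes B: "orthonormal_or_zero B m" and F: "F \<in> hardy_space"
  shows "hardy_norm (residual B F m) \<le> hardy_norm F"
proof -
  have "(hardy_norm (residual B F m))\<^sup>2 \<le> (hardy_norm (residual B F 0))\<^sup>2"
    using residual_norm_diff[OF B _ F, of 0] zero_le_power2 by (metis diff_ge_0_iff_ge le0)
  then show ?thesis by (simp add: residual_def)
qed

text \<open>Multiplying by the norm instead of dividing covers the degenerate case, where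
  Cauchy-Schwarz makes both sides 0.\<close>

lemma hardy_inner_normalized:
  assumes R: "R \<in> hardy_space" and F: "F \<in> hardy_space"
  shows "cmod (hardy_inner F (\<lambda>w. R w / of_real (hardy_norm R))) * hardy_norm R = cmod (hardy_inner F R)"
proof (cases "hardy_norm R = 0")
  case True
  then show ?thesis using hardy_Cauchy_Schwarz[OF F R] by simp
next
  case False
  define c where "c = complex_of_real (inverse (hardy_norm R))"
  have eq: "(\<lambda>w. R w / of_real (hardy_norm R)) = (\<lambda>w. c * R w)"
    by (simp add: c_def divide_inverse mult.commute)
  have "hardy_inner F (\<lambda>w. c * R w) = cnj (c * hardy_inner R F)"
    using hardy_inner_cnj[OF hardy_space_cmult[OF R] F, of c] hardy_inner_cmult[OF R F, of c] by simp
  then have h: "cmod (hardy_inner F (\<lambda>w. c * R w)) = cmod c * cmod (cnj (hardy_inner R F))"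
    by (simp add: norm_mult)
  have nc: "cmod c = inverse (hardy_norm R)"
    unfolding c_def norm_of_real by simp
  show ?thesis
    unfolding eq h nc hardy_inner_cnj[OF R F] using False by simp
qed

lemma orthonormal_or_zero_step:
  assumes B: "orthonormal_or_zero B k" and G: "G \<in> hardy_space"
    and Bk: "B k = (\<lambda>w. residual B G k w / of_real (hardy_norm (residual B G k)))"
  shows "orthonormal_or_zero B (Suc k)"
proof -
  define R where "R = residual B G k"
  define c where "c = complex_of_real (inverse (hardy_norm R))"
  have R: "R \<in> hardy_space" unfolding R_def by (rule residual_in_hardy_space[OF B G])
  have eq: "B k = (\<lambda>w. c * R w)"
    unfolding Bk R_def[symmetric] by (simp add: c_def divide_inverse mult.commute)
  have H: "B k \<in> hardy_space" unfolding eq by (rule hardy_space_cmult[OF R])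
  have Bi: "B i \<in> hardy_space" if "i < k" for i using B that by (simp add: orthonormal_or_zero_def)
  have o: "hardy_inner (B k) (B i) = 0" if "i < k" for i
    unfolding eq using hardy_inner_cmult[OF R Bi[OF that], of c] residual_orthogonal(1)[OF B G that]
    by (simp add: R_def)
  then have o': "hardy_inner (B i) (B k) = 0" if "i < k" for i
    using hardy_inner_cnj[OF H Bi[OF that]] that by simp
  have "B k = (\<lambda>w. 0) \<or> hardy_inner (B k) (B k) = 1"
  proof (cases "hardy_norm R = 0")
    case True
    then show ?thesis by (simp add: eq c_def)
  next
    case False
    have "hardy_inner (B k) (B k) = c * hardy_inner R (B k)"
      using hardy_inner_cmult[OF R H, of c] by (simp add: eq)
    also have "hardy_inner R (B k) = cnj (c * hardy_inner R R)"
      using hardy_inner_cmult[OF R R, of c] hardy_inner_cnj[OF H R] by (simp add: eq)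
    also have "c * cnj (c * hardy_inner R R) =
        of_real (inverse (hardy_norm R) * (inverse (hardy_norm R) * (hardy_norm R)\<^sup>2))"
      unfolding hardy_inner_self[OF R] c_def
      by (simp only: of_real_mult complex_cnj_mult complex_cnj_complex_of_real)
    also have "inverse (hardy_norm R) * (inverse (hardy_norm R) * (hardy_norm R)\<^sup>2) = 1"
      using False by (simp add: power2_eq_square field_simps)
    also have "complex_of_real 1 = 1" by simp
    finally show ?thesis ..
  qed
  with B H o o' show ?thesis
    unfolding orthonormal_or_zero_def by (auto simp: less_Suc_eq)
qed

lemma gram_schmidt_orthonormal_or_zero:
  assumes "\<And>k. V k \<in> hardy_space"
  shows "orthonormal_or_zero (gram_schmidt V) m"
proof (induction m)
  case 0
  show ?case by (simp add: orthonormal_or_zero_def)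
next
  case (Suc m)
  show ?case by (rule orthonormal_or_zero_step[OF Suc assms gram_schmidt_residual])
qed

text \<open>\<open>candidate\<close> orthonormalises a list whose initial part is already
  orthonormal up to zeros, so that part must come back unchanged. Unit vectors are divided by 1,
  zero vectors stay zero under division by 0.\<close>

lemma gram_schmidt_fixes_orthonormal_or_zero:
  assumes B: "orthonormal_or_zero B m" and j: "j < m"
  shows "gram_schmidt (B(m := \<Phi>)) j = B j"
  using j
proof (induction j rule: less_induct)
  case (less j)
  have "residual (gram_schmidt (B(m := \<Phi>))) (B j) j = B j"
  proof -
    have "(\<Sum>i<j. hardy_inner (B j) (gram_schmidt (B(m := \<Phi>)) i) * gram_schmidt (B(m := \<Phi>)) i w) = 0" for w
    proof (rule sum.neutral, rule ballI)
      fix i assume "i \<in> {..<j}"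
      then have i: "i < j" by simp
      then have "gram_schmidt (B(m := \<Phi>)) i = B i"
        by (rule less.IH) (use i less.prems in simp)
      moreover have "hardy_inner (B j) (B i) = 0"
        using i less.prems B by (auto simp: orthonormal_or_zero_def)
      ultimately
      show "hardy_inner (B j) (gram_schmidt (B(m := \<Phi>)) i) * gram_schmidt (B(m := \<Phi>)) i w = 0"
        by simp
    qed
    then show ?thesis by (simp add: residual_def)
  qed
  then have eq: "gram_schmidt (B(m := \<Phi>)) j = (\<lambda>w. B j w / of_real (hardy_norm (B j)))"
    using less(2) by (subst gram_schmidt_residual) simp
  have Bj: "B j \<in> hardy_space" and "B j = (\<lambda>w. 0) \<or> hardy_inner (B j) (B j) = 1"
    using B less(2) by (auto simp: orthonormal_or_zero_def)
  from this(2) show ?case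
  proof
    assume "hardy_inner (B j) (B j) = 1"
    then have "(hardy_norm (B j))\<^sup>2 = 1"
      unfolding hardy_inner_self[OF Bj] by (simp only: of_real_eq_1_iff)
    then have "hardy_norm (B j) = 1" by (simp add: power2_eq_1_iff)
         (metis hardy_norm_nonneg le_minus_one_simps(3))
    then show ?thesis unfolding eq by simp
  next
    assume "B j = (\<lambda>w. 0)"
    then show ?thesis unfolding eq by simp
  qed
qed

lemma gram_schmidt_last:
  assumes B: "orthonormal_or_zero B m"
  shows "gram_schmidt (B(m := \<Phi>)) m = (\<lambda>w. residual B \<Phi> m w / of_real (hardy_norm (residual B \<Phi> m)))"
proof -
  have "residual (gram_schmidt (B(m := \<Phi>))) \<Phi> m = residual B \<Phi> m"
    unfolding residual_def using gram_schmidt_fixes_orthonormal_or_zero[OF B] by simp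
  then show ?thesis by (subst gram_schmidt_residual) simp
qed

section \<open>Decay of the residuals under maximal selection\<close>

theorem theorem3p1:
  fixes d :: "complex ^ 'n"
    and F :: "complex ^ 'n \<Rightarrow> complex"
    and zs :: "nat \<Rightarrow> complex ^ 'n"
  assumes "(\<Sum>j\<in>UNIV. (cmod (d $ j))\<^sup>2) = 1"
    and "F \<in> hardy_space"
    and "\<And>k. zs k \<in> tube"
    and "\<And>m z. z \<in> tube \<Longrightarrow>
      cmod (hardy_inner F (candidate d zs m z)) \<le> cmod (hardy_inner F (candidate d zs m (zs m)))"
  shows "(\<lambda>m. hardy_norm (\<lambda>w. F w - partial_sum d zs F m w)) \<longlonglongrightarrow> 0"
proof -
  note F = assms(2)
  define B where "B = orthonormal_system d zs"
  define R where "R m = residual B F m" for m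
  define b where "b m = (hardy_norm (R m))\<^sup>2" for m
  have V: "multiple_kernel d zs k \<in> hardy_space" for k
    by (rule multiple_kernel_in_hardy_space[OF assms(3)])
  have B: "orthonormal_or_zero B m" for m
    unfolding B_def orthonormal_system_def by (rule gram_schmidt_orthonormal_or_zero[OF V])
  have RH: "R m \<in> hardy_space" for m
    unfolding R_def by (rule residual_in_hardy_space[OF B F])
  have bdiff: "(hardy_norm (\<lambda>w. R m w - R l w))\<^sup>2 = b m - b l" if "m \<le> l" for m l
    unfolding R_def b_def by (rule residual_norm_diff[OF B that F])
  have "decseq b"
    unfolding decseq_def using bdiff by (metis diff_ge_0_iff_ge zero_le_power2)
  moreover have "0 \<le> b m" for m by (simp add: b_def)
  ultimately obtain \<beta> where \<beta>: "b \<longlonglongrightarrow> \<beta>" "\<And>m. \<beta> \<le> b m"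
    using decseq_convergent[of b 0] by auto
  define c where "c m = hardy_inner F (B m)" for m
  have c0: "(\<lambda>m. (cmod (c m))\<^sup>2) \<longlonglongrightarrow> 0"
  proof -
    \<comment> \<open>One step removes \<open>c m * B m\<close> from the residual. An inequality is
      enough and includes the degenerate case \<open>B m = 0\<close>, where
      \<open>c m = 0\<close>.\<close>
    have bound: "norm ((cmod (c m))\<^sup>2) \<le> b m - b (Suc m)" for m
    proof -
      have Bm: "B m \<in> hardy_space" "B m = (\<lambda>w. 0) \<or> hardy_inner (B m) (B m) = 1"
        using B[of "Suc m"] by (auto simp: orthonormal_or_zero_def)
      have cm: "cmod (c m) \<le> cmod (hardy_inner (\<lambda>w. c m * B m w) (B m))"
      proof -
        have "hardy_inner F (\<lambda>w. 0) = 0"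
          using hardy_inner_cnj[OF hardy_space_zero F] hardy_inner_zero[OF F] by simp
        then show ?thesis
          using Bm(2) hardy_inner_cmult[OF Bm(1) Bm(1), of "c m"] by (auto simp: c_def)
      qed
      have eq: "(\<lambda>w. R m w - R (Suc m) w) = (\<lambda>w. c m * B m w)"
        by (simp add: R_def residual_def c_def)
      have nB: "hardy_norm (B m) \<le> 1"
      proof -
        have "cmod (hardy_inner (B m) (B m)) \<le> 1" using Bm(2) hardy_inner_zero[OF Bm(1)] by auto
        then have "(hardy_norm (B m))\<^sup>2 \<le> 1" by (simp add: hardy_inner_self[OF Bm(1)] norm_power)
        then have "(hardy_norm (B m))\<^sup>2 \<le> 1\<^sup>2" by simp
        then show ?thesis by (rule power2_le_imp_le) simp
      qed
      have "cmod (c m) \<le> hardy_norm (\<lambda>w. c m * B m w) * hardy_norm (B m)"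
        using cm hardy_Cauchy_Schwarz[OF hardy_space_cmult[OF Bm(1), of "c m"] Bm(1)] by simp
      also have "\<dots> \<le> hardy_norm (\<lambda>w. c m * B m w) * 1"
        by (intro mult_left_mono nB) simp
      finally have "(cmod (c m))\<^sup>2 \<le> (hardy_norm (\<lambda>w. c m * B m w))\<^sup>2"
        by (intro power_mono) simp_all
      also have "\<dots> = b m - b (Suc m)" using bdiff[of m "Suc m"] by (simp add: eq)
      finally show ?thesis by simp
    qed
    have "(\<lambda>m. b m - b (Suc m)) \<longlonglongrightarrow> \<beta> - \<beta>"
      by (rule tendsto_diff[OF \<beta>(1) LIMSEQ_Suc[OF \<beta>(1)]])
    then have "(\<lambda>m. b m - b (Suc m)) \<longlonglongrightarrow> 0" by simp
    then show ?thesis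
      by (rule Lim_null_comparison[OF always_eventually[OF allI[OF bound]]])
  qed
  then have c: "(\<lambda>m. cmod (c m)) \<longlonglongrightarrow> 0"
    using tendsto_real_sqrt[OF c0] by simp
  have cand: "candidate d zs m z = (\<lambda>w. residual B (multiple_kernel d (zs(m := z)) m) m w /
      of_real (hardy_norm (residual B (multiple_kernel d (zs(m := z)) m) m)))" for m z
    unfolding candidate_def B_def[symmetric] by (rule gram_schmidt_last[OF B])
  \<comment> \<open>Overwriting \<open>zs\<close> at \<open>m\<close> by its own value changes
    nothing, so the candidate at the selected point is the next Gram-Schmidt vector.\<close>
  have cand_self: "candidate d zs m (zs m) = B m" for m
    unfolding cand B_def orthonormal_system_def by (subst gram_schmidt_residual) simp
  have kernel0: "(\<lambda>m. hardy_inner (R m) (kernel_at a)) \<longlonglongrightarrow> 0" if a: "a \<in> tube" "a \<notin> range zs" for a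
  proof -
    note K = kernel_at_in_hardy_space[OF a(1)]
    have bound: "cmod (hardy_inner (R m) (kernel_at a)) \<le> hardy_norm (kernel_at a) * cmod (c m)" for m
    proof -
      have mk: "multiple_kernel d (zs(m := a)) m = kernel_at a"
        using multiple_kernel_first_occurrence[of m "zs(m := a)" d] a(2) by auto
      \<comment> \<open>The projection is moved from \<open>F\<close> to the kernel; normalising the
        projected kernel gives the candidate at \<open>a\<close>, to which maximality
        applies.\<close>
      have "cmod (hardy_inner (R m) (kernel_at a)) = cmod (hardy_inner F (residual B (kernel_at a) m))"
        unfolding R_def by (simp add: residual_swap[OF B F K])
      also have "\<dots> = cmod (hardy_inner F (candidate d zs m a)) * hardy_norm (residual B (kernel_at a) m)"
        unfolding cand mk by (rule hardy_inner_normalized[symmetric, OF residual_in_hardy_space[OF B K] F])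
      also have "\<dots> \<le> cmod (c m) * hardy_norm (kernel_at a)"
        using assms(4)[OF a(1), of m] unfolding cand_self c_def
        by (intro mult_mono hardy_norm_residual_le B K) auto
      finally show ?thesis by (simp add: mult.commute)
    qed
    have "(\<lambda>m. hardy_norm (kernel_at a) * cmod (c m)) \<longlonglongrightarrow> hardy_norm (kernel_at a) * 0"
      by (intro tendsto_intros c)
    then have "(\<lambda>m. hardy_norm (kernel_at a) * cmod (c m)) \<longlonglongrightarrow> 0" by simp
    then show ?thesis by (rule Lim_null_comparison[OF always_eventually[OF allI[OF bound]]])
  qed
  have "b m \<le> b m - \<beta>" for m
  proof -
    have "(\<integral>\<^sup>+x. ennreal ((cmod (slice (R m) y x))\<^sup>2) \<partial>lborel) \<le> ennreal (b m - \<beta>)" if y: "y \<in> octant" for y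
    proof -
      \<comment> \<open>At a fixed height distinct x give distinct tube points, so at most countably
        many x are excluded.\<close>
      have "countable {x. re_im_vec x y \<in> range zs}"
      proof (rule countable_image_inj_on)
        show "countable ((\<lambda>x. re_im_vec x y) ` {x. re_im_vec x y \<in> range zs})"
          by (rule countable_subset[of _ "range zs"]) auto
        show "inj_on (\<lambda>x. re_im_vec x y) {x. re_im_vec x y \<in> range zs}"
          by (auto simp: inj_on_def vec_eq_iff re_im_vec_def)
      qed
      then have "AE x in lborel. x \<notin> {x. re_im_vec x y \<in> range zs}"
        by (intro AE_not_in countable_imp_null_set_lborel)
      \<comment> \<open>Countably many residuals allow a single exceptional null set for all of
        them.\<close>
      moreover have "AE x in lborel. \<forall>l. hardy_inner (R l) (kernel_at (re_im_vec x y)) = R l (re_im_vec x y)"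
        unfolding AE_all_countable using hardy_reproducing_AE[OF RH y] by blast
      ultimately have ptw: "AE x in lborel. (\<lambda>l. slice (R m) y x - slice (R l) y x) \<longlonglongrightarrow> slice (R m) y x"
      proof eventually_elim
        case (elim x)
        have "(\<lambda>l. hardy_inner (R l) (kernel_at (re_im_vec x y))) \<longlonglongrightarrow> 0"
          using elim(1) y by (intro kernel0) auto
        then have "(\<lambda>l. slice (R l) y x) \<longlonglongrightarrow> 0" using elim(2) by (simp add: slice_def)
        from tendsto_diff[OF tendsto_const[of "slice (R m) y x"] this] show ?case by simp
      qed
      have meas [measurable]: "slice (R l) y \<in> borel_measurable lborel" for l
        using slice_square_integrable[OF RH y] by (simp add: square_integrable_def)
      \<comment> \<open>Fatou in \<open>l\<close> with \<open>m\<close> fixed.\<close>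
      have "(\<integral>\<^sup>+x. ennreal ((cmod (slice (R m) y x))\<^sup>2) \<partial>lborel) \<le>
        liminf (\<lambda>l. \<integral>\<^sup>+x. ennreal ((cmod (slice (R m) y x - slice (R l) y x))\<^sup>2) \<partial>lborel)"
        by (rule l2_Fatou[OF _ _ ptw]) measurable
      also have "\<dots> \<le> ennreal (b m - \<beta>)"
      proof (rule liminf_le_const)
        fix l assume l: "m \<le> l"
        let ?D = "\<lambda>w. R m w - R l w"
        have D: "?D \<in> hardy_space" by (intro hardy_space_diff RH)
        have "(\<integral>\<^sup>+x. ennreal ((cmod (slice ?D y x))\<^sup>2) \<partial>lborel) = ennreal (l2_sq lborel (slice ?D y))"
          by (rule nn_integral_l2_sq[OF slice_square_integrable[OF D y]])
        also have "\<dots> \<le> ennreal (b m - \<beta>)"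
          using l2_sq_slice_le[OF D y] bdiff[OF l] \<beta>(2)[of l] by (intro ennreal_leI) simp
        finally show "(\<integral>\<^sup>+x. ennreal ((cmod (slice (R m) y x - slice (R l) y x))\<^sup>2) \<partial>lborel) \<le> ennreal (b m - \<beta>)"
          by (simp add: slice_def)
      qed
      finally show ?thesis .
    qed
    then have "hardy_norm_sq (R m) \<le> ennreal (b m - \<beta>)"
      unfolding hardy_norm_sq_def slice_def by (intro SUP_least)
    \<comment> \<open>\<open>\<beta> \<le> b m\<close> keeps the right-hand side nonnegative, so the
      comparison in \<open>ennreal\<close> carries over to the reals.\<close>
    then show ?thesis
      using \<beta>(2)[of m] by (simp add: hardy_norm_sq_eq[OF RH] b_def[symmetric])
  qed
  then have "\<beta> \<le> 0" by simp
  moreover have "0 \<le> \<beta>" using \<open>\<And>m. 0 \<le> b m\<close> by (intro LIMSEQ_le_const[OF \<beta>(1)]) auto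
  ultimately have "b \<longlonglongrightarrow> 0" using \<beta>(1) by simp
  from tendsto_real_sqrt[OF this] have "(\<lambda>m. hardy_norm (R m)) \<longlonglongrightarrow> 0" by (simp add: b_def)
  moreover have "(\<lambda>w. F w - partial_sum d zs F m w) = R m" for m
    by (simp add: R_def residual_def partial_sum_def B_def)
  ultimately show ?thesis by simp
qed

end
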